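(* Let $\kappa$ be an ordinal number used as an index set. (i) Let $G$ be a topological abelian group and let $\{H_\alpha:\alpha<\kappa\}$ be a family of topological abelian groups. Then $\mathrm{Ext}(G,\prod_{\alpha<\kappa}H_\alpha)\cong\prod_{\alpha<\kappa}\mathrm{Ext}(G,H_\alpha)$. (ii) Let $Z$ be a topological vector space and let $\{Y_\alpha:\alpha<\kappa\}$ be a family of topological vector spaces. Then $\mathrm{Ext}_{\mathrm{TVS}}(Z,\prod_{\alpha<\kappa}Y_\alpha)\cong\prod_{\alpha<\kappa}\mathrm{Ext}_{\mathrm{TVS}}(Z,Y_\alpha)$. Here the products of topological groups and of topological vector spaces carry the product topology, and $\cong$ denotes isomorphism of abelian groups.
   Context: All topological groups are Hausdorff and abelian; all topological vector spaces are Hausdorff and over $\mathbb{R}$. An extension of topological abelian groups (resp. topological vector spaces) is a short exact sequence $E:0\to H\stackrel{\imath}{\to}X\stackrel{\pi}{\to}G\to 0$ of topological abelian groups (resp. topological vector spaces) in which $\imath,\pi$ are continuous homomorphisms (resp. continuous linear maps) that are open onto their images. Two extensions $0\to H\stackrel{\imath}{\to}X\stackrel{\pi}{\to}G\to 0$ and $0\to H\stackrel{\imath'}{\to}X'\stackrel{\pi'}{\to}G\to 0$ are equivalent if there is a continuous homomorphism (resp. continuous linear map) $T:X\to X'$ with $T\circ\imath=\imath'$ and $\pi'\circ T=\pi$. $\mathrm{Ext}(G,H)$ (resp. $\mathrm{Ext}_{\mathrm{TVS}}(G,H)$) is the set of equivalence classes of such extensions. It is an abelian group under the Baer sum: $[E_1]+[E_2]$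 is the class of the extension obtained from the product extension $0\to H\times H\to X_1\times X_2\to G\times G\to 0$ by pulling back along the diagonal $G\to G\times G$ and then pushing out along the addition map $H\times H\to H$ (pull-backs and push-outs taken in the respective category). The zero element is the class of the trivial extension $0\to H\to H\times G\to G\to 0$. *)

theory Defs
  imports "HOL-Analysis.Analysis" "HOL-Algebra.Product_Groups"
begin

section \<open>Topological abelian groups and topological vector spaces\<close>

text \<open>
  Groups and vector spaces live on carriers, so that a family indexed by a set may consist of
  different structures. The group operation is written multiplicatively, as in
  \<^theory>\<open>HOL-Algebra.Group\<close>, also when it is the addition of a vector space.
\<close>

record 'a tgroup = "'a monoid" +
  topol :: "'a topology"

locale top_ab_group = comm_group G for G :: "('a, 'e) tgroup_scheme" (structure) +
  assumes topspace_topol: "topspace (topol G) = carrier G"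
    and Hausdorff: "Hausdorff_space (topol G)"
    and continuous_mult:
      "continuous_map (prod_topology (topol G) (topol G)) (topol G) (\<lambda>(x, y). x \<otimes> y)"
    and continuous_inv: "continuous_map (topol G) (topol G) (\<lambda>x. inv x)"

record 'a tvs = "'a tgroup" +
  scale :: "real \<Rightarrow> 'a \<Rightarrow> 'a"

locale top_vector_space = top_ab_group V for V :: "('a, 'e) tvs_scheme" (structure) +
  assumes scale_closed: "x \<in> carrier V \<Longrightarrow> scale V r x \<in> carrier V"
    and scale_mult_right: "\<lbrakk>x \<in> carrier V; y \<in> carrier V\<rbrakk> \<Longrightarrow>
          scale V r (x \<otimes> y) = scale V r x \<otimes> scale V r y"
    and scale_add_left: "x \<in> carrier V \<Longrightarrow> scale V (r + s) x = scale V r x \<otimes> scale V s x"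
    and scale_scale: "x \<in> carrier V \<Longrightarrow> scale V r (scale V s x) = scale V (r * s) x"
    and scale_one: "x \<in> carrier V \<Longrightarrow> scale V 1 x = x"
    and continuous_scale:
      "continuous_map (prod_topology euclideanreal (topol V)) (topol V) (\<lambda>(r, x). scale V r x)"

definition continuous_hom ::
    "('a, 'e) tgroup_scheme \<Rightarrow> ('b, 'f) tgroup_scheme \<Rightarrow> ('a \<Rightarrow> 'b) \<Rightarrow> bool" where
  "continuous_hom A B f \<longleftrightarrow> f \<in> hom A B \<and> continuous_map (topol A) (topol B) f"

definition continuous_linear ::
    "('a, 'e) tvs_scheme \<Rightarrow> ('b, 'f) tvs_scheme \<Rightarrow> ('a \<Rightarrow> 'b) \<Rightarrow> bool" where
  "continuous_linear A B f \<longleftrightarrow>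
     continuous_hom A B f \<and> (\<forall>r. \<forall>x\<in>carrier A. f (scale A r x) = scale B r (f x))"

definition open_onto_image ::
    "('a, 'e) tgroup_scheme \<Rightarrow> ('b, 'f) tgroup_scheme \<Rightarrow> ('a \<Rightarrow> 'b) \<Rightarrow> bool" where
  "open_onto_image A B f \<longleftrightarrow> open_map (topol A) (subtopology (topol B) (f ` carrier A)) f"

definition tgroup_prod ::
    "('a, 'e) tgroup_scheme \<Rightarrow> ('b, 'f) tgroup_scheme \<Rightarrow> ('a \<times> 'b) tgroup" where
  "tgroup_prod A B =
     monoid.extend (A \<times>\<times> B) (tgroup.fields (prod_topology (topol A) (topol B)))"

definition tvs_prod ::
    "('a, 'e) tvs_scheme \<Rightarrow> ('b, 'f) tvs_scheme \<Rightarrow> ('a \<times> 'b) tvs" where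
  "tvs_prod A B = tgroup.extend (tgroup_prod A B)
     (tvs.fields (\<lambda>r (x, y). (scale A r x, scale B r y)))"

definition tgroup_Prod ::
    "'i set \<Rightarrow> ('i \<Rightarrow> ('a, 'e) tgroup_scheme) \<Rightarrow> ('i \<Rightarrow> 'a) tgroup" where
  "tgroup_Prod I H = monoid.extend (product_group I H)
     (tgroup.fields (product_topology (\<lambda>i. topol (H i)) I))"

definition tvs_Prod ::
    "'i set \<Rightarrow> ('i \<Rightarrow> ('a, 'e) tvs_scheme) \<Rightarrow> ('i \<Rightarrow> 'a) tvs" where
  "tvs_Prod I Y = tgroup.extend (tgroup_Prod I Y)
     (tvs.fields (\<lambda>r x. \<lambda>i\<in>I. scale (Y i) r (x i)))"


section \<open>Extensions and their equivalence\<close>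

text \<open>
  An extension \<open>0 \<rightarrow> H \<rightarrow> X \<rightarrow> G \<rightarrow> 0\<close> is stored as the middle object \<open>X\<close>
  together with the two maps; \<open>'m\<close> is \<open>'x tgroup\<close> or \<open>'x tvs\<close>.
\<close>

record ('m, 'h, 'x, 'g) extension =
  mid :: 'm
  incl :: "'h \<Rightarrow> 'x"
  proj :: "'x \<Rightarrow> 'g"

type_synonym ('h, 'x, 'g) tgroup_extension = "('x tgroup, 'h, 'x, 'g) extension"
type_synonym ('h, 'x, 'g) tvs_extension = "('x tvs, 'h, 'x, 'g) extension"

definition short_exact ::
    "('g, 'e) tgroup_scheme \<Rightarrow> ('h, 'f) tgroup_scheme \<Rightarrow>
     (('x, 'k) tgroup_scheme, 'h, 'x, 'g) extension \<Rightarrow> bool" where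
  "short_exact G H E \<longleftrightarrow>
     inj_on (incl E) (carrier H) \<and>
     incl E ` carrier H = kernel (mid E) G (proj E) \<and>
     proj E ` carrier (mid E) = carrier G"

definition is_extension ::
    "('g, 'e) tgroup_scheme \<Rightarrow> ('h, 'f) tgroup_scheme \<Rightarrow>
     (('x, 'k) tgroup_scheme, 'h, 'x, 'g) extension \<Rightarrow> bool" where
  "is_extension G H E \<longleftrightarrow>
     top_ab_group (mid E) \<and>
     continuous_hom H (mid E) (incl E) \<and> open_onto_image H (mid E) (incl E) \<and>
     continuous_hom (mid E) G (proj E) \<and> open_onto_image (mid E) G (proj E) \<and>
     short_exact G H E"

definition is_tvs_extension ::
    "('g, 'e) tvs_scheme \<Rightarrow> ('h, 'f) tvs_scheme \<Rightarrow>
     (('x, 'k) tvs_scheme, 'h, 'x, 'g) extension \<Rightarrow> bool" where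
  "is_tvs_extension Z Y E \<longleftrightarrow>
     top_vector_space (mid E) \<and>
     continuous_linear Y (mid E) (incl E) \<and> open_onto_image Y (mid E) (incl E) \<and>
     continuous_linear (mid E) Z (proj E) \<and> open_onto_image (mid E) Z (proj E) \<and>
     short_exact Z Y E"

definition ext_equiv ::
    "('h, 'f) tgroup_scheme \<Rightarrow> (('x, 'k) tgroup_scheme, 'h, 'x, 'g) extension \<Rightarrow>
     (('y, 'l) tgroup_scheme, 'h, 'y, 'g) extension \<Rightarrow> bool" where
  "ext_equiv H E E' \<longleftrightarrow>
     (\<exists>T. continuous_hom (mid E) (mid E') T \<and>
          (\<forall>h\<in>carrier H. T (incl E h) = incl E' h) \<and>
          (\<forall>x\<in>carrier (mid E). proj E' (T x) = proj E x))"

definition tvs_ext_equiv ::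
    "('h, 'f) tvs_scheme \<Rightarrow> (('x, 'k) tvs_scheme, 'h, 'x, 'g) extension \<Rightarrow>
     (('y, 'l) tvs_scheme, 'h, 'y, 'g) extension \<Rightarrow> bool" where
  "tvs_ext_equiv Y E E' \<longleftrightarrow>
     (\<exists>T. continuous_linear (mid E) (mid E') T \<and>
          (\<forall>y\<in>carrier Y. T (incl E y) = incl E' y) \<and>
          (\<forall>x\<in>carrier (mid E). proj E' (T x) = proj E x))"


section \<open>Baer sum\<close>

definition trivial_extension ::
    "('g, 'e) tgroup_scheme \<Rightarrow> ('h, 'f) tgroup_scheme \<Rightarrow> ('h, 'h \<times> 'g, 'g) tgroup_extension" where
  "trivial_extension G H =
     \<lparr>mid = tgroup_prod H G, incl = (\<lambda>h. (h, \<one>\<^bsub>G\<^esub>)), proj = snd\<rparr>"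

definition tvs_trivial_extension ::
    "('g, 'e) tvs_scheme \<Rightarrow> ('h, 'f) tvs_scheme \<Rightarrow> ('h, 'h \<times> 'g, 'g) tvs_extension" where
  "tvs_trivial_extension Z Y =
     \<lparr>mid = tvs_prod Y Z, incl = (\<lambda>y. (y, \<one>\<^bsub>Z\<^esub>)), proj = snd\<rparr>"

definition product_extension ::
    "(('x, 'k) tgroup_scheme, 'h, 'x, 'g) extension \<Rightarrow>
     (('y, 'l) tgroup_scheme, 'h', 'y, 'g') extension \<Rightarrow>
     ('h \<times> 'h', 'x \<times> 'y, 'g \<times> 'g') tgroup_extension" where
  "product_extension E1 E2 =
     \<lparr>mid = tgroup_prod (mid E1) (mid E2),
      incl = map_prod (incl E1) (incl E2),
      proj = map_prod (proj E1) (proj E2)\<rparr>"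

definition tvs_product_extension ::
    "(('x, 'k) tvs_scheme, 'h, 'x, 'g) extension \<Rightarrow>
     (('y, 'l) tvs_scheme, 'h', 'y, 'g') extension \<Rightarrow>
     ('h \<times> 'h', 'x \<times> 'y, 'g \<times> 'g') tvs_extension" where
  "tvs_product_extension E1 E2 =
     \<lparr>mid = tvs_prod (mid E1) (mid E2),
      incl = map_prod (incl E1) (incl E2),
      proj = map_prod (proj E1) (proj E2)\<rparr>"

text \<open>Pull-back of \<open>E: 0 \<rightarrow> H \<rightarrow> X \<rightarrow> G \<rightarrow> 0\<close> along \<open>t: G' \<rightarrow> G\<close>:
  the subgroup \<open>{(x, g). \<pi> x = t g}\<close> of \<open>X \<times> G'\<close> with the subspace topology.\<close>

definition pullback_set ::
    "('g', 'e) tgroup_scheme \<Rightarrow> ('g' \<Rightarrow> 'g) \<Rightarrow>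
     (('x, 'k) tgroup_scheme, 'h, 'x, 'g) extension \<Rightarrow> ('x \<times> 'g') set" where
  "pullback_set G' t E = {(x, g). x \<in> carrier (mid E) \<and> g \<in> carrier G' \<and> proj E x = t g}"

definition pullback_extension ::
    "('g', 'e) tgroup_scheme \<Rightarrow> ('g' \<Rightarrow> 'g) \<Rightarrow>
     (('x, 'k) tgroup_scheme, 'h, 'x, 'g) extension \<Rightarrow> ('h, 'x \<times> 'g', 'g') tgroup_extension" where
  "pullback_extension G' t E =
     (let P = tgroup_prod (mid E) G'; S = pullback_set G' t E in
      \<lparr>mid = P\<lparr>carrier := S, topol := subtopology (topol P) S\<rparr>,
       incl = (\<lambda>h. (incl E h, \<one>\<^bsub>G'\<^esub>)),
       proj = snd\<rparr>)"

definition tvs_pullback_extension ::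
    "('g', 'e) tvs_scheme \<Rightarrow> ('g' \<Rightarrow> 'g) \<Rightarrow>
     (('x, 'k) tvs_scheme, 'h, 'x, 'g) extension \<Rightarrow> ('h, 'x \<times> 'g', 'g') tvs_extension" where
  "tvs_pullback_extension Z' t E =
     (let P = tvs_prod (mid E) Z'; S = pullback_set Z' t E in
      \<lparr>mid = P\<lparr>carrier := S, topol := subtopology (topol P) S\<rparr>,
       incl = (\<lambda>h. (incl E h, \<one>\<^bsub>Z'\<^esub>)),
       proj = snd\<rparr>)"

text \<open>The quotient topology: a set of cosets is open iff its preimage, which is its union,
  is open.\<close>

definition tgroup_quotient :: "('a, 'e) tgroup_scheme \<Rightarrow> 'a set \<Rightarrow> 'a set tgroup" where
  "tgroup_quotient A N = monoid.extend (A Mod N)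
     (tgroup.fields (topology (\<lambda>U. U \<subseteq> rcosets\<^bsub>A\<^esub> N \<and> openin (topol A) (\<Union>U))))"

definition tvs_quotient :: "('a, 'e) tvs_scheme \<Rightarrow> 'a set \<Rightarrow> 'a set tvs" where
  "tvs_quotient A N = tgroup.extend (tgroup_quotient A N)
     (tvs.fields (\<lambda>r C. \<Union>x\<in>C. N #>\<^bsub>A\<^esub> scale A r x))"

text \<open>Push-out of \<open>E: 0 \<rightarrow> H \<rightarrow> X \<rightarrow> G \<rightarrow> 0\<close> along \<open>a: H \<rightarrow> H'\<close>:
  the quotient of \<open>H' \<times> X\<close> by the subgroup of all \<open>(a h, - \<imath> h)\<close>. The value of the
  projection at a coset is the common value of \<open>\<pi> x\<close> at its elements \<open>(h', x)\<close>.\<close>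

definition pushout_subgroup ::
    "('h, 'e) tgroup_scheme \<Rightarrow> ('h \<Rightarrow> 'h') \<Rightarrow>
     (('x, 'k) tgroup_scheme, 'h, 'x, 'g) extension \<Rightarrow> ('h' \<times> 'x) set" where
  "pushout_subgroup H a E = (\<lambda>h. (a h, inv\<^bsub>mid E\<^esub> (incl E h))) ` carrier H"

definition pushout_extension ::
    "('h, 'e) tgroup_scheme \<Rightarrow> ('h', 'f) tgroup_scheme \<Rightarrow> ('h \<Rightarrow> 'h') \<Rightarrow>
     (('x, 'k) tgroup_scheme, 'h, 'x, 'g) extension \<Rightarrow>
     ('h', ('h' \<times> 'x) set, 'g) tgroup_extension" where
  "pushout_extension H H' a E =
     (let P = tgroup_prod H' (mid E); N = pushout_subgroup H a E in
      \<lparr>mid = tgroup_quotient P N,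
       incl = (\<lambda>h'. N #>\<^bsub>P\<^esub> (h', \<one>\<^bsub>mid E\<^esub>)),
       proj = (\<lambda>C. the_elem ((\<lambda>(h', x). proj E x) ` C))\<rparr>)"

definition tvs_pushout_extension ::
    "('h, 'e) tvs_scheme \<Rightarrow> ('h', 'f) tvs_scheme \<Rightarrow> ('h \<Rightarrow> 'h') \<Rightarrow>
     (('x, 'k) tvs_scheme, 'h, 'x, 'g) extension \<Rightarrow>
     ('h', ('h' \<times> 'x) set, 'g) tvs_extension" where
  "tvs_pushout_extension Y Y' a E =
     (let P = tvs_prod Y' (mid E); N = pushout_subgroup Y a E in
      \<lparr>mid = tvs_quotient P N,
       incl = (\<lambda>y'. N #>\<^bsub>P\<^esub> (y', \<one>\<^bsub>mid E\<^esub>)),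
       proj = (\<lambda>C. the_elem ((\<lambda>(y', x). proj E x) ` C))\<rparr>)"

definition baer_sum ::
    "('g, 'e) tgroup_scheme \<Rightarrow> ('h, 'f) tgroup_scheme \<Rightarrow>
     (('x, 'k) tgroup_scheme, 'h, 'x, 'g) extension \<Rightarrow>
     (('y, 'l) tgroup_scheme, 'h, 'y, 'g) extension \<Rightarrow>
     ('h, ('h \<times> ('x \<times> 'y) \<times> 'g) set, 'g) tgroup_extension" where
  "baer_sum G H E1 E2 =
     pushout_extension (tgroup_prod H H) H (\<lambda>(a, b). a \<otimes>\<^bsub>H\<^esub> b)
       (pullback_extension G (\<lambda>g. (g, g)) (product_extension E1 E2))"

definition tvs_baer_sum ::
    "('g, 'e) tvs_scheme \<Rightarrow> ('h, 'f) tvs_scheme \<Rightarrow>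
     (('x, 'k) tvs_scheme, 'h, 'x, 'g) extension \<Rightarrow>
     (('y, 'l) tvs_scheme, 'h, 'y, 'g) extension \<Rightarrow>
     ('h, ('h \<times> ('x \<times> 'y) \<times> 'g) set, 'g) tvs_extension" where
  "tvs_baer_sum Z Y E1 E2 =
     tvs_pushout_extension (tvs_prod Y Y) Y (\<lambda>(a, b). a \<otimes>\<^bsub>Y\<^esub> b)
       (tvs_pullback_extension Z (\<lambda>z. (z, z)) (tvs_product_extension E1 E2))"


section \<open>Representatives on the product type\<close>

text \<open>Transport of structure along a map that is injective on the carrier.\<close>

definition transport_tgroup :: "('a \<Rightarrow> 'b) \<Rightarrow> ('a, 'e) tgroup_scheme \<Rightarrow> 'b tgroup" where
  "transport_tgroup f A = (let g = inv_into (carrier A) f in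
     \<lparr>carrier = f ` carrier A,
      monoid.mult = (\<lambda>x y. f (g x \<otimes>\<^bsub>A\<^esub> g y)),
      one = f \<one>\<^bsub>A\<^esub>,
      topol = pullback_topology (f ` carrier A) g (topol A)\<rparr>)"

definition transport_tvs :: "('a \<Rightarrow> 'b) \<Rightarrow> ('a, 'e) tvs_scheme \<Rightarrow> 'b tvs" where
  "transport_tvs f A = tgroup.extend (transport_tgroup f A)
     (tvs.fields (\<lambda>r x. f (scale A r (inv_into (carrier A) f x))))"

lemma transport_tvs_simps [simp]:
  "carrier (transport_tvs f A) = carrier (transport_tgroup f A)"
  "monoid.mult (transport_tvs f A) = monoid.mult (transport_tgroup f A)"
  "one (transport_tvs f A) = one (transport_tgroup f A)"
  "topol (transport_tvs f A) = topol (transport_tgroup f A)"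
  "scale (transport_tvs f A) r x = f (scale A r (inv_into (carrier A) f x))"
  by (simp_all add: transport_tvs_def tgroup.defs tvs.defs)

lemma iso_transport_tgroup:
  assumes "top_ab_group A" "inj_on f (carrier A)"
  shows "f \<in> iso A (transport_tgroup f A)"
proof -
  interpret top_ab_group A by fact
  show ?thesis
    using assms(2)
    by (auto simp: iso_def hom_def transport_tgroup_def Let_def bij_betw_def)
qed

lemma homeomorphic_maps_transport_tgroup:
  assumes "top_ab_group A" "inj_on f (carrier A)"
  shows "homeomorphic_maps (topol A) (topol (transport_tgroup f A)) f (inv_into (carrier A) f)"
proof -
  interpret top_ab_group A by fact
  let ?g = "inv_into (carrier A) f"
  have gf: "?g (f x) = x" if "x \<in> carrier A" for x
    using that assms(2) by simp
  have T: "topol (transport_tgroup f A) = pullback_topology (f ` carrier A) ?g (topol A)"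
    by (simp add: transport_tgroup_def Let_def)
  have "continuous_map (topol A) (topol A) (?g \<circ> f)"
    by (rule continuous_map_eq[OF continuous_map_id]) (simp add: topspace_topol gf)
  then have 1: "continuous_map (topol A) (topol (transport_tgroup f A)) f"
    unfolding T by (rule continuous_map_pullback') (auto simp: topspace_topol)
  have 2: "continuous_map (topol (transport_tgroup f A)) (topol A) ?g"
    unfolding T using continuous_map_pullback[OF continuous_map_id[of "topol A"]] by simp
  show ?thesis
    using 1 2 by (auto simp: homeomorphic_maps_def topspace_topol gf T topspace_pullback_topology)
qed

lemma top_ab_group_transport:
  assumes "top_ab_group A" "inj_on f (carrier A)"
  shows "top_ab_group (transport_tgroup f A)"
proof -
  interpret top_ab_group A by fact
  let ?B = "transport_tgroup f A" and ?g = "inv_into (carrier A) f"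
  have iso: "f \<in> iso A ?B" by (rule iso_transport_tgroup[OF assms])
  have "comm_group (?B\<lparr>one := f \<one>\<^bsub>A\<^esub>\<rparr>)" by (rule iso_imp_img_comm_group[OF iso])
  moreover have "?B\<lparr>one := f \<one>\<^bsub>A\<^esub>\<rparr> = ?B" by (simp add: transport_tgroup_def Let_def)
  ultimately interpret B: comm_group ?B by simp
  have hm: "homeomorphic_maps (topol A) (topol ?B) f ?g"
    by (rule homeomorphic_maps_transport_tgroup[OF assms])
  then have cf: "continuous_map (topol A) (topol ?B) f"
    and cg: "continuous_map (topol ?B) (topol A) ?g"
    by (auto simp: homeomorphic_maps_def)
  have cB: "carrier ?B = f ` carrier A" by (simp add: transport_tgroup_def Let_def)
  have g: "?g y \<in> carrier A" "f (?g y) = y" if "y \<in> carrier ?B" for y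
    using that by (auto simp: cB inv_into_into f_inv_into_f)
  have tB: "topspace (topol ?B) = carrier ?B"
    using g(1)
    by (auto simp: transport_tgroup_def Let_def topspace_pullback_topology topspace_topol)
  have "topol A homeomorphic_space topol ?B"
    using hm homeomorphic_space_def by blast
  then have H: "Hausdorff_space (topol ?B)"
    using Hausdorff homeomorphic_Hausdorff_space by blast
  have "continuous_map (prod_topology (topol ?B) (topol ?B)) (topol ?B)
          (f \<circ> (\<lambda>(x, y). x \<otimes>\<^bsub>A\<^esub> y) \<circ> (\<lambda>(x, y). (?g x, ?g y)))"
    by (intro continuous_map_compose[OF _ continuous_map_compose[OF continuous_mult cf]])
      (use cg in \<open>simp add: continuous_map_prod_top\<close>)
  then have M: "continuous_map (prod_topology (topol ?B) (topol ?B)) (topol ?B)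
          (\<lambda>(x, y). x \<otimes>\<^bsub>?B\<^esub> y)"
    by (rule continuous_map_eq) (auto simp: transport_tgroup_def Let_def)
  have "f \<in> hom A ?B" using iso by (simp add: iso_def)
  then interpret h: group_hom A ?B f by unfold_locales
  have "continuous_map (topol ?B) (topol ?B) (f \<circ> (\<lambda>x. inv\<^bsub>A\<^esub> x) \<circ> ?g)"
    by (intro continuous_map_compose[OF cg] continuous_map_compose[OF continuous_inv cf])
  then have V: "continuous_map (topol ?B) (topol ?B) (\<lambda>x. inv\<^bsub>?B\<^esub> x)"
    by (rule continuous_map_eq) (simp add: tB h.hom_inv g)
  show ?thesis
    by unfold_locales (rule tB H M V)+
qed

lemma top_ab_group_cong:
  fixes A :: "('a, 'e) tgroup_scheme" and B :: "('a, 'f) tgroup_scheme"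
  assumes "top_ab_group A"
    and "carrier B = carrier A" "monoid.mult B = monoid.mult A" "one B = one A" "topol B = topol A"
  shows "top_ab_group B"
proof -
  interpret top_ab_group A by fact
  interpret B: comm_group B
    by (rule comm_groupI) (use assms(2-) in \<open>auto simp: m_ac intro: l_inv_ex\<close>)
  have "m_inv B = m_inv A"
    by (auto simp: m_inv_def assms(2-))
  then show ?thesis
    using topspace_topol Hausdorff continuous_mult continuous_inv
    by unfold_locales (simp_all add: assms(2-))
qed

lemma top_vector_space_transport:
  assumes "top_vector_space A" "inj_on f (carrier A)"
  shows "top_vector_space (transport_tvs f A)"
proof -
  interpret top_vector_space A by fact
  let ?B = "transport_tvs f A" and ?g = "inv_into (carrier A) f"
  interpret B: top_ab_group ?B
    by (rule top_ab_group_cong[OF top_ab_group_transport[OF top_ab_group_axioms assms(2)]]) simp_all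
  have hm: "homeomorphic_maps (topol A) (topol ?B) f ?g"
    using homeomorphic_maps_transport_tgroup[OF top_ab_group_axioms assms(2)] by simp
  then have cf: "continuous_map (topol A) (topol ?B) f"
    and cg: "continuous_map (topol ?B) (topol A) ?g"
    by (auto simp: homeomorphic_maps_def)
  have cB: "carrier ?B = f ` carrier A" by (simp add: transport_tgroup_def Let_def)
  have m: "x \<otimes>\<^bsub>?B\<^esub> y = f (?g x \<otimes>\<^bsub>A\<^esub> ?g y)" for x y by (simp add: transport_tgroup_def Let_def)
  have gf: "?g (f x) = x" if "x \<in> carrier A" for x
    using that assms(2) by simp
  have "continuous_map (prod_topology euclideanreal (topol ?B)) (topol ?B)
          (f \<circ> (\<lambda>(r, x). scale A r x) \<circ> (\<lambda>(r, x). (id r, ?g x)))"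
    by (intro continuous_map_compose[OF _ continuous_map_compose[OF continuous_scale cf]])
      (use cg in \<open>simp add: continuous_map_prod_top\<close>)
  then have S: "continuous_map (prod_topology euclideanreal (topol ?B)) (topol ?B)
          (\<lambda>(r, x). scale ?B r x)"
    by (rule continuous_map_eq) auto
  have sc: "scale ?B r (f x) = f (scale A r x)" if "x \<in> carrier A" for r x
    using that by (simp add: gf)
  have mf: "f x \<otimes>\<^bsub>?B\<^esub> f y = f (x \<otimes>\<^bsub>A\<^esub> y)" if "x \<in> carrier A" "y \<in> carrier A" for x y
    using that by (simp only: m gf)
  show ?thesis
    by (intro top_vector_space.intro top_vector_space_axioms.intro B.top_ab_group_axioms S;
        unfold cB;
        (elim imageE)?; (hypsubst)?)
      (simp_all only: sc mf m_closed scale_closed scale_mult_right scale_add_left scale_scale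
        scale_one imageI)
qed

lemma ex_inj_on_mid:
  fixes E :: "(('x, 'k) tgroup_scheme, 'h, 'x, 'g) extension"
  assumes "top_ab_group G" "top_ab_group H" "is_extension G H E"
  shows "\<exists>f :: 'x \<Rightarrow> 'h \<times> 'g. inj_on f (carrier (mid E))"
proof -
  interpret G: top_ab_group G by fact
  interpret X: top_ab_group "mid E" using assms(3) by (simp add: is_extension_def)
  have p: "proj E \<in> hom (mid E) G"
    using assms(3) by (simp add: is_extension_def continuous_hom_def)
  interpret p: group_hom "mid E" G "proj E" by unfold_locales (rule p)
  have ker: "incl E ` carrier H = kernel (mid E) G (proj E)"
    using assms(3) by (simp add: is_extension_def short_exact_def)
  define s where "s = inv_into (carrier (mid E)) (proj E)"
  have s: "s (proj E x) \<in> carrier (mid E)" "proj E (s (proj E x)) = proj E x"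
    if "x \<in> carrier (mid E)" for x
    using that by (auto simp: s_def inv_into_into f_inv_into_f)
  let ?d = "\<lambda>x. x \<otimes>\<^bsub>mid E\<^esub> inv\<^bsub>mid E\<^esub> (s (proj E x))"
  have d: "?d x \<in> incl E ` carrier H" if "x \<in> carrier (mid E)" for x
    using that s[OF that] by (auto simp: ker kernel_def)
  let ?f = "\<lambda>x. (inv_into (carrier H) (incl E) (?d x), proj E x)"
  have "inj_on ?f (carrier (mid E))"
  proof (rule inj_onI)
    fix x y assume xy: "x \<in> carrier (mid E)" "y \<in> carrier (mid E)" and eq: "?f x = ?f y"
    have px: "proj E x = proj E y"
      using arg_cong[OF eq, of snd] by (simp only: snd_conv)
    have i: "inv_into (carrier H) (incl E) (?d x) = inv_into (carrier H) (incl E) (?d y)"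
      using arg_cong[OF eq, of fst] by (simp only: fst_conv)
    have dd: "?d x = ?d y"
      by (rule inv_into_injective[OF i d[OF xy(1)] d[OF xy(2)]])
    have xd: "?d z \<otimes>\<^bsub>mid E\<^esub> s (proj E z) = z" if "z \<in> carrier (mid E)" for z
      using that s(1)[OF that] by (simp add: X.m_assoc)
    have "?d x \<otimes>\<^bsub>mid E\<^esub> s (proj E x) = ?d y \<otimes>\<^bsub>mid E\<^esub> s (proj E y)"
      by (rule arg_cong2[OF dd arg_cong[OF px]])
    then show "x = y"
      by (simp only: xd xy)
  qed
  then show ?thesis by blast
qed

lemma is_extension_transport:
  assumes G: "top_ab_group G" and H: "top_ab_group H" and E: "is_extension G H E"
    and B: "top_ab_group B"
    and iso: "f \<in> iso (mid E) B" and hm: "homeomorphic_maps (topol (mid E)) (topol B) f g"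
  defines "E' \<equiv> \<lparr>mid = B, incl = f \<circ> incl E, proj = proj E \<circ> g\<rparr>"
  shows "is_extension G H E'" "ext_equiv H E E'"
proof -
  interpret G: top_ab_group G by fact
  interpret H: top_ab_group H by fact
  interpret B: top_ab_group B by fact
  interpret X: top_ab_group "mid E" using E by (simp add: is_extension_def)
  have E1: "incl E \<in> hom H (mid E)" "continuous_map (topol H) (topol (mid E)) (incl E)"
      "open_map (topol H) (subtopology (topol (mid E)) (incl E ` carrier H)) (incl E)"
      "inj_on (incl E) (carrier H)"
    and E2: "proj E \<in> hom (mid E) G" "continuous_map (topol (mid E)) (topol G) (proj E)"
      "open_map (topol (mid E)) (subtopology (topol G) (proj E ` carrier (mid E))) (proj E)"
      "proj E ` carrier (mid E) = carrier G"
    and ker: "incl E ` carrier H = kernel (mid E) G (proj E)"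
    using E by (auto simp: is_extension_def continuous_hom_def open_onto_image_def short_exact_def)
  have f: "f \<in> hom (mid E) B" "bij_betw f (carrier (mid E)) (carrier B)"
    using iso by (auto simp: iso_def)
  interpret f: group_hom "mid E" B f by unfold_locales (rule f)
  have fB: "f ` carrier (mid E) = carrier B" using f(2) by (simp add: bij_betw_def)
  have gf: "g (f x) = x" if "x \<in> carrier (mid E)" for x
    using hm that by (simp add: homeomorphic_maps_def X.topspace_topol)
  have fg: "f (g y) = y" if "y \<in> carrier B" for y
    using hm that by (simp add: homeomorphic_maps_def B.topspace_topol)
  have gB: "g ` carrier B = carrier (mid E)"
    unfolding fB[symmetric] by (force simp: gf)
  have gc: "g y \<in> carrier (mid E)" if "y \<in> carrier B" for y
    using gB that by blast
  have ghom: "g \<in> hom B (mid E)"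
  proof (rule homI)
    fix x y assume xy: "x \<in> carrier B" "y \<in> carrier B"
    have "g (x \<otimes>\<^bsub>B\<^esub> y) = g (f (g x) \<otimes>\<^bsub>B\<^esub> f (g y))" using xy by (simp add: fg)
    also have "\<dots> = g (f (g x \<otimes>\<^bsub>mid E\<^esub> g y))" using xy gc by simp
    also have "\<dots> = g x \<otimes>\<^bsub>mid E\<^esub> g y" using xy gc by (intro gf X.m_closed)
    finally show "g (x \<otimes>\<^bsub>B\<^esub> y) = g x \<otimes>\<^bsub>mid E\<^esub> g y" .
  qed (rule gc)
  have cf: "continuous_map (topol (mid E)) (topol B) f"
    and cg: "continuous_map (topol B) (topol (mid E)) g"
    using hm by (auto simp: homeomorphic_maps_def)
  have of: "open_map (topol (mid E)) (topol B) f" and og: "open_map (topol B) (topol (mid E)) g"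
    using hm by (auto simp: homeomorphic_maps_map homeomorphic_imp_open_map)
  have iH: "incl E h \<in> carrier (mid E)" if "h \<in> carrier H" for h
    using E1(1) that by (auto simp: hom_def)
  have "open_map (subtopology (topol (mid E)) (incl E ` carrier H))
          (subtopology (topol B) ((f \<circ> incl E) ` carrier H)) f"
    by (rule open_map_restriction[OF of])
      (use iH in \<open>auto simp: X.topspace_topol dest!: arg_cong[where f = g] simp: gf\<close>)
  then have oi: "open_map (topol H) (subtopology (topol B) ((f \<circ> incl E) ` carrier H)) (f \<circ> incl E)"
    by (rule open_map_compose[OF E1(3)])
  have op: "open_map (topol B) (subtopology (topol G) ((proj E \<circ> g) ` carrier B)) (proj E \<circ> g)"
    using open_map_compose[OF og E2(3)] by (simp only: image_comp[symmetric] gB)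
  have surj: "(proj E \<circ> g) ` carrier B = carrier G"
    by (simp only: image_comp[symmetric] gB E2(4))
  have inj: "inj_on (f \<circ> incl E) (carrier H)"
    using E1(4) iH f(2) by (intro comp_inj_on) (auto simp: bij_betw_def intro: inj_on_subset)
  have ker': "(f \<circ> incl E) ` carrier H = kernel B G (proj E \<circ> g)"
  proof -
    have "(f \<circ> incl E) ` carrier H = f ` kernel (mid E) G (proj E)"
      by (simp only: image_comp[symmetric] ker)
    also have "\<dots> = kernel B G (proj E \<circ> g)"
    proof (intro equalityI subsetI)
      fix y assume "y \<in> f ` kernel (mid E) G (proj E)"
      then show "y \<in> kernel B G (proj E \<circ> g)" by (auto simp: kernel_def gf)
    next
      fix y assume "y \<in> kernel B G (proj E \<circ> g)"
      then have "y = f (g y)" "g y \<in> kernel (mid E) G (proj E)"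
        by (auto simp: kernel_def fg gc)
      then show "y \<in> f ` kernel (mid E) G (proj E)" by blast
    qed
    finally show ?thesis .
  qed
  show "is_extension G H E'"
    unfolding is_extension_def E'_def continuous_hom_def open_onto_image_def short_exact_def
    using B oi op inj ker' hom_compose[OF E1(1) f(1)] hom_compose[OF ghom E2(1)]
      continuous_map_compose[OF E1(2) cf] continuous_map_compose[OF cg E2(2)] surj
    by simp
  show "ext_equiv H E E'"
    unfolding ext_equiv_def E'_def continuous_hom_def
    using f(1) cf by (auto intro!: exI[of _ f] simp: gf)
qed

lemma ex_small_extension:
  fixes G :: "('g, 'e) tgroup_scheme" and H :: "('h, 'f) tgroup_scheme"
    and E :: "(('x, 'k) tgroup_scheme, 'h, 'x, 'g) extension"
  assumes "top_ab_group G" "top_ab_group H" "is_extension G H E"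
  shows "\<exists>E' :: ('h, 'h \<times> 'g, 'g) tgroup_extension. is_extension G H E' \<and> ext_equiv H E E'"
proof -
  have X: "top_ab_group (mid E)" using assms(3) by (simp add: is_extension_def)
  obtain f :: "'x \<Rightarrow> 'h \<times> 'g" where "inj_on f (carrier (mid E))" using ex_inj_on_mid[OF assms] by blast
  from is_extension_transport[OF assms top_ab_group_transport[OF X this]
      iso_transport_tgroup[OF X this] homeomorphic_maps_transport_tgroup[OF X this]]
  show ?thesis by blast
qed

lemma ex_small_tvs_extension:
  fixes Z :: "('g, 'e) tvs_scheme" and Y :: "('h, 'f) tvs_scheme"
    and E :: "(('x, 'k) tvs_scheme, 'h, 'x, 'g) extension"
  assumes Z: "top_vector_space Z" and Y: "top_vector_space Y" and E: "is_tvs_extension Z Y E"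
  shows "\<exists>E' :: ('h, 'h \<times> 'g, 'g) tvs_extension. is_tvs_extension Z Y E' \<and> tvs_ext_equiv Y E E'"
proof -
  have X: "top_vector_space (mid E)" using E by (simp add: is_tvs_extension_def)
  interpret Z: top_vector_space Z by fact
  interpret Y: top_vector_space Y by fact
  interpret X: top_vector_space "mid E" by fact
  have Eg: "is_extension Z Y E"
    using E X.top_ab_group_axioms
    by (simp add: is_tvs_extension_def is_extension_def continuous_linear_def)
  obtain f :: "'x \<Rightarrow> 'h \<times> 'g" where f: "inj_on f (carrier (mid E))"
    using ex_inj_on_mid[OF Z.top_ab_group_axioms Y.top_ab_group_axioms Eg] by blast
  let ?g = "inv_into (carrier (mid E)) f" and ?B = "transport_tvs f (mid E)"
  define E' where "E' = \<lparr>mid = ?B, incl = f \<circ> incl E, proj = proj E \<circ> ?g\<rparr>"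
  have B: "top_vector_space ?B" by (rule top_vector_space_transport[OF X f])
  then interpret B: top_vector_space ?B .
  have iso: "f \<in> iso (mid E) ?B"
    using iso_transport_tgroup[OF X.top_ab_group_axioms f] by (simp add: iso_def hom_def)
  have hm: "homeomorphic_maps (topol (mid E)) (topol ?B) f ?g"
    using homeomorphic_maps_transport_tgroup[OF X.top_ab_group_axioms f] by simp
  note E' = is_extension_transport[OF Z.top_ab_group_axioms Y.top_ab_group_axioms Eg
      B.top_ab_group_axioms iso hm, folded E'_def]
  have lin: "continuous_linear Y (mid E) (incl E)" "continuous_linear (mid E) Z (proj E)"
    using E by (auto simp: is_tvs_extension_def)
  have iY: "incl E y \<in> carrier (mid E)" if "y \<in> carrier Y" for y
    using lin(1) that by (auto simp: continuous_linear_def continuous_hom_def hom_def)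
  have cB: "carrier ?B = f ` carrier (mid E)"
    by (simp add: transport_tgroup_def Let_def)
  have 1: "is_tvs_extension Z Y E'"
    using E'(1) B lin f iY cB
    by (auto simp: is_extension_def is_tvs_extension_def continuous_linear_def E'_def
        X.scale_closed simp del: transport_tvs_simps(1))
  have 2: "tvs_ext_equiv Y E E'"
  proof -
    have "continuous_linear (mid E) ?B f"
      using iso hm f by (simp add: continuous_linear_def continuous_hom_def iso_def homeomorphic_maps_def)
    then show ?thesis
      unfolding tvs_ext_equiv_def E'_def using f by (auto intro!: exI[of _ f])
  qed
  from 1 2 show ?thesis by blast
qed

section \<open>The groups Ext\<close>

text \<open>
  The middle object of an extension of \<open>G\<close> by \<open>H\<close> has the cardinality of \<open>H \<times> G\<close>,
  so the extensions whose middle object has its carrier in the type \<open>'h \<times> 'g\<close> represent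
  all equivalence classes; see \<open>ex_small_extension\<close> and \<open>ex_small_tvs_extension\<close>.
  The class of an extension with middle object on an arbitrary type \<open>'x\<close> is the set of
  equivalent extensions on \<open>'h \<times> 'g\<close>.
\<close>

definition ext_class ::
    "('g, 'e) tgroup_scheme \<Rightarrow> ('h, 'f) tgroup_scheme \<Rightarrow>
     (('x, 'k) tgroup_scheme, 'h, 'x, 'g) extension \<Rightarrow> ('h, 'h \<times> 'g, 'g) tgroup_extension set"
  where
  "ext_class G H E = {E'. is_extension G H E' \<and> ext_equiv H E E'}"

definition tvs_ext_class ::
    "('g, 'e) tvs_scheme \<Rightarrow> ('h, 'f) tvs_scheme \<Rightarrow>
     (('x, 'k) tvs_scheme, 'h, 'x, 'g) extension \<Rightarrow> ('h, 'h \<times> 'g, 'g) tvs_extension set"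
  where
  "tvs_ext_class Z Y E = {E'. is_tvs_extension Z Y E' \<and> tvs_ext_equiv Y E E'}"

definition Ext ::
    "('g, 'e) tgroup_scheme \<Rightarrow> ('h, 'f) tgroup_scheme \<Rightarrow>
     ('h, 'h \<times> 'g, 'g) tgroup_extension set monoid" where
  "Ext G H =
     \<lparr>carrier = ext_class G H ` {E :: ('h, 'h \<times> 'g, 'g) tgroup_extension. is_extension G H E},
      monoid.mult = (\<lambda>c1 c2. \<Union>E1\<in>c1. \<Union>E2\<in>c2. ext_class G H (baer_sum G H E1 E2)),
      one = ext_class G H (trivial_extension G H)\<rparr>"

definition Ext_TVS ::
    "('g, 'e) tvs_scheme \<Rightarrow> ('h, 'f) tvs_scheme \<Rightarrow>
     ('h, 'h \<times> 'g, 'g) tvs_extension set monoid" where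
  "Ext_TVS Z Y =
     \<lparr>carrier = tvs_ext_class Z Y ` {E :: ('h, 'h \<times> 'g, 'g) tvs_extension. is_tvs_extension Z Y E},
      monoid.mult = (\<lambda>c1 c2. \<Union>E1\<in>c1. \<Union>E2\<in>c2. tvs_ext_class Z Y (tvs_baer_sum Z Y E1 E2)),
      one = tvs_ext_class Z Y (tvs_trivial_extension Z Y)\<rparr>"

definition isomorphic_ab_groups ::
    "('a, 'e) monoid_scheme \<Rightarrow> ('b, 'f) monoid_scheme \<Rightarrow> bool" where
  "isomorphic_ab_groups A B \<longleftrightarrow> comm_group A \<and> comm_group B \<and> A \<cong> B"

end

theory Submission
  imports Defs
begin

text \<open>
Why the theorem holds. Write \<open>0 \<rightarrow> Y \<rightarrow> X \<rightarrow> Z \<rightarrow> 0\<close> for an extension, and say that \<open>E\<close> pushes to \<open>E'\<close>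
  along \<open>a: Y \<rightarrow> Y'\<close> if a morphism \<open>X \<rightarrow> X'\<close> over \<open>Z\<close> restricts to \<open>a\<close> on \<open>Y\<close>; equivalence is pushing
  along the identity. Coordinate by coordinate, an extension \<open>E\<close> of \<open>Z\<close> by \<open>\<Prod> Y\<^sub>i\<close> yields its push-outs
  \<open>E\<^sub>i\<close> along the projections. Conversely a family of extensions \<open>E\<^sub>i\<close> of \<open>Z\<close> by \<open>Y\<^sub>i\<close> with middle
  objects \<open>X\<^sub>i\<close> yields the fibre product of the \<open>X\<^sub>i\<close> over \<open>Z\<close>, which is an extension \<open>F\<close> of \<open>Z\<close> by
  \<open>\<Prod> Y\<^sub>i\<close> and pushes to each \<open>E\<^sub>i\<close>; and every extension that pushes to all \<open>E\<^sub>i\<close> along the projections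
  maps to \<open>F\<close> and is therefore equivalent to it. This makes the map of classes
  \<open>[E] \<mapsto> ([E\<^sub>i])\<^sub>i\<close> bijective (\<open>Ext_lin_tvs_Prod_iso\<close>).

  Everything that involves equivalence or the Baer sum rests on one fact, \<open>pushes_unique\<close>: if an
  extension \<open>E\<close> pushes along the same \<open>a\<close> both to \<open>E\<^sub>1\<close> and to \<open>E\<^sub>2\<close>, then \<open>E\<^sub>1\<close> and \<open>E\<^sub>2\<close> are equivalent. If
  \<open>S\<close> and \<open>T\<close> are the two morphisms out of the middle object \<open>X\<close>, then every element of \<open>X\<^sub>1\<close> has the
  form \<open>S x + y\<close> with \<open>x \<in> X\<close> and \<open>y \<in> Y\<close>, and \<open>S x + y \<mapsto> T x + y\<close> is the equivalence. It is continuous since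
  \<open>(x, y) \<mapsto> S x + y\<close> is an open map, which is the topological core of the proof. In
  particular equivalence is symmetric, although the definition asks for a map in one direction only.

  The Baer sum of \<open>E\<^sub>1\<close> and \<open>E\<^sub>2\<close> enters only through \<open>pushes_baer_sum\<close>: if \<open>E\<close> pushes to \<open>E\<^sub>1\<close> along \<open>a\<close> and
  to \<open>E\<^sub>2\<close> along \<open>b\<close>, then it pushes to the Baer sum along \<open>a + b\<close>. With \<open>pushes_unique\<close> this reduces each
  law to an identity between homomorphisms into \<open>Y\<close>: to compare two expressions it suffices to reach
  both of them from one extension along the same map. That the Baer sum is an extension at all is
  checked by constructing products, pull-backs and push-outs.

  Groups and vector spaces are treated by the same proofs. A Boolean parameter \<open>lin\<close> says whether
  the objects are topological vector spaces and the maps linear, or whether the scalar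
  multiplication is ignored. Forgetting the scalar multiplication in the second case identifies the
  resulting group with \<open>Ext\<close> of topological groups (\<open>isomorphic_Ext_forget_scale\<close>).
\<close>

section \<open>Topological abelian groups\<close>

context top_ab_group
begin

lemma openin_subset_carrier: "openin (topol G) U \<Longrightarrow> U \<subseteq> carrier G"
  using openin_subset topspace_topol by fastforce

lemma continuous_map_mult:
  assumes "continuous_map X (topol G) f" "continuous_map X (topol G) g"
  shows "continuous_map X (topol G) (\<lambda>x. f x \<otimes> g x)"
  using continuous_map_compose[OF continuous_map_pairedI[OF assms] continuous_mult]
  by (simp add: o_def)

lemma continuous_map_inv:
  assumes "continuous_map X (topol G) f"
  shows "continuous_map X (topol G) (\<lambda>x. inv (f x))"
  using continuous_map_compose[OF assms continuous_inv] by (simp add: o_def)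

lemma openin_translate:
  assumes "openin (topol G) U" "a \<in> carrier G"
  shows "openin (topol G) {x \<in> carrier G. a \<otimes> x \<in> U}"
proof -
  have "continuous_map (topol G) (topol G) (\<lambda>x. a \<otimes> x)"
    using continuous_map_mult[of "topol G" "\<lambda>x. a" "\<lambda>x. x"] assms(2)
      continuous_map_id[of "topol G"]
    by (simp add: topspace_topol id_def)
  from openin_continuous_map_preimage[OF this assms(1)] show ?thesis
    by (simp add: topspace_topol)
qed

lemma nbhd_one_binary:
  assumes c: "continuous_map (prod_topology (topol G) (topol G)) (topol G) (\<lambda>(x, y). b x y)"
    and b: "b \<one> \<one> = \<one>" and U: "openin (topol G) U" "\<one> \<in> U"
  obtains V where "openin (topol G) V" "\<one> \<in> V" "\<And>x y. \<lbrakk>x \<in> V; y \<in> V\<rbrakk> \<Longrightarrow> b x y \<in> U"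
proof -
  let ?S = "{z \<in> topspace (prod_topology (topol G) (topol G)). (\<lambda>(x, y). b x y) z \<in> U}"
  have "openin (prod_topology (topol G) (topol G)) ?S"
    by (rule openin_continuous_map_preimage[OF c U(1)])
  moreover have "(\<one>, \<one>) \<in> ?S"
    using U b by (simp add: topspace_topol)
  ultimately obtain V W where VW: "openin (topol G) V" "openin (topol G) W" "\<one> \<in> V" "\<one> \<in> W"
      "V \<times> W \<subseteq> ?S"
    unfolding openin_prod_topology_alt by meson
  show thesis
  proof (rule that)
    show "openin (topol G) (V \<inter> W)" using VW(1,2) by (rule openin_Int)
    show "\<one> \<in> V \<inter> W" using VW(3,4) by simp
    fix x y assume "x \<in> V \<inter> W" "y \<in> V \<inter> W"
    then have "(x, y) \<in> ?S" using VW(5) by blast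
    then show "b x y \<in> U" by simp
  qed
qed

lemma nbhd_one_mult:
  assumes "openin (topol G) U" "\<one> \<in> U"
  obtains V where "openin (topol G) V" "\<one> \<in> V" "\<And>x y. \<lbrakk>x \<in> V; y \<in> V\<rbrakk> \<Longrightarrow> x \<otimes> y \<in> U"
  by (rule nbhd_one_binary[OF continuous_mult _ assms]) (simp, blast)

lemma nbhd_one_div:
  assumes "openin (topol G) U" "\<one> \<in> U"
  obtains V where "openin (topol G) V" "\<one> \<in> V" "\<And>x y. \<lbrakk>x \<in> V; y \<in> V\<rbrakk> \<Longrightarrow> x \<otimes> inv y \<in> U"
proof -
  have "continuous_map (prod_topology (topol G) (topol G)) (topol G) (\<lambda>z. fst z \<otimes> inv (snd z))"
    by (intro continuous_map_mult continuous_map_inv continuous_map_fst continuous_map_snd)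
  then have "continuous_map (prod_topology (topol G) (topol G)) (topol G) (\<lambda>(x, y). x \<otimes> inv y)"
    by (simp add: case_prod_unfold)
  then show thesis
    by (rule nbhd_one_binary[OF _ _ assms]) (simp, rule that)
qed

end

text \<open>
  For a homomorphism, openness onto the image is a condition on the neighbourhoods of the neutral
  element, because translations are homeomorphisms.
\<close>

lemma open_onto_imageI:
  assumes "top_ab_group A" "top_ab_group B" and f: "f \<in> hom A B"
    and nbhd: "\<And>U. \<lbrakk>openin (topol A) U; \<one>\<^bsub>A\<^esub> \<in> U\<rbrakk> \<Longrightarrow>
      \<exists>V. openin (topol B) V \<and> \<one>\<^bsub>B\<^esub> \<in> V \<and> V \<inter> f ` carrier A \<subseteq> f ` U"
  shows "open_onto_image A B f"
proof -
  interpret A: top_ab_group A by fact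
  interpret B: top_ab_group B by fact
  interpret f: group_hom A B f by unfold_locales (rule f)
  let ?T = "subtopology (topol B) (f ` carrier A)"
  have "openin ?T (f ` U)" if U: "openin (topol A) U" for U
  proof (subst openin_subopen, intro ballI)
    fix y assume "y \<in> f ` U"
    then obtain u where u: "u \<in> U" "y = f u" by blast
    then have uA: "u \<in> carrier A" using A.openin_subset_carrier[OF U] by blast
    let ?U = "{x \<in> carrier A. u \<otimes>\<^bsub>A\<^esub> x \<in> U}"
    have "openin (topol A) ?U" "\<one>\<^bsub>A\<^esub> \<in> ?U"
      using A.openin_translate[OF U uA] u uA by auto
    from nbhd[OF this] obtain V where V: "openin (topol B) V" "\<one>\<^bsub>B\<^esub> \<in> V"
        "V \<inter> f ` carrier A \<subseteq> f ` ?U" by blast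
    let ?W = "{z \<in> carrier B. inv\<^bsub>B\<^esub> y \<otimes>\<^bsub>B\<^esub> z \<in> V}"
    have W: "openin (topol B) ?W"
      by (rule B.openin_translate[OF V(1)]) (simp add: u uA)
    have "?W \<inter> f ` carrier A \<subseteq> f ` U"
    proof
      fix z assume z: "z \<in> ?W \<inter> f ` carrier A"
      then obtain a where a: "a \<in> carrier A" "z = f a" by blast
      have "inv\<^bsub>B\<^esub> y \<otimes>\<^bsub>B\<^esub> z = f (inv\<^bsub>A\<^esub> u \<otimes>\<^bsub>A\<^esub> a)" using a u uA by simp
      then have "inv\<^bsub>B\<^esub> y \<otimes>\<^bsub>B\<^esub> z \<in> f ` carrier A" using a uA by blast
      then have "inv\<^bsub>B\<^esub> y \<otimes>\<^bsub>B\<^esub> z \<in> V \<inter> f ` carrier A" using z by blast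
      then obtain x where x: "x \<in> carrier A" "u \<otimes>\<^bsub>A\<^esub> x \<in> U" "inv\<^bsub>B\<^esub> y \<otimes>\<^bsub>B\<^esub> z = f x" using V(3) by auto
      have "f (u \<otimes>\<^bsub>A\<^esub> x) = y \<otimes>\<^bsub>B\<^esub> (inv\<^bsub>B\<^esub> y \<otimes>\<^bsub>B\<^esub> z)" using x u uA by simp
      also have "\<dots> = z" using u uA a by (simp add: B.m_assoc[symmetric])
      finally show "z \<in> f ` U" using x by blast
    qed
    moreover have "y \<in> ?W \<inter> f ` carrier A" using u uA V(2) by auto
    ultimately show "\<exists>T. openin ?T T \<and> y \<in> T \<and> T \<subseteq> f ` U"
      using openin_subtopology_Int[OF W] by blast
  qed
  then show ?thesis by (simp add: open_onto_image_def open_map_def)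
qed

lemma open_onto_imageD:
  assumes "open_onto_image A B f" "openin (topol A) U"
  obtains V where "openin (topol B) V" "f ` U = V \<inter> f ` carrier A"
  using assms by (auto simp: open_onto_image_def open_map_def openin_subtopology)

lemma open_map_onto:
  assumes "top_ab_group B" "open_onto_image A B f" "f ` carrier A = carrier B"
  shows "open_map (topol A) (topol B) f"
proof -
  have "subtopology (topol B) (f ` carrier A) = topol B"
    by (metis assms(1,3) top_ab_group.topspace_topol subtopology_topspace)
  then show ?thesis using assms(2) by (simp add: open_onto_image_def)
qed

section \<open>Groups and vector spaces at once\<close>

text \<open>
  For \<open>lin = False\<close> the field \<open>scale\<close> of the record is not constrained, so that every topological
  abelian group is an object, whatever its \<open>scale\<close>.
\<close>

definition top_object :: "bool \<Rightarrow> 'a tvs \<Rightarrow> bool" where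
  "top_object lin A \<longleftrightarrow> top_ab_group A \<and> (lin \<longrightarrow> top_vector_space A)"

definition top_morphism :: "bool \<Rightarrow> 'a tvs \<Rightarrow> 'b tvs \<Rightarrow> ('a \<Rightarrow> 'b) \<Rightarrow> bool" where
  "top_morphism lin A B f \<longleftrightarrow>
     continuous_hom A B f \<and> (lin \<longrightarrow> (\<forall>r. \<forall>x\<in>carrier A. f (scale A r x) = scale B r (f x)))"

lemma top_objectD: "top_object lin A \<Longrightarrow> top_ab_group A"
  by (simp add: top_object_def)

lemma top_object_scale_closed:
  "\<lbrakk>top_object lin A; lin; x \<in> carrier A\<rbrakk> \<Longrightarrow> scale A r x \<in> carrier A"
  by (simp add: top_object_def top_vector_space.scale_closed)

lemma top_morphismI:
  assumes "\<And>x. x \<in> carrier A \<Longrightarrow> f x \<in> carrier B"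
    and "\<And>x y. \<lbrakk>x \<in> carrier A; y \<in> carrier A\<rbrakk> \<Longrightarrow> f (x \<otimes>\<^bsub>A\<^esub> y) = f x \<otimes>\<^bsub>B\<^esub> f y"
    and "continuous_map (topol A) (topol B) f"
    and "\<And>r x. \<lbrakk>lin; x \<in> carrier A\<rbrakk> \<Longrightarrow> f (scale A r x) = scale B r (f x)"
  shows "top_morphism lin A B f"
  using assms by (auto simp: top_morphism_def continuous_hom_def hom_def)

lemma
  assumes "top_morphism lin A B f"
  shows top_morphism_closed: "x \<in> carrier A \<Longrightarrow> f x \<in> carrier B"
    and top_morphism_mult: "\<lbrakk>x \<in> carrier A; y \<in> carrier A\<rbrakk> \<Longrightarrow> f (x \<otimes>\<^bsub>A\<^esub> y) = f x \<otimes>\<^bsub>B\<^esub> f y"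
    and top_morphism_continuous: "continuous_map (topol A) (topol B) f"
    and top_morphism_scale: "\<lbrakk>lin; x \<in> carrier A\<rbrakk> \<Longrightarrow> f (scale A r x) = scale B r (f x)"
    and top_morphism_hom: "f \<in> hom A B"
  using assms by (auto simp: top_morphism_def continuous_hom_def hom_def)

lemma top_morphism_group_hom:
  "\<lbrakk>top_object lin A; top_object lin B; top_morphism lin A B f\<rbrakk> \<Longrightarrow> group_hom A B f"
  by (simp add: group_hom_def group_hom_axioms_def top_object_def top_morphism_hom
      top_ab_group_def comm_group_def)

lemma top_morphism_one:
  "\<lbrakk>top_object lin A; top_object lin B; top_morphism lin A B f\<rbrakk> \<Longrightarrow> f \<one>\<^bsub>A\<^esub> = \<one>\<^bsub>B\<^esub>"
  using group_hom.hom_one[OF top_morphism_group_hom] by blast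

lemma top_morphism_compose:
  assumes f: "top_morphism lin A B f" and g: "top_morphism lin B C g"
  shows "top_morphism lin A C (\<lambda>x. g (f x))"
  by (rule top_morphismI)
    (use continuous_map_compose[OF top_morphism_continuous[OF f] top_morphism_continuous[OF g]] in
      \<open>auto simp: top_morphism_closed[OF f] top_morphism_closed[OF g] top_morphism_mult[OF f]
        top_morphism_mult[OF g] top_morphism_scale[OF f] top_morphism_scale[OF g] o_def\<close>)

lemma top_morphism_id: "top_morphism lin A A (\<lambda>x. x)"
  by (rule top_morphismI) (use continuous_map_id in \<open>auto simp: id_def\<close>)

lemma top_morphism_mult_fun:
  assumes B: "top_object lin B" and f: "top_morphism lin A B f" and g: "top_morphism lin A B g"
  shows "top_morphism lin A B (\<lambda>x. f x \<otimes>\<^bsub>B\<^esub> g x)"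
proof -
  interpret B: top_ab_group B by (rule top_objectD[OF B])
  note closed = top_morphism_closed[OF f] top_morphism_closed[OF g]
  show ?thesis
  proof (rule top_morphismI)
    show "continuous_map (topol A) (topol B) (\<lambda>x. f x \<otimes>\<^bsub>B\<^esub> g x)"
      by (intro B.continuous_map_mult top_morphism_continuous[OF f] top_morphism_continuous[OF g])
    show "f (scale A r x) \<otimes>\<^bsub>B\<^esub> g (scale A r x) = scale B r (f x \<otimes>\<^bsub>B\<^esub> g x)"
      if "lin" "x \<in> carrier A" for r x
      using that B top_vector_space.scale_mult_right[of B "f x" "g x" r]
      by (simp add: top_object_def closed top_morphism_scale[OF f] top_morphism_scale[OF g])
  qed (auto simp: closed top_morphism_mult[OF f] top_morphism_mult[OF g] B.m_ac)
qed

lemma top_vector_space_scale_one_inv: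
  assumes "top_vector_space V"
  shows "scale V r \<one>\<^bsub>V\<^esub> = \<one>\<^bsub>V\<^esub>"
    and "x \<in> carrier V \<Longrightarrow> scale V r (inv\<^bsub>V\<^esub> x) = inv\<^bsub>V\<^esub> (scale V r x)"
proof -
  interpret V: top_vector_space V by fact
  have "(\<lambda>x. scale V r x) \<in> hom V V"
    by (simp add: hom_def V.scale_closed V.scale_mult_right)
  then interpret s: group_hom V V "scale V r" by unfold_locales
  show "scale V r \<one>\<^bsub>V\<^esub> = \<one>\<^bsub>V\<^esub>" by (rule s.hom_one)
  show "x \<in> carrier V \<Longrightarrow> scale V r (inv\<^bsub>V\<^esub> x) = inv\<^bsub>V\<^esub> (scale V r x)" by simp
qed

lemma top_morphism_const_one:
  assumes "top_object lin B"
  shows "top_morphism lin A B (\<lambda>_. \<one>\<^bsub>B\<^esub>)"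
proof -
  interpret B: top_ab_group B by (rule top_objectD[OF assms])
  show ?thesis
    by (rule top_morphismI) (use assms in
      \<open>auto simp: B.topspace_topol top_object_def top_vector_space_scale_one_inv(1)\<close>)
qed

lemma top_morphism_inv_fun:
  assumes B: "top_object lin B" and f: "top_morphism lin A B f"
  shows "top_morphism lin A B (\<lambda>x. inv\<^bsub>B\<^esub> (f x))"
proof -
  interpret B: top_ab_group B by (rule top_objectD[OF B])
  show ?thesis
    by (rule top_morphismI) (use B in
      \<open>auto simp: top_object_def top_morphism_closed[OF f] top_morphism_mult[OF f]
        top_morphism_scale[OF f] B.inv_mult top_vector_space_scale_one_inv(2)
        intro: B.continuous_map_inv top_morphism_continuous[OF f]\<close>)
qed

text \<open>
  An open continuous surjection is a quotient map, so the induced homomorphism is continuous.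
\<close>

lemma top_morphism_factor:
  assumes A: "top_object lin A" and B: "top_object lin B" and C: "top_object lin C"
    and q: "top_morphism lin A B q" and op: "open_map (topol A) (topol B) q"
    and surj: "q ` carrier A = carrier B"
    and f: "top_morphism lin A C f"
    and ker: "\<And>x. \<lbrakk>x \<in> carrier A; q x = \<one>\<^bsub>B\<^esub>\<rbrakk> \<Longrightarrow> f x = \<one>\<^bsub>C\<^esub>"
  obtains T where "top_morphism lin B C T" "\<And>x. x \<in> carrier A \<Longrightarrow> T (q x) = f x"
proof -
  interpret A: top_ab_group A by (rule top_objectD[OF A])
  interpret B: top_ab_group B by (rule top_objectD[OF B])
  interpret C: top_ab_group C by (rule top_objectD[OF C])
  interpret q: group_hom A B q by (rule top_morphism_group_hom[OF A B q])
  interpret f: group_hom A C f by (rule top_morphism_group_hom[OF A C f])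
  have fq: "f x = f y" if xy: "x \<in> carrier A" "y \<in> carrier A" and eq: "q x = q y" for x y
  proof -
    have "f (x \<otimes>\<^bsub>A\<^esub> inv\<^bsub>A\<^esub> y) = \<one>\<^bsub>C\<^esub>"
      by (rule ker) (use xy eq in auto)
    then have "f x \<otimes>\<^bsub>C\<^esub> inv\<^bsub>C\<^esub> f y = \<one>\<^bsub>C\<^esub>" using xy by simp
    then show ?thesis using xy C.inv_solve_right'[of "\<one>\<^bsub>C\<^esub>" "f x" "f y"] by simp
  qed
  define T where "T = (\<lambda>b. f (inv_into (carrier A) q b))"
  have T: "T (q x) = f x" if "x \<in> carrier A" for x
    unfolding T_def
    by (rule fq) (use that in \<open>auto simp: inv_into_into f_inv_into_f\<close>)
  have qm: "quotient_map (topol A) (topol B) q"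
    by (rule continuous_open_imp_quotient_map[OF top_morphism_continuous[OF q] op])
      (simp add: A.topspace_topol B.topspace_topol surj)
  have cT: "continuous_map (topol B) (topol C) T"
    by (rule continuous_compose_quotient_map[OF qm])
      (rule continuous_map_eq[OF top_morphism_continuous[OF f]], simp add: T A.topspace_topol)
  have "top_morphism lin B C T"
  proof (rule top_morphismI[OF _ _ cT])
    fix b assume "b \<in> carrier B"
    then show "T b \<in> carrier C" by (auto simp: surj[symmetric] T)
  next
    fix b c assume "b \<in> carrier B" "c \<in> carrier B"
    then obtain x y where xy: "x \<in> carrier A" "y \<in> carrier A" "b = q x" "c = q y"
      by (auto simp: surj[symmetric])
    have "T (b \<otimes>\<^bsub>B\<^esub> c) = T (q (x \<otimes>\<^bsub>A\<^esub> y))" using xy by simp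
    also have "\<dots> = T b \<otimes>\<^bsub>C\<^esub> T c" using xy(1,2) by (simp add: T xy(3,4) del: q.hom_mult)
    finally show "T (b \<otimes>\<^bsub>B\<^esub> c) = T b \<otimes>\<^bsub>C\<^esub> T c" .
  next
    fix r b assume lin: lin and "b \<in> carrier B"
    then obtain x where x: "x \<in> carrier A" "b = q x" by (auto simp: surj[symmetric])
    have "T (scale B r b) = T (q (scale A r x))" using lin x by (simp add: top_morphism_scale[OF q])
    also have "\<dots> = scale C r (T b)"
      using lin x by (simp add: T top_object_scale_closed[OF A] top_morphism_scale[OF f])
    finally show "T (scale B r b) = scale C r (T b)" .
  qed
  then show thesis using T by (rule that)
qed

lemma top_ab_groupI:
  fixes A :: "('a, 'e) tgroup_scheme"
  assumes "comm_group A" "topspace (topol A) = carrier A" "Hausdorff_space (topol A)"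
    and "continuous_map (prod_topology (topol A) (topol A)) (topol A) (\<lambda>z. fst z \<otimes>\<^bsub>A\<^esub> snd z)"
    and "continuous_map (topol A) (topol A) i"
    and "\<And>x. x \<in> carrier A \<Longrightarrow> i x \<otimes>\<^bsub>A\<^esub> x = \<one>\<^bsub>A\<^esub>"
  shows "top_ab_group A"
proof -
  interpret comm_group A by fact
  have "i x = inv\<^bsub>A\<^esub> x" if "x \<in> carrier A" for x
    using assms(6)[OF that] that continuous_map_funspace[OF assms(5)] assms(2)
    by (intro inv_equality[symmetric]) auto
  then have "continuous_map (topol A) (topol A) (\<lambda>x. inv\<^bsub>A\<^esub> x)"
    using assms(2) by (intro continuous_map_eq[OF assms(5)]) auto
  then show ?thesis
    by unfold_locales (use assms in \<open>simp_all add: case_prod_unfold\<close>)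
qed

lemma top_objectI:
  assumes "top_ab_group V"
    and "\<And>r x. \<lbrakk>lin; x \<in> carrier V\<rbrakk> \<Longrightarrow> scale V r x \<in> carrier V"
    and "\<And>r x y. \<lbrakk>lin; x \<in> carrier V; y \<in> carrier V\<rbrakk> \<Longrightarrow>
           scale V r (x \<otimes>\<^bsub>V\<^esub> y) = scale V r x \<otimes>\<^bsub>V\<^esub> scale V r y"
    and "\<And>r s x. \<lbrakk>lin; x \<in> carrier V\<rbrakk> \<Longrightarrow> scale V (r + s) x = scale V r x \<otimes>\<^bsub>V\<^esub> scale V s x"
    and "\<And>r s x. \<lbrakk>lin; x \<in> carrier V\<rbrakk> \<Longrightarrow> scale V r (scale V s x) = scale V (r * s) x"
    and "\<And>x. \<lbrakk>lin; x \<in> carrier V\<rbrakk> \<Longrightarrow> scale V 1 x = x"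
    and "lin \<Longrightarrow> continuous_map (prod_topology euclideanreal (topol V)) (topol V)
           (\<lambda>z. scale V (fst z) (snd z))"
  shows "top_object lin V"
  using assms
  by (auto simp: top_object_def case_prod_unfold
      intro!: top_vector_space.intro top_vector_space_axioms.intro)

lemma
  assumes "top_object lin V" lin
  shows top_object_scale_mult_right: "\<lbrakk>x \<in> carrier V; y \<in> carrier V\<rbrakk> \<Longrightarrow>
          scale V r (x \<otimes>\<^bsub>V\<^esub> y) = scale V r x \<otimes>\<^bsub>V\<^esub> scale V r y"
    and top_object_scale_add_left: "x \<in> carrier V \<Longrightarrow>
          scale V (r + s) x = scale V r x \<otimes>\<^bsub>V\<^esub> scale V s x"
    and top_object_scale_scale: "x \<in> carrier V \<Longrightarrow> scale V r (scale V s x) = scale V (r * s) x"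
    and top_object_scale_one: "x \<in> carrier V \<Longrightarrow> scale V 1 x = x"
    and top_object_continuous_scale: "\<lbrakk>continuous_map X euclideanreal f; continuous_map X (topol V) g\<rbrakk>
          \<Longrightarrow> continuous_map X (topol V) (\<lambda>z. scale V (f z) (g z))"
proof -
  interpret V: top_vector_space V using assms by (simp add: top_object_def)
  show "\<lbrakk>x \<in> carrier V; y \<in> carrier V\<rbrakk> \<Longrightarrow>
          scale V r (x \<otimes>\<^bsub>V\<^esub> y) = scale V r x \<otimes>\<^bsub>V\<^esub> scale V r y"
    by (rule V.scale_mult_right)
  show "x \<in> carrier V \<Longrightarrow> scale V (r + s) x = scale V r x \<otimes>\<^bsub>V\<^esub> scale V s x"
    by (rule V.scale_add_left)
  show "x \<in> carrier V \<Longrightarrow> scale V r (scale V s x) = scale V (r * s) x"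
    by (rule V.scale_scale)
  show "x \<in> carrier V \<Longrightarrow> scale V 1 x = x"
    by (rule V.scale_one)
  show "\<lbrakk>continuous_map X euclideanreal f; continuous_map X (topol V) g\<rbrakk>
          \<Longrightarrow> continuous_map X (topol V) (\<lambda>z. scale V (f z) (g z))"
    using continuous_map_compose[OF continuous_map_pairedI V.continuous_scale] by (simp add: o_def)
qed

section \<open>Products and subobjects\<close>

lemma tvs_prod_simps [simp]:
  "carrier (tvs_prod A B) = carrier A \<times> carrier B"
  "x \<otimes>\<^bsub>tvs_prod A B\<^esub> y = (fst x \<otimes>\<^bsub>A\<^esub> fst y, snd x \<otimes>\<^bsub>B\<^esub> snd y)"
  "\<one>\<^bsub>tvs_prod A B\<^esub> = (\<one>\<^bsub>A\<^esub>, \<one>\<^bsub>B\<^esub>)"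
  "topol (tvs_prod A B) = prod_topology (topol A) (topol B)"
  "scale (tvs_prod A B) r x = (scale A r (fst x), scale B r (snd x))"
  by (simp_all add: tvs_prod_def tgroup_prod_def DirProd_def tgroup.defs tvs.defs monoid.defs
      case_prod_unfold)

lemma top_object_tvs_prod:
  assumes A: "top_object lin A" and B: "top_object lin B"
  shows "top_object lin (tvs_prod A B)"
proof (rule top_objectI)
  interpret A: top_ab_group A by (rule top_objectD[OF A])
  interpret B: top_ab_group B by (rule top_objectD[OF B])
  let ?T = "prod_topology (topol A) (topol B)"
  show "top_ab_group (tvs_prod A B)"
  proof (rule top_ab_groupI)
    show "comm_group (tvs_prod A B)"
    proof (rule comm_groupI)
      fix x assume "x \<in> carrier (tvs_prod A B)"
      then show "\<exists>y\<in>carrier (tvs_prod A B). y \<otimes>\<^bsub>tvs_prod A B\<^esub> x = \<one>\<^bsub>tvs_prod A B\<^esub>"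
        by (intro bexI[of _ "(inv\<^bsub>A\<^esub> fst x, inv\<^bsub>B\<^esub> snd x)"]) auto
    qed (auto simp: A.m_assoc B.m_assoc intro: A.m_comm B.m_comm)
    have 1: "continuous_map (prod_topology ?T ?T) (topol A) (\<lambda>z. fst (fst z) \<otimes>\<^bsub>A\<^esub> fst (snd z))"
      by (intro A.continuous_map_mult 
          continuous_map_compose[OF continuous_map_fst continuous_map_fst, unfolded o_def]
          continuous_map_compose[OF continuous_map_snd continuous_map_fst, unfolded o_def])
    have 2: "continuous_map (prod_topology ?T ?T) (topol B) (\<lambda>z. snd (fst z) \<otimes>\<^bsub>B\<^esub> snd (snd z))"
      by (intro B.continuous_map_mult
          continuous_map_compose[OF continuous_map_fst continuous_map_snd, unfolded o_def]
          continuous_map_compose[OF continuous_map_snd continuous_map_snd, unfolded o_def])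
    show "continuous_map (prod_topology (topol (tvs_prod A B)) (topol (tvs_prod A B)))
            (topol (tvs_prod A B)) (\<lambda>z. fst z \<otimes>\<^bsub>tvs_prod A B\<^esub> snd z)"
      using continuous_map_pairedI[OF 1 2] by simp
    show "continuous_map (topol (tvs_prod A B)) (topol (tvs_prod A B))
            (\<lambda>z. (inv\<^bsub>A\<^esub> (fst z), inv\<^bsub>B\<^esub> (snd z)))"
      using A.continuous_map_inv[OF continuous_map_fst, of "topol B"]
        B.continuous_map_inv[OF continuous_map_snd, of "topol A"]
      by (simp add: continuous_map_pairedI)
  qed (auto simp: A.topspace_topol B.topspace_topol Hausdorff_space_prod_topology A.Hausdorff B.Hausdorff)
  show "continuous_map (prod_topology euclideanreal (topol (tvs_prod A B))) (topol (tvs_prod A B))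
          (\<lambda>z. scale (tvs_prod A B) (fst z) (snd z))" if lin
    unfolding tvs_prod_simps
    by (intro continuous_map_pairedI top_object_continuous_scale[OF A that]
        top_object_continuous_scale[OF B that] continuous_map_fst
        continuous_map_compose[OF continuous_map_snd continuous_map_fst, unfolded o_def]
        continuous_map_compose[OF continuous_map_snd continuous_map_snd, unfolded o_def])
qed (auto simp: top_object_scale_closed[OF A] top_object_scale_closed[OF B]
    top_object_scale_mult_right[OF A] top_object_scale_mult_right[OF B]
    top_object_scale_add_left[OF A] top_object_scale_add_left[OF B]
    top_object_scale_scale[OF A] top_object_scale_scale[OF B]
    top_object_scale_one[OF A] top_object_scale_one[OF B])

lemma top_morphism_fst: "top_morphism lin (tvs_prod A B) A fst"
  by (rule top_morphismI) (auto simp: continuous_map_fst)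

lemma top_morphism_snd: "top_morphism lin (tvs_prod A B) B snd"
  by (rule top_morphismI) (auto simp: continuous_map_snd)

lemma top_morphism_pair:
  assumes f: "top_morphism lin C A f" and g: "top_morphism lin C B g"
  shows "top_morphism lin C (tvs_prod A B) (\<lambda>x. (f x, g x))"
  by (rule top_morphismI)
    (auto simp: top_morphism_closed[OF f] top_morphism_closed[OF g] top_morphism_mult[OF f]
      top_morphism_mult[OF g] top_morphism_scale[OF f] top_morphism_scale[OF g]
      intro: continuous_map_pairedI top_morphism_continuous[OF f] top_morphism_continuous[OF g])

lemma tvs_Prod_simps [simp]:
  "carrier (tvs_Prod I Y) = (\<Pi>\<^sub>E i\<in>I. carrier (Y i))"
  "x \<otimes>\<^bsub>tvs_Prod I Y\<^esub> y = (\<lambda>i\<in>I. x i \<otimes>\<^bsub>Y i\<^esub> y i)"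
  "\<one>\<^bsub>tvs_Prod I Y\<^esub> = (\<lambda>i\<in>I. \<one>\<^bsub>Y i\<^esub>)"
  "topol (tvs_Prod I Y) = product_topology (\<lambda>i. topol (Y i)) I"
  "scale (tvs_Prod I Y) r x = (\<lambda>i\<in>I. scale (Y i) r (x i))"
  by (simp_all add: tvs_Prod_def tgroup_Prod_def tgroup.defs tvs.defs monoid.defs)

lemma top_object_tvs_Prod:
  assumes Y: "\<And>i. i \<in> I \<Longrightarrow> top_object lin (Y i)"
  shows "top_object lin (tvs_Prod I Y)"
proof (rule top_objectI)
  have g: "top_ab_group (Y i)" if "i \<in> I" for i
    by (rule top_objectD[OF Y[OF that]])
  have cg: "comm_group (Y i)" if "i \<in> I" for i
    using g[OF that] by (simp add: top_ab_group_def)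
  have cm: "comm_monoid (Y i)" "monoid (Y i)" "group (Y i)" if "i \<in> I" for i
    using cg[OF that] by (simp_all add: comm_group_def group_def)
  let ?T = "product_topology (\<lambda>i. topol (Y i)) I"
  have coord: "continuous_map ?T (topol (Y i)) (\<lambda>x. x i)" if "i \<in> I" for i
    by (rule continuous_map_product_projection[OF that])
  show "top_ab_group (tvs_Prod I Y)"
  proof (rule top_ab_groupI)
    show "comm_group (tvs_Prod I Y)"
    proof (rule comm_groupI)
      fix x assume "x \<in> carrier (tvs_Prod I Y)"
      then show "\<exists>y\<in>carrier (tvs_Prod I Y). y \<otimes>\<^bsub>tvs_Prod I Y\<^esub> x = \<one>\<^bsub>tvs_Prod I Y\<^esub>"
        by (intro bexI[of _ "\<lambda>i\<in>I. inv\<^bsub>Y i\<^esub> x i"])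
          (auto simp: PiE_iff cm group.inv_closed group.l_inv intro!: restrict_ext)
    qed (auto simp: PiE_iff cm monoid.m_closed monoid.m_assoc monoid.l_one extensional_def
          intro!: restrict_ext ext comm_monoid.m_comm)
    show "continuous_map (prod_topology (topol (tvs_Prod I Y)) (topol (tvs_Prod I Y)))
            (topol (tvs_Prod I Y)) (\<lambda>z. fst z \<otimes>\<^bsub>tvs_Prod I Y\<^esub> snd z)"
      using top_ab_group.continuous_map_mult[OF g
          continuous_map_compose[OF continuous_map_fst coord, of _ ?T]
          continuous_map_compose[OF continuous_map_snd coord, of _ ?T]]
      by (auto simp: continuous_map_componentwise o_def)
    show "continuous_map (topol (tvs_Prod I Y)) (topol (tvs_Prod I Y)) (\<lambda>x. \<lambda>i\<in>I. inv\<^bsub>Y i\<^esub> (x i))"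
      using top_ab_group.continuous_map_inv[OF g coord]
      by (auto simp: continuous_map_componentwise)
    show "topspace (topol (tvs_Prod I Y)) = carrier (tvs_Prod I Y)"
      using g by (auto simp: top_ab_group.topspace_topol intro!: PiE_cong)
    show "Hausdorff_space (topol (tvs_Prod I Y))"
      using g by (auto simp: Hausdorff_space_product_topology top_ab_group.Hausdorff)
    show "(\<lambda>i\<in>I. inv\<^bsub>Y i\<^esub> (x i)) \<otimes>\<^bsub>tvs_Prod I Y\<^esub> x = \<one>\<^bsub>tvs_Prod I Y\<^esub>"
      if "x \<in> carrier (tvs_Prod I Y)" for x
      using that by (auto simp: PiE_iff cm group.l_inv intro!: restrict_ext)
  qed
  show "continuous_map (prod_topology euclideanreal (topol (tvs_Prod I Y))) (topol (tvs_Prod I Y))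
          (\<lambda>z. scale (tvs_Prod I Y) (fst z) (snd z))" if lin
    unfolding tvs_Prod_simps continuous_map_componentwise
    by (auto intro!: top_object_continuous_scale[OF Y that] continuous_map_fst
        continuous_map_compose[OF continuous_map_snd coord, unfolded o_def])
  note [simp] = top_object_scale_closed[OF Y] top_object_scale_mult_right[OF Y]
    top_object_scale_add_left[OF Y] top_object_scale_scale[OF Y] top_object_scale_one[OF Y]
  show "scale (tvs_Prod I Y) r x \<in> carrier (tvs_Prod I Y)"
    if lin "x \<in> carrier (tvs_Prod I Y)" for r x
    using that by (auto simp: PiE_iff)
  show "scale (tvs_Prod I Y) r (x \<otimes>\<^bsub>tvs_Prod I Y\<^esub> y) =
      scale (tvs_Prod I Y) r x \<otimes>\<^bsub>tvs_Prod I Y\<^esub> scale (tvs_Prod I Y) r y"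
    if lin "x \<in> carrier (tvs_Prod I Y)" "y \<in> carrier (tvs_Prod I Y)" for r x y
    using that by (auto simp: PiE_iff intro!: restrict_ext)
  show "scale (tvs_Prod I Y) (r + s) x = scale (tvs_Prod I Y) r x \<otimes>\<^bsub>tvs_Prod I Y\<^esub> scale (tvs_Prod I Y) s x"
    if lin "x \<in> carrier (tvs_Prod I Y)" for r s x
    using that by (auto simp: PiE_iff intro!: restrict_ext)
  show "scale (tvs_Prod I Y) r (scale (tvs_Prod I Y) s x) = scale (tvs_Prod I Y) (r * s) x"
    if lin "x \<in> carrier (tvs_Prod I Y)" for r s x
    using that by (auto simp: PiE_iff intro!: restrict_ext)
  show "scale (tvs_Prod I Y) 1 x = x" if lin "x \<in> carrier (tvs_Prod I Y)" for x
    using that by (auto simp: PiE_iff extensional_def intro!: ext)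
qed

lemma top_morphism_coord: "i \<in> I \<Longrightarrow> top_morphism lin (tvs_Prod I Y) (Y i) (\<lambda>x. x i)"
  by (rule top_morphismI) (auto intro: continuous_map_product_projection)

lemma top_morphism_tuple:
  assumes f: "\<And>i. i \<in> I \<Longrightarrow> top_morphism lin C (Y i) (f i)"
  shows "top_morphism lin C (tvs_Prod I Y) (\<lambda>x. \<lambda>i\<in>I. f i x)"
  by (rule top_morphismI)
    (auto simp: continuous_map_componentwise top_morphism_closed[OF f] top_morphism_mult[OF f]
      top_morphism_scale[OF f] intro!: top_morphism_continuous[OF f] restrict_ext)

definition tvs_subobject :: "'a tvs \<Rightarrow> 'a set \<Rightarrow> 'a tvs" where
  "tvs_subobject A S = A\<lparr>carrier := S, topol := subtopology (topol A) S\<rparr>"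

lemma tvs_subobject_simps [simp]:
  "carrier (tvs_subobject A S) = S"
  "monoid.mult (tvs_subobject A S) = monoid.mult A"
  "\<one>\<^bsub>tvs_subobject A S\<^esub> = \<one>\<^bsub>A\<^esub>"
  "topol (tvs_subobject A S) = subtopology (topol A) S"
  "scale (tvs_subobject A S) = scale A"
  by (simp_all add: tvs_subobject_def)

lemma top_object_tvs_subobject:
  assumes A: "top_object lin A" and S: "subgroup S A"
    and scale: "\<And>r x. \<lbrakk>lin; x \<in> S\<rbrakk> \<Longrightarrow> scale A r x \<in> S"
  shows "top_object lin (tvs_subobject A S)"
proof (rule top_objectI)
  interpret A: top_ab_group A by (rule top_objectD[OF A])
  interpret S: subgroup S A by (rule S)
  note sub = S.subset[THEN subsetD]
  let ?T = "subtopology (topol A) S"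
  have incl: "continuous_map ?T (topol A) (\<lambda>x. x)"
    using continuous_map_id_subt[of "topol A" S] by (simp add: id_def)
  show "top_ab_group (tvs_subobject A S)"
  proof (rule top_ab_groupI)
    show "comm_group (tvs_subobject A S)"
    proof (rule comm_groupI)
      fix x assume "x \<in> carrier (tvs_subobject A S)"
      then show "\<exists>y\<in>carrier (tvs_subobject A S). y \<otimes>\<^bsub>tvs_subobject A S\<^esub> x = \<one>\<^bsub>tvs_subobject A S\<^esub>"
        by (intro bexI[of _ "inv\<^bsub>A\<^esub> x"]) (auto simp: sub)
    qed (auto simp: sub A.m_assoc intro: A.m_comm)
    have "continuous_map (prod_topology ?T ?T) (topol A) (\<lambda>z. fst z \<otimes>\<^bsub>A\<^esub> snd z)"
      by (intro A.continuous_map_mult)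
        (use continuous_map_compose[OF continuous_map_fst incl, of ?T]
          continuous_map_compose[OF continuous_map_snd incl, of ?T] in \<open>simp_all add: o_def\<close>)
    then show "continuous_map (prod_topology (topol (tvs_subobject A S)) (topol (tvs_subobject A S)))
        (topol (tvs_subobject A S)) (\<lambda>z. fst z \<otimes>\<^bsub>tvs_subobject A S\<^esub> snd z)"
      by (auto simp: continuous_map_in_subtopology)
    show "continuous_map (topol (tvs_subobject A S)) (topol (tvs_subobject A S)) (\<lambda>x. inv\<^bsub>A\<^esub> x)"
      using A.continuous_map_inv[OF incl] by (auto simp: continuous_map_in_subtopology)
    show "topspace (topol (tvs_subobject A S)) = carrier (tvs_subobject A S)"
      using S.subset by (auto simp: A.topspace_topol)
  qed (auto simp: Hausdorff_space_subtopology[OF A.Hausdorff] sub)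
  show "continuous_map (prod_topology euclideanreal (topol (tvs_subobject A S)))
      (topol (tvs_subobject A S)) (\<lambda>z. scale (tvs_subobject A S) (fst z) (snd z))" if lin
    unfolding tvs_subobject_simps continuous_map_in_subtopology
    using scale[OF that]
    by (auto intro!: top_object_continuous_scale[OF A that] continuous_map_fst
        continuous_map_compose[OF continuous_map_snd incl, unfolded o_def])
  fix x assume "x \<in> carrier (tvs_subobject A S)" and lin
  then have "x \<in> carrier A" lin using sub by auto
  note * = this
  show "scale (tvs_subobject A S) (r + s) x =
      scale (tvs_subobject A S) r x \<otimes>\<^bsub>tvs_subobject A S\<^esub> scale (tvs_subobject A S) s x" for r s
    using * by (simp add: top_object_scale_add_left[OF A])
  show "scale (tvs_subobject A S) r (scale (tvs_subobject A S) s x) =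
      scale (tvs_subobject A S) (r * s) x" for r s
    using * by (simp add: top_object_scale_scale[OF A])
  show "scale (tvs_subobject A S) 1 x = x"
    using * by (simp add: top_object_scale_one[OF A])
  show "scale (tvs_subobject A S) r (x \<otimes>\<^bsub>tvs_subobject A S\<^esub> y) =
      scale (tvs_subobject A S) r x \<otimes>\<^bsub>tvs_subobject A S\<^esub> scale (tvs_subobject A S) r y"
    if "y \<in> carrier (tvs_subobject A S)" for r y
    using * that sub by (simp add: top_object_scale_mult_right[OF A])
qed (simp add: scale)

lemma top_morphism_into_subobject:
  assumes "top_morphism lin B A f" "\<And>x. x \<in> carrier B \<Longrightarrow> f x \<in> S" "top_object lin B"
  shows "top_morphism lin B (tvs_subobject A S) f"
  using assms top_ab_group.topspace_topol[OF top_objectD[OF assms(3)]]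
  by (auto simp: top_morphism_def continuous_hom_def hom_def continuous_map_in_subtopology)

lemma top_morphism_from_subobject:
  assumes "top_morphism lin A B f" "S \<subseteq> carrier A"
  shows "top_morphism lin (tvs_subobject A S) B f"
  using assms
  by (auto simp: top_morphism_def continuous_hom_def hom_def continuous_map_from_subtopology
      subset_iff Pi_iff)

text \<open>
  Pull-backs and fibre products are cut out of a product by equations between morphisms; the index
  set allows for a whole family of equations.
\<close>

lemma top_object_equalizer:
  assumes A: "top_object lin A" and B: "\<And>i. i \<in> I \<Longrightarrow> top_object lin (B i)"
    and f: "\<And>i. i \<in> I \<Longrightarrow> top_morphism lin A (B i) (f i)"
    and g: "\<And>i. i \<in> I \<Longrightarrow> top_morphism lin A (B i) (g i)"
  shows "top_object lin (tvs_subobject A {x \<in> carrier A. \<forall>i\<in>I. f i x = g i x})"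
proof (rule top_object_tvs_subobject[OF A])
  interpret A: top_ab_group A by (rule top_objectD[OF A])
  have h: "group_hom A (B i) (f i)" "group_hom A (B i) (g i)" if "i \<in> I" for i
    using that by (auto intro: top_morphism_group_hom[OF A B] f g)
  show "subgroup {x \<in> carrier A. \<forall>i\<in>I. f i x = g i x} A"
    by (rule A.subgroupI)
      (auto simp: group_hom.hom_inv[OF h(1)] group_hom.hom_inv[OF h(2)]
        group_hom.hom_mult[OF h(1)] group_hom.hom_mult[OF h(2)]
        group_hom.hom_one[OF h(1)] group_hom.hom_one[OF h(2)] intro!: exI[of _ "\<one>\<^bsub>A\<^esub>"])
  show "scale A r x \<in> {x \<in> carrier A. \<forall>i\<in>I. f i x = g i x}"
    if lin "x \<in> {x \<in> carrier A. \<forall>i\<in>I. f i x = g i x}" for r x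
    using that by (auto simp: top_object_scale_closed[OF A] top_morphism_scale[OF f]
        top_morphism_scale[OF g])
qed

section \<open>Quotients\<close>

lemma open_map_prod_map:
  assumes f: "open_map X X' f" and g: "open_map Y Y' g"
  shows "open_map (prod_topology X Y) (prod_topology X' Y') (\<lambda>z. (f (fst z), g (snd z)))"
  unfolding open_map_def
proof (intro allI impI)
  fix U assume U: "openin (prod_topology X Y) U"
  show "openin (prod_topology X' Y') ((\<lambda>z. (f (fst z), g (snd z))) ` U)"
    unfolding openin_prod_topology_alt
  proof (intro allI impI)
    fix x' y' assume "(x', y') \<in> (\<lambda>z. (f (fst z), g (snd z))) ` U"
    then obtain x y where xy: "(x, y) \<in> U" "x' = f x" "y' = g y" by auto
    then obtain V W where VW: "openin X V" "openin Y W" "x \<in> V" "y \<in> W" "V \<times> W \<subseteq> U"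
      using U unfolding openin_prod_topology_alt by meson
    have "f ` V \<times> g ` W \<subseteq> (\<lambda>z. (f (fst z), g (snd z))) ` U"
      using VW(5) by force
    moreover have "openin X' (f ` V)" "openin Y' (g ` W)"
      using VW(1,2) f g by (auto simp: open_map_def)
    ultimately show "\<exists>V W. openin X' V \<and> openin Y' W \<and> x' \<in> V \<and> y' \<in> W \<and>
        V \<times> W \<subseteq> (\<lambda>z. (f (fst z), g (snd z))) ` U"
      using VW(3,4) xy(2,3) by blast
  qed
qed

lemma tvs_quotient_simps:
  "carrier (tvs_quotient A N) = rcosets\<^bsub>A\<^esub> N"
  "monoid.mult (tvs_quotient A N) = (<#>\<^bsub>A\<^esub>)"
  "\<one>\<^bsub>tvs_quotient A N\<^esub> = N"
  "topol (tvs_quotient A N) = topology (\<lambda>U. U \<subseteq> rcosets\<^bsub>A\<^esub> N \<and> openin (topol A) (\<Union>U))"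
  "scale (tvs_quotient A N) r C = (\<Union>x\<in>C. N #>\<^bsub>A\<^esub> scale A r x)"
  by (simp_all add: tvs_quotient_def tgroup_quotient_def FactGroup_def tgroup.defs tvs.defs monoid.defs)

context
  fixes lin :: bool and A :: "'a tvs" and N :: "'a set"
  assumes A: "top_object lin A" and N: "subgroup N A"
    and N_scale: "\<And>r x. \<lbrakk>lin; x \<in> N\<rbrakk> \<Longrightarrow> scale A r x \<in> N"
begin

interpretation A: top_ab_group A by (rule top_objectD[OF A])
interpretation N: normal N A by (rule A.subgroup_imp_normal[OF N])

private abbreviation "Q \<equiv> tvs_quotient A N"
private abbreviation "q \<equiv> (\<lambda>x. N #>\<^bsub>A\<^esub> x)"

private lemma coset_eqI: "\<lbrakk>x \<in> q y; y \<in> carrier A\<rbrakk> \<Longrightarrow> q y = q x"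
  by (rule A.repr_independence[OF _ _ N])

private lemma coset_self: "x \<in> carrier A \<Longrightarrow> x \<in> q x"
  by (rule A.rcos_self[OF _ N])

private lemma carrier_Q: "carrier Q = q ` carrier A"
  by (auto simp: tvs_quotient_simps RCOSETS_def)

private lemma coset_in_iff:
  assumes "U \<subseteq> carrier Q" "x \<in> carrier A"
  shows "q x \<in> U \<longleftrightarrow> x \<in> \<Union>U"
proof
  assume "x \<in> \<Union>U"
  then obtain C where C: "C \<in> U" "x \<in> C" by blast
  then obtain y where "y \<in> carrier A" "C = q y" using assms by (auto simp: carrier_Q)
  then show "q x \<in> U" using C coset_eqI by auto
qed (use coset_self[OF assms(2)] in blast)

private lemma Union_subset: "U \<subseteq> carrier Q \<Longrightarrow> \<Union>U \<subseteq> carrier A"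
  using A.rcosets_part_G[OF N] by (auto simp: tvs_quotient_simps)

text \<open>
  Distinct cosets are disjoint, so unions of sets of cosets commute with intersections; hence the
  open sets named in the definition of the quotient form a topology.
\<close>

lemma openin_tvs_quotient:
  "openin (topol (tvs_quotient A N)) U \<longleftrightarrow> U \<subseteq> carrier (tvs_quotient A N) \<and> openin (topol A) (\<Union>U)"
proof -
  have "istopology (\<lambda>U. U \<subseteq> carrier Q \<and> openin (topol A) (\<Union>U))"
    unfolding istopology_def
  proof (intro conjI allI impI; (elim conjE)?)
    fix S T assume ST: "S \<subseteq> carrier Q" "T \<subseteq> carrier Q" "openin (topol A) (\<Union>S)" "openin (topol A) (\<Union>T)"
    have "x \<in> \<Union>(S \<inter> T) \<longleftrightarrow> x \<in> \<Union>S \<and> x \<in> \<Union>T" if "x \<in> carrier A" for x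
      using coset_in_iff[OF ST(1) that] coset_in_iff[OF ST(2) that]
        coset_in_iff[of "S \<inter> T" x] ST that by blast
    then have "\<Union>(S \<inter> T) = \<Union>S \<inter> \<Union>T"
      using Union_subset[OF ST(1)] Union_subset[of "S \<inter> T"] ST(1) by blast
    then show "openin (topol A) (\<Union>(S \<inter> T))" using ST by (simp add: openin_Int)
  next
    fix K assume K: "\<forall>S\<in>K. S \<subseteq> carrier Q \<and> openin (topol A) (\<Union>S)"
    have "\<Union>(\<Union>K) = (\<Union>S\<in>K. \<Union>S)" by blast
    then show "openin (topol A) (\<Union>(\<Union>K))" using K by auto
  qed auto
  then show ?thesis
    by (simp add: tvs_quotient_simps)
qed

private lemma topspace_Q: "topspace (topol Q) = carrier Q"
proof -
  have "openin (topol Q) (carrier Q)"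
    using A.rcosets_part_G[OF N] A.topspace_topol
    by (simp add: openin_tvs_quotient) (metis openin_topspace tvs_quotient_simps(1))
  then show ?thesis
    by (metis openin_subset openin_topspace openin_tvs_quotient subset_antisym)
qed

private lemma continuous_q: "continuous_map (topol A) (topol Q) q"
  unfolding continuous_map_def
proof (intro conjI allI impI)
  show "q \<in> topspace (topol A) \<rightarrow> topspace (topol Q)"
    by (auto simp: topspace_Q A.topspace_topol carrier_Q)
  fix U assume U: "openin (topol Q) U"
  then have "{x \<in> topspace (topol A). q x \<in> U} = \<Union>U"
    using coset_in_iff[of U] Union_subset[of U] by (auto simp: openin_tvs_quotient A.topspace_topol)
  then show "openin (topol A) {x \<in> topspace (topol A). q x \<in> U}"
    using U by (simp add: openin_tvs_quotient)
qed

text \<open>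
  The union of the cosets that meet an open set \<open>U\<close> is a union of translates of \<open>U\<close>.
\<close>

lemma open_map_tvs_quotient: "open_map (topol A) (topol (tvs_quotient A N)) (\<lambda>x. N #>\<^bsub>A\<^esub> x)"
  unfolding open_map_def
proof (intro allI impI)
  fix U assume U: "openin (topol A) U"
  have UA: "U \<subseteq> carrier A" by (rule A.openin_subset_carrier[OF U])
  have *: "\<Union>(q ` U) = (\<Union>n\<in>N. {x \<in> carrier A. inv\<^bsub>A\<^esub> n \<otimes>\<^bsub>A\<^esub> x \<in> U})"
  proof (intro equalityI subsetI)
    fix x assume "x \<in> \<Union>(q ` U)"
    then obtain u n where un: "u \<in> U" "n \<in> N" "x = n \<otimes>\<^bsub>A\<^esub> u" by (auto simp: r_coset_def)
    then show "x \<in> (\<Union>n\<in>N. {x \<in> carrier A. inv\<^bsub>A\<^esub> n \<otimes>\<^bsub>A\<^esub> x \<in> U})"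
      using UA by (auto simp: A.m_assoc[symmetric] intro!: bexI[of _ n])
  next
    fix x assume "x \<in> (\<Union>n\<in>N. {x \<in> carrier A. inv\<^bsub>A\<^esub> n \<otimes>\<^bsub>A\<^esub> x \<in> U})"
    then obtain n where n: "n \<in> N" "x \<in> carrier A" "inv\<^bsub>A\<^esub> n \<otimes>\<^bsub>A\<^esub> x \<in> U" by blast
    have "x = n \<otimes>\<^bsub>A\<^esub> (inv\<^bsub>A\<^esub> n \<otimes>\<^bsub>A\<^esub> x)" using n by (simp add: A.m_assoc[symmetric])
    then have "x \<in> q (inv\<^bsub>A\<^esub> n \<otimes>\<^bsub>A\<^esub> x)" using n(1) unfolding r_coset_def by blast
    then show "x \<in> \<Union>(q ` U)" using n(3) by blast
  qed
  show "openin (topol Q) (q ` U)"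
    unfolding openin_tvs_quotient *
    using UA by (auto simp: carrier_Q intro!: openin_Union A.openin_translate[OF U])
qed

private lemma q_mult:
  "\<lbrakk>x \<in> carrier A; y \<in> carrier A\<rbrakk> \<Longrightarrow> q x \<otimes>\<^bsub>Q\<^esub> q y = q (x \<otimes>\<^bsub>A\<^esub> y)"
  by (simp add: tvs_quotient_simps N.rcos_sum)

private lemma q_scale:
  assumes lin "x \<in> carrier A"
  shows "scale Q r (q x) = q (scale A r x)"
proof -
  have "q (scale A r y) = q (scale A r x)" if y: "y \<in> q x" for y
  proof -
    obtain n where n: "n \<in> N" "y = n \<otimes>\<^bsub>A\<^esub> x" using y by (auto simp: r_coset_def)
    have "scale A r y = scale A r n \<otimes>\<^bsub>A\<^esub> scale A r x"
      using n assms by (simp add: top_object_scale_mult_right[OF A])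
    then have "scale A r y \<in> q (scale A r x)"
      using N_scale[OF assms(1) n(1)] unfolding r_coset_def by blast
    then show ?thesis
      using coset_eqI top_object_scale_closed[OF A] assms by blast
  qed
  then show ?thesis
    unfolding tvs_quotient_simps using coset_self[OF assms(2)] by blast
qed

private lemma comm_group_Q: "comm_group Q"
proof -
  interpret F: comm_group "A Mod N" by (rule A.abelian_FactGroup[OF N])
  have eq: "carrier Q = carrier (A Mod N)" "monoid.mult Q = monoid.mult (A Mod N)" "\<one>\<^bsub>Q\<^esub> = \<one>\<^bsub>A Mod N\<^esub>"
    by (simp_all add: tvs_quotient_simps FactGroup_def)
  show ?thesis
    by (rule comm_groupI; unfold eq)
      (rule F.m_closed F.one_closed F.m_assoc F.m_comm F.l_one F.l_inv_ex; assumption)+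
qed

lemma top_morphism_tvs_quotient: "top_morphism lin A (tvs_quotient A N) (\<lambda>x. N #>\<^bsub>A\<^esub> x)"
  by (rule top_morphismI) (auto simp: carrier_Q q_mult q_scale continuous_q)

lemma tvs_quotient_eq_one_iff: "x \<in> carrier A \<Longrightarrow> N #>\<^bsub>A\<^esub> x = \<one>\<^bsub>tvs_quotient A N\<^esub> \<longleftrightarrow> x \<in> N"
  unfolding tvs_quotient_simps(3)
  by (metis coset_self N.rcos_const A.is_group)

lemma tvs_quotient_surj: "(\<lambda>x. N #>\<^bsub>A\<^esub> x) ` carrier A = carrier (tvs_quotient A N)"
  by (simp add: carrier_Q)

private lemma quotient_map_q: "quotient_map (topol A) (topol Q) q"
  by (rule continuous_open_imp_quotient_map[OF continuous_q open_map_tvs_quotient])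
    (simp add: topspace_Q carrier_Q A.topspace_topol)

text \<open>
  If \<open>x - y\<close> is not in the closed subgroup \<open>N\<close>, then neither is \<open>u - v\<close> for \<open>u\<close> near \<open>x\<close> and \<open>v\<close> near
  \<open>y\<close>; the images of these neighbourhoods separate the two cosets.
\<close>

lemma Hausdorff_tvs_quotient:
  assumes closed: "closedin (topol A) N"
  shows "Hausdorff_space (topol (tvs_quotient A N))"
  unfolding Hausdorff_space_def topspace_Q
proof (intro allI impI; elim conjE)
  fix C D assume "C \<in> carrier Q" "D \<in> carrier Q" "C \<noteq> D"
  then obtain x y where xy: "x \<in> carrier A" "y \<in> carrier A" "C = q x" "D = q y"
    by (auto simp: carrier_Q)
  let ?W = "{z \<in> topspace (prod_topology (topol A) (topol A)).
     fst z \<otimes>\<^bsub>A\<^esub> inv\<^bsub>A\<^esub> (snd z) \<in> carrier A - N}"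
  have coset: "q a = q b" if "a \<otimes>\<^bsub>A\<^esub> inv\<^bsub>A\<^esub> b \<in> N" "a \<in> carrier A" "b \<in> carrier A" for a b
  proof -
    have "a = (a \<otimes>\<^bsub>A\<^esub> inv\<^bsub>A\<^esub> b) \<otimes>\<^bsub>A\<^esub> b" using that by (simp add: A.m_assoc)
    then have "a \<in> q b" using that(1) unfolding r_coset_def by blast
    then show ?thesis using coset_eqI that by simp
  qed
  have coset': "a \<otimes>\<^bsub>A\<^esub> inv\<^bsub>A\<^esub> b \<in> N" if "q a = q b" "a \<in> carrier A" "b \<in> carrier A" for a b
  proof -
    have "a \<in> q b" using coset_self[OF that(2)] that(1) by simp
    then obtain n where n: "n \<in> N" "a = n \<otimes>\<^bsub>A\<^esub> b" by (auto simp: r_coset_def)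
    then show ?thesis using that by (simp add: A.m_assoc)
  qed
  have "continuous_map (prod_topology (topol A) (topol A)) (topol A) (\<lambda>z. fst z \<otimes>\<^bsub>A\<^esub> inv\<^bsub>A\<^esub> (snd z))"
    by (intro A.continuous_map_mult A.continuous_map_inv continuous_map_fst continuous_map_snd)
  moreover have "openin (topol A) (carrier A - N)"
    using closed by (simp add: closedin_def A.topspace_topol)
  ultimately have "openin (prod_topology (topol A) (topol A)) ?W"
    by (rule openin_continuous_map_preimage)
  moreover have "x \<otimes>\<^bsub>A\<^esub> inv\<^bsub>A\<^esub> y \<notin> N"
    using xy coset[of x y] \<open>C \<noteq> D\<close> by blast
  then have "(x, y) \<in> ?W"
    using xy(1,2) by (simp add: A.topspace_topol)
  ultimately obtain U V where UV: "openin (topol A) U" "openin (topol A) V" "x \<in> U" "y \<in> V" "U \<times> V \<subseteq> ?W"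
    unfolding openin_prod_topology_alt by meson
  have "disjnt (q ` U) (q ` V)"
    unfolding disjnt_iff
  proof (intro allI notI, elim conjE imageE)
    fix C u v assume "u \<in> U" "C = q u" "v \<in> V" "C = q v"
    then have "(u, v) \<in> ?W" and eq: "q u = q v" using UV(5) by blast+
    then have "u \<in> carrier A" "v \<in> carrier A" "u \<otimes>\<^bsub>A\<^esub> inv\<^bsub>A\<^esub> v \<notin> N"
      by (simp_all add: A.topspace_topol)
    then show False using coset'[OF eq] by blast
  qed
  moreover have "openin (topol Q) (q ` U)" "openin (topol Q) (q ` V)"
    using UV open_map_tvs_quotient by (auto simp: open_map_def)
  ultimately show "\<exists>U V. openin (topol Q) U \<and> openin (topol Q) V \<and> C \<in> U \<and> D \<in> V \<and> disjnt U V"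
    using UV(3,4) unfolding xy(3,4) by (meson imageI)
qed

text \<open>
  The operations of the quotient are continuous because the products of the projection with itself
  and with the identity of the reals are again open surjections, hence quotient maps.
\<close>

lemma top_object_tvs_quotient:
  assumes closed: "closedin (topol A) N"
  shows "top_object lin (tvs_quotient A N)"
proof (rule top_objectI)
  interpret Q: comm_group Q by (rule comm_group_Q)
  show "top_ab_group Q"
  proof (rule top_ab_groupI)
    let ?AA = "prod_topology (topol A) (topol A)" and ?QQ = "prod_topology (topol Q) (topol Q)"
    have "continuous_map ?AA ?QQ (\<lambda>z. (q (fst z), q (snd z)))"
      by (intro continuous_map_pairedI continuous_map_compose[OF continuous_map_fst continuous_q, unfolded o_def]
          continuous_map_compose[OF continuous_map_snd continuous_q, unfolded o_def])
    then have qq: "quotient_map ?AA ?QQ (\<lambda>z. (q (fst z), q (snd z)))"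
      by (rule continuous_open_imp_quotient_map[OF _ open_map_prod_map[OF open_map_tvs_quotient open_map_tvs_quotient]])
        (force simp: topspace_Q carrier_Q A.topspace_topol)
    have "continuous_map ?AA (topol Q) (\<lambda>z. q (fst z \<otimes>\<^bsub>A\<^esub> snd z))"
      by (rule continuous_map_compose[OF _ continuous_q, unfolded o_def])
        (intro A.continuous_map_mult continuous_map_fst continuous_map_snd)
    then have "continuous_map ?AA (topol Q) ((\<lambda>z. fst z \<otimes>\<^bsub>Q\<^esub> snd z) \<circ> (\<lambda>z. (q (fst z), q (snd z))))"
      by (rule continuous_map_eq) (auto simp: q_mult A.topspace_topol)
    then show "continuous_map ?QQ (topol Q) (\<lambda>z. fst z \<otimes>\<^bsub>Q\<^esub> snd z)"
      by (rule continuous_compose_quotient_map[OF qq])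
    have "continuous_map (topol A) (topol Q) (\<lambda>x. q (inv\<^bsub>A\<^esub> x))"
      by (rule continuous_map_compose[OF A.continuous_inv continuous_q, unfolded o_def])
    moreover have "group_hom A Q q"
      by (simp add: group_hom_def group_hom_axioms_def Q.is_group
          top_morphism_hom[OF top_morphism_tvs_quotient])
    ultimately have "continuous_map (topol A) (topol Q) ((\<lambda>x. inv\<^bsub>Q\<^esub> x) \<circ> q)"
      by (elim continuous_map_eq) (simp add: A.topspace_topol group_hom.hom_inv)
    then show "continuous_map (topol Q) (topol Q) (\<lambda>x. inv\<^bsub>Q\<^esub> x)"
      by (rule continuous_compose_quotient_map[OF quotient_map_q])
  qed (auto simp: topspace_Q comm_group_Q Hausdorff_tvs_quotient[OF closed])
  show "continuous_map (prod_topology euclideanreal (topol Q)) (topol Q) (\<lambda>z. scale Q (fst z) (snd z))" if lin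
  proof -
    let ?A = "prod_topology euclideanreal (topol A)" and ?Q = "prod_topology euclideanreal (topol Q)"
    have "continuous_map ?A ?Q (\<lambda>z. (id (fst z), q (snd z)))"
      by (intro continuous_map_pairedI continuous_map_compose[OF continuous_map_fst continuous_map_id, unfolded o_def]
          continuous_map_compose[OF continuous_map_snd continuous_q, unfolded o_def])
    then have qq: "quotient_map ?A ?Q (\<lambda>z. (id (fst z), q (snd z)))"
      by (rule continuous_open_imp_quotient_map[OF _ open_map_prod_map[OF open_map_id open_map_tvs_quotient]])
        (force simp: topspace_Q carrier_Q A.topspace_topol)
    have "continuous_map ?A (topol Q) (\<lambda>z. q (scale A (fst z) (snd z)))"
      by (rule continuous_map_compose[OF _ continuous_q, unfolded o_def])
        (intro top_object_continuous_scale[OF A that] continuous_map_fst continuous_map_snd)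
    then have "continuous_map ?A (topol Q) ((\<lambda>z. scale Q (fst z) (snd z)) \<circ> (\<lambda>z. (id (fst z), q (snd z))))"
      by (rule continuous_map_eq) (auto simp: q_scale[OF that] A.topspace_topol)
    then show ?thesis by (rule continuous_compose_quotient_map[OF qq])
  qed
  note A_scale = top_object_scale_closed[OF A] top_object_scale_mult_right[OF A]
    top_object_scale_add_left[OF A] top_object_scale_scale[OF A] top_object_scale_one[OF A]
  fix r s C assume lin "C \<in> carrier Q"
  then obtain x where x: lin "x \<in> carrier A" and C: "C = q x" unfolding carrier_Q by blast
  show "scale Q r C \<in> carrier Q"
    unfolding C q_scale[OF x] carrier_Q using x A_scale(1) by blast
  show "scale Q (r + s) C = scale Q r C \<otimes>\<^bsub>Q\<^esub> scale Q s C"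
    unfolding C q_scale[OF x] using x A_scale(1) by (simp add: q_mult A_scale(3))
  show "scale Q r (scale Q s C) = scale Q (r * s) C"
    unfolding C q_scale[OF x] using x A_scale(1) by (simp add: q_scale A_scale(4))
  show "scale Q 1 C = C"
    unfolding C q_scale[OF x] using x by (simp add: A_scale(5))
  fix D assume "D \<in> carrier Q"
  then obtain y where y: "y \<in> carrier A" and D: "D = q y" unfolding carrier_Q by blast
  show "scale Q r (C \<otimes>\<^bsub>Q\<^esub> D) = scale Q r C \<otimes>\<^bsub>Q\<^esub> scale Q r D"
    unfolding C D using x y A_scale(1) by (simp add: q_mult q_scale A_scale(2))
qed

end

section \<open>Extensions and the maps between them\<close>

lemma top_morphism_cong:
  assumes A: "top_object lin A" and f: "top_morphism lin A B f"
    and eq: "\<And>x. x \<in> carrier A \<Longrightarrow> g x = f x"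
  shows "top_morphism lin A B g"
proof -
  interpret A: top_ab_group A by (rule top_objectD[OF A])
  show ?thesis
  proof (rule top_morphismI)
    show "continuous_map (topol A) (topol B) g"
      by (rule continuous_map_eq[OF top_morphism_continuous[OF f]]) (simp add: A.topspace_topol eq)
  qed (simp_all add: eq top_morphism_closed[OF f] top_morphism_mult[OF f] top_morphism_scale[OF f]
      top_object_scale_closed[OF A])
qed

text \<open>
  Assuming that \<open>Z\<close> and \<open>Y\<close> are objects as well makes the locale predicate the only
  hypothesis about an extension in most of what follows.
\<close>

locale top_extension =
  fixes lin :: bool and Z :: "'z tvs" and Y :: "'y tvs" and E :: "('y, 'x, 'z) tvs_extension"
  assumes Z_object: "top_object lin Z" and Y_object: "top_object lin Y"
    and mid_object: "top_object lin (mid E)"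
    and incl_morphism: "top_morphism lin Y (mid E) (incl E)"
    and incl_open: "open_onto_image Y (mid E) (incl E)"
    and proj_morphism: "top_morphism lin (mid E) Z (proj E)"
    and proj_open: "open_onto_image (mid E) Z (proj E)"
    and exact: "short_exact Z Y E"
begin

sublocale Z: top_ab_group Z by (rule top_objectD[OF Z_object])
sublocale Y: top_ab_group Y by (rule top_objectD[OF Y_object])
sublocale X: top_ab_group "mid E" by (rule top_objectD[OF mid_object])
sublocale i: group_hom Y "mid E" "incl E"
  by (rule top_morphism_group_hom[OF Y_object mid_object incl_morphism])
sublocale p: group_hom "mid E" Z "proj E"
  by (rule top_morphism_group_hom[OF mid_object Z_object proj_morphism])

lemma incl_image: "incl E ` carrier Y = {x \<in> carrier (mid E). proj E x = \<one>\<^bsub>Z\<^esub>}"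
  using exact by (simp add: short_exact_def kernel_def)

lemma proj_incl [simp]: "y \<in> carrier Y \<Longrightarrow> proj E (incl E y) = \<one>\<^bsub>Z\<^esub>"
  using incl_image by blast

lemma incl_one_iff: "y \<in> carrier Y \<Longrightarrow> incl E y = \<one>\<^bsub>mid E\<^esub> \<longleftrightarrow> y = \<one>\<^bsub>Y\<^esub>"
  using exact i.inj_on_one_iff by (auto simp: short_exact_def)

lemma kernelE:
  assumes "x \<in> carrier (mid E)" "proj E x = \<one>\<^bsub>Z\<^esub>"
  obtains y where "y \<in> carrier Y" "x = incl E y"
  using assms incl_image by blast

lemma proj_surj: "proj E ` carrier (mid E) = carrier Z"
  using exact by (simp add: short_exact_def)

lemma fibreE:
  assumes "x \<in> carrier (mid E)" "x' \<in> carrier (mid E)" "proj E x = proj E x'"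
  obtains y where "y \<in> carrier Y" "x = x' \<otimes>\<^bsub>mid E\<^esub> incl E y"
proof -
  have "proj E (inv\<^bsub>mid E\<^esub> x' \<otimes>\<^bsub>mid E\<^esub> x) = \<one>\<^bsub>Z\<^esub>" using assms by simp
  then obtain y where y: "y \<in> carrier Y" "inv\<^bsub>mid E\<^esub> x' \<otimes>\<^bsub>mid E\<^esub> x = incl E y"
    using kernelE assms by (metis X.inv_closed X.m_closed)
  show thesis
    by (rule that[OF y(1)]) (use assms in \<open>simp add: y(2)[symmetric] X.m_assoc[symmetric]\<close>)
qed

lemma proj_open_map: "open_map (topol (mid E)) (topol Z) (proj E)"
  by (rule open_map_onto[OF Z.top_ab_group_axioms proj_open proj_surj])

lemma incl_nbhd:
  assumes "openin (topol Y) U" "\<one>\<^bsub>Y\<^esub> \<in> U"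
  obtains V where "openin (topol (mid E)) V" "\<one>\<^bsub>mid E\<^esub> \<in> V"
    "\<And>y. \<lbrakk>y \<in> carrier Y; incl E y \<in> V\<rbrakk> \<Longrightarrow> y \<in> U"
proof -
  obtain V where V: "openin (topol (mid E)) V" "incl E ` U = V \<inter> incl E ` carrier Y"
    using open_onto_imageD[OF incl_open assms(1)] by blast
  have inj: "inj_on (incl E) (carrier Y)" using exact by (simp add: short_exact_def)
  show thesis
  proof (rule that[OF V(1)])
    show "\<one>\<^bsub>mid E\<^esub> \<in> V" using V(2) assms(2) by (metis IntD1 image_eqI i.hom_one)
    fix y assume "y \<in> carrier Y" "incl E y \<in> V"
    then have "incl E y \<in> incl E ` U" using V(2) by blast
    then show "y \<in> U"
      using inj_on_image_mem_iff[OF inj \<open>y \<in> carrier Y\<close> Y.openin_subset_carrier[OF assms(1)]] by simp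
  qed
qed

end

text \<open>
  Openness of the two maps onto their images is expressed by neighbourhoods of the neutral element;
  for the inclusion, which is injective, it says that \<open>Y\<close> carries the topology induced from the middle
  object.
\<close>

lemma top_extensionI:
  assumes Z: "top_object lin Z" and Y: "top_object lin Y" and X: "top_object lin (mid E)"
    and i: "top_morphism lin Y (mid E) (incl E)" and p: "top_morphism lin (mid E) Z (proj E)"
    and pi: "\<And>y. y \<in> carrier Y \<Longrightarrow> proj E (incl E y) = \<one>\<^bsub>Z\<^esub>"
    and inj: "\<And>y. \<lbrakk>y \<in> carrier Y; incl E y = \<one>\<^bsub>mid E\<^esub>\<rbrakk> \<Longrightarrow> y = \<one>\<^bsub>Y\<^esub>"
    and ker: "\<And>x. \<lbrakk>x \<in> carrier (mid E); proj E x = \<one>\<^bsub>Z\<^esub>\<rbrakk> \<Longrightarrow> x \<in> incl E ` carrier Y"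
    and surj: "\<And>z. z \<in> carrier Z \<Longrightarrow> z \<in> proj E ` carrier (mid E)"
    and i_nbhd: "\<And>U. \<lbrakk>openin (topol Y) U; \<one>\<^bsub>Y\<^esub> \<in> U\<rbrakk> \<Longrightarrow>
        \<exists>V. openin (topol (mid E)) V \<and> \<one>\<^bsub>mid E\<^esub> \<in> V \<and> (\<forall>y\<in>carrier Y. incl E y \<in> V \<longrightarrow> y \<in> U)"
    and p_nbhd: "\<And>U. \<lbrakk>openin (topol (mid E)) U; \<one>\<^bsub>mid E\<^esub> \<in> U\<rbrakk> \<Longrightarrow>
        \<exists>V. openin (topol Z) V \<and> \<one>\<^bsub>Z\<^esub> \<in> V \<and> V \<subseteq> proj E ` U"
  shows "top_extension lin Z Y E"
proof
  interpret i: group_hom Y "mid E" "incl E" by (rule top_morphism_group_hom[OF Y X i])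
  interpret p: group_hom "mid E" Z "proj E" by (rule top_morphism_group_hom[OF X Z p])
  show "open_onto_image Y (mid E) (incl E)"
  proof (rule open_onto_imageI[OF top_objectD[OF Y] top_objectD[OF X] top_morphism_hom[OF i]])
    fix U assume "openin (topol Y) U" "\<one>\<^bsub>Y\<^esub> \<in> U"
    from i_nbhd[OF this] obtain V where V: "openin (topol (mid E)) V" "\<one>\<^bsub>mid E\<^esub> \<in> V"
      "\<forall>y\<in>carrier Y. incl E y \<in> V \<longrightarrow> y \<in> U" by blast
    then have "V \<inter> incl E ` carrier Y \<subseteq> incl E ` U" by blast
    with V(1,2) show "\<exists>V. openin (topol (mid E)) V \<and> \<one>\<^bsub>mid E\<^esub> \<in> V \<and> V \<inter> incl E ` carrier Y \<subseteq> incl E ` U"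
      by meson
  qed
  show "open_onto_image (mid E) Z (proj E)"
  proof (rule open_onto_imageI[OF top_objectD[OF X] top_objectD[OF Z] top_morphism_hom[OF p]])
    fix U assume "openin (topol (mid E)) U" "\<one>\<^bsub>mid E\<^esub> \<in> U"
    from p_nbhd[OF this] show "\<exists>V. openin (topol Z) V \<and> \<one>\<^bsub>Z\<^esub> \<in> V \<and> V \<inter> proj E ` carrier (mid E) \<subseteq> proj E ` U"
      by (meson le_infI1)
  qed
  show "short_exact Z Y E"
    unfolding short_exact_def kernel_def
  proof (intro conjI equalityI subsetI)
    show "inj_on (incl E) (carrier Y)" using inj by (subst i.inj_on_one_iff) blast
  next
    fix x assume "x \<in> incl E ` carrier Y"
    then show "x \<in> {x \<in> carrier (mid E). proj E x = \<one>\<^bsub>Z\<^esub>}" by (auto simp: pi)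
  next
    fix x assume "x \<in> {x \<in> carrier (mid E). proj E x = \<one>\<^bsub>Z\<^esub>}"
    then show "x \<in> incl E ` carrier Y" using ker by simp
  next
    fix z assume "z \<in> proj E ` carrier (mid E)"
    then show "z \<in> carrier Z" by auto
  qed (rule surj)
qed (rule Z Y X i p)+

text \<open>
  A morphism of extensions that is the identity on the quotient \<open>Z\<close> and \<open>a\<close> on the kernel; it exhibits
  \<open>E'\<close> as a push-out of \<open>E\<close> along \<open>a\<close>. For \<open>a\<close> the identity, this is equivalence of extensions.
\<close>

definition pushes :: "bool \<Rightarrow> 'w tvs \<Rightarrow> ('w \<Rightarrow> 'y) \<Rightarrow> ('w, 'x1, 'z) tvs_extension \<Rightarrow>
    ('y, 'x2, 'z) tvs_extension \<Rightarrow> bool" where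
  "pushes lin W a E E' \<longleftrightarrow>
     (\<exists>S. top_morphism lin (mid E) (mid E') S \<and>
          (\<forall>w\<in>carrier W. S (incl E w) = incl E' (a w)) \<and>
          (\<forall>x\<in>carrier (mid E). proj E' (S x) = proj E x))"

lemma pushesI:
  assumes "top_morphism lin (mid E) (mid E') S"
    and "\<And>w. w \<in> carrier W \<Longrightarrow> S (incl E w) = incl E' (a w)"
    and "\<And>x. x \<in> carrier (mid E) \<Longrightarrow> proj E' (S x) = proj E x"
  shows "pushes lin W a E E'"
  using assms by (auto simp: pushes_def)

lemma pushesE:
  assumes "pushes lin W a E E'"
  obtains S where "top_morphism lin (mid E) (mid E') S"
    "\<And>w. w \<in> carrier W \<Longrightarrow> S (incl E w) = incl E' (a w)"
    "\<And>x. x \<in> carrier (mid E) \<Longrightarrow> proj E' (S x) = proj E x"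
  using assms by (auto simp: pushes_def)

lemma pushes_id: "pushes lin W (\<lambda>w. w) E E"
  by (rule pushesI[OF top_morphism_id]) auto

lemma pushes_compose:
  assumes "pushes lin W a E E'" "pushes lin Y b E' E''"
    and a: "\<And>w. w \<in> carrier W \<Longrightarrow> a w \<in> carrier Y"
    and c: "\<And>w. w \<in> carrier W \<Longrightarrow> c w = b (a w)"
  shows "pushes lin W c E E''"
proof -
  obtain S where S: "top_morphism lin (mid E) (mid E') S"
    "\<And>w. w \<in> carrier W \<Longrightarrow> S (incl E w) = incl E' (a w)"
    "\<And>x. x \<in> carrier (mid E) \<Longrightarrow> proj E' (S x) = proj E x" by (rule pushesE[OF assms(1)]) (rule that)
  obtain T where T: "top_morphism lin (mid E') (mid E'') T"
    "\<And>w. w \<in> carrier Y \<Longrightarrow> T (incl E' w) = incl E'' (b w)"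
    "\<And>x. x \<in> carrier (mid E') \<Longrightarrow> proj E'' (T x) = proj E' x" by (rule pushesE[OF assms(2)]) (rule that)
  show ?thesis
    by (rule pushesI[OF top_morphism_compose[OF S(1) T(1)]])
      (simp_all add: S T a c top_morphism_closed[OF S(1)])
qed

text \<open>
  With \<open>S: X\<^sub>0 \<rightarrow> X\<^sub>1\<close> and \<open>T: X\<^sub>0 \<rightarrow> X\<^sub>2\<close> the given morphisms, the equivalence is
  \<open>S x + y \<mapsto> T x + y\<close>. It is well defined: if \<open>S x + y = 0\<close>, then \<open>x\<close> comes from some \<open>w\<close> in the kernel
  \<open>W\<close> of \<open>X\<^sub>0 \<rightarrow> Z\<close>, so \<open>a w + y = 0\<close> and \<open>T x + y = 0\<close>. It is continuous because
  \<open>(x, y) \<mapsto> S x + y\<close> is an open map onto \<open>X\<^sub>1\<close>: elements of \<open>X\<^sub>1\<close> near \<open>0\<close> lie over elements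
  of \<open>Z\<close> near \<open>0\<close>, these lift to elements \<open>x\<close> of \<open>X\<^sub>0\<close> near \<open>0\<close> as the projection of \<open>X\<^sub>0\<close> is open, and
  the difference to \<open>S x\<close> is small and in the image of \<open>Y\<close>, which has the induced topology.
\<close>

lemma pushes_unique:
  assumes E0: "top_extension lin Z W E0" and E1: "top_extension lin Z Y E1"
    and E2: "top_extension lin Z Y E2"
    and a: "\<And>w. w \<in> carrier W \<Longrightarrow> a w \<in> carrier Y"
    and push1: "pushes lin W a E0 E1" and push2: "pushes lin W a E0 E2"
  shows "pushes lin Y (\<lambda>y. y) E1 E2"
proof -
  interpret E0: top_extension lin Z W E0 by fact
  interpret E1: top_extension lin Z Y E1 by fact
  interpret E2: top_extension lin Z Y E2 by fact
  obtain S where S: "top_morphism lin (mid E0) (mid E1) S"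
    "\<And>w. w \<in> carrier W \<Longrightarrow> S (incl E0 w) = incl E1 (a w)"
    "\<And>x. x \<in> carrier (mid E0) \<Longrightarrow> proj E1 (S x) = proj E0 x" by (rule pushesE[OF push1]) (rule that)
  obtain T where T: "top_morphism lin (mid E0) (mid E2) T"
    "\<And>w. w \<in> carrier W \<Longrightarrow> T (incl E0 w) = incl E2 (a w)"
    "\<And>x. x \<in> carrier (mid E0) \<Longrightarrow> proj E2 (T x) = proj E0 x" by (rule pushesE[OF push2]) (rule that)
  interpret S: group_hom "mid E0" "mid E1" S
    by (rule top_morphism_group_hom[OF E0.mid_object E1.mid_object S(1)])
  interpret T: group_hom "mid E0" "mid E2" T
    by (rule top_morphism_group_hom[OF E0.mid_object E2.mid_object T(1)])
  let ?A = "tvs_prod (mid E0) Y"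
  define q where "q = (\<lambda>u. S (fst u) \<otimes>\<^bsub>mid E1\<^esub> incl E1 (snd u))"
  define f where "f = (\<lambda>u. T (fst u) \<otimes>\<^bsub>mid E2\<^esub> incl E2 (snd u))"
  have A: "top_object lin ?A" by (rule top_object_tvs_prod[OF E0.mid_object E1.Y_object])
  have q: "top_morphism lin ?A (mid E1) q" unfolding q_def
    by (intro top_morphism_mult_fun[OF E1.mid_object] top_morphism_compose[OF top_morphism_fst S(1)]
        top_morphism_compose[OF top_morphism_snd E1.incl_morphism])
  have f: "top_morphism lin ?A (mid E2) f" unfolding f_def
    by (intro top_morphism_mult_fun[OF E2.mid_object] top_morphism_compose[OF top_morphism_fst T(1)]
        top_morphism_compose[OF top_morphism_snd E2.incl_morphism])
  have surj: "q ` carrier ?A = carrier (mid E1)"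
  proof (intro equalityI subsetI)
    fix x assume x: "x \<in> carrier (mid E1)"
    then have "proj E1 x \<in> proj E0 ` carrier (mid E0)" using E0.proj_surj by simp
    then obtain v where v: "v \<in> carrier (mid E0)" "proj E1 x = proj E0 v" by blast
    obtain y where "y \<in> carrier Y" "x = S v \<otimes>\<^bsub>mid E1\<^esub> incl E1 y"
      by (rule E1.fibreE[OF x S.hom_closed[OF v(1)]]) (use v S(3) in simp, rule that)
    then show "x \<in> q ` carrier ?A"
      using v(1) by (intro image_eqI[of _ _ "(v, y)"]) (simp_all add: q_def)
  qed (use top_morphism_closed[OF q] in blast)
  have "open_onto_image ?A (mid E1) q"
  proof (rule open_onto_imageI[OF top_objectD[OF A] E1.X.top_ab_group_axioms top_morphism_hom[OF q]])
    fix U assume "openin (topol ?A) U" "\<one>\<^bsub>?A\<^esub> \<in> U"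
    then obtain U0 W0 where UW: "openin (topol (mid E0)) U0" "openin (topol Y) W0"
        "\<one>\<^bsub>mid E0\<^esub> \<in> U0" "\<one>\<^bsub>Y\<^esub> \<in> W0" "U0 \<times> W0 \<subseteq> U"
      unfolding tvs_prod_simps openin_prod_topology_alt by meson
    obtain N where N: "openin (topol (mid E1)) N" "\<one>\<^bsub>mid E1\<^esub> \<in> N"
        "\<And>y. \<lbrakk>y \<in> carrier Y; incl E1 y \<in> N\<rbrakk> \<Longrightarrow> y \<in> W0"
      by (rule E1.incl_nbhd[OF UW(2,4)]) (rule that)
    obtain V where V: "openin (topol (mid E1)) V" "\<one>\<^bsub>mid E1\<^esub> \<in> V"
        "\<And>x y. \<lbrakk>x \<in> V; y \<in> V\<rbrakk> \<Longrightarrow> x \<otimes>\<^bsub>mid E1\<^esub> inv\<^bsub>mid E1\<^esub> y \<in> N"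
      by (rule E1.X.nbhd_one_div[OF N(1,2)]) (rule that)
    \<comment> \<open>an element of \<open>V\<close> over \<open>proj E0 v\<close> with \<open>S v \<in> V\<close> differs from \<open>S v\<close> by
      an element of \<open>N\<close> in the image of \<open>Y\<close>\<close>
    let ?V0 = "{v \<in> topspace (topol (mid E0)). S v \<in> V} \<inter> U0"
    let ?V1 = "{x \<in> topspace (topol (mid E1)). proj E1 x \<in> proj E0 ` ?V0} \<inter> V"
    have "openin (topol (mid E0)) ?V0"
      by (intro openin_Int UW(1) openin_continuous_map_preimage[OF top_morphism_continuous[OF S(1)] V(1)])
    then have "openin (topol Z) (proj E0 ` ?V0)"
      using E0.proj_open_map by (simp only: open_map_def)
    then have "openin (topol (mid E1)) ?V1"
      by (intro openin_Int V(1)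
          openin_continuous_map_preimage[OF top_morphism_continuous[OF E1.proj_morphism]])
    moreover have "\<one>\<^bsub>mid E0\<^esub> \<in> ?V0" using V(2) UW(3) by (simp add: E0.X.topspace_topol)
    then have "proj E0 \<one>\<^bsub>mid E0\<^esub> \<in> proj E0 ` ?V0" by (rule imageI)
    then have "\<one>\<^bsub>mid E1\<^esub> \<in> ?V1" using V(2) by (simp add: E1.X.topspace_topol)
    moreover have "?V1 \<subseteq> q ` U"
    proof
      fix x assume "x \<in> ?V1"
      then have x: "x \<in> carrier (mid E1)" "x \<in> V" and "proj E1 x \<in> proj E0 ` ?V0"
        by (simp_all add: E1.X.topspace_topol)
      then obtain v where v: "v \<in> ?V0" "proj E1 x = proj E0 v" by blast
      from v(1) have v': "v \<in> carrier (mid E0)" "v \<in> U0" "S v \<in> V" by (simp_all add: E0.X.topspace_topol)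
      have "proj E1 x = proj E1 (S v)" using v(2) S(3)[OF v'(1)] by simp
      then obtain y where y: "y \<in> carrier Y" "x = S v \<otimes>\<^bsub>mid E1\<^esub> incl E1 y"
        by (rule E1.fibreE[OF x(1) S.hom_closed[OF v'(1)]])
      have "incl E1 y = x \<otimes>\<^bsub>mid E1\<^esub> inv\<^bsub>mid E1\<^esub> (S v)"
        using y v' E1.X.m_comm[of "S v" "incl E1 y"] by (simp add: E1.X.m_assoc)
      then have "y \<in> W0" using N(3)[OF y(1)] V(3)[OF x(2) v'(3)] by simp
      then have "(v, y) \<in> U" using UW(5) v' by blast
      then show "x \<in> q ` U" by (rule rev_image_eqI) (simp add: q_def y)
    qed
    ultimately show "\<exists>V. openin (topol (mid E1)) V \<and> \<one>\<^bsub>mid E1\<^esub> \<in> V \<and> V \<inter> q ` carrier ?A \<subseteq> q ` U"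
      by blast
  qed
  then have op: "open_map (topol ?A) (topol (mid E1)) q"
    by (rule open_map_onto[OF E1.X.top_ab_group_axioms _ surj])
  have ker: "f u = \<one>\<^bsub>mid E2\<^esub>" if u: "u \<in> carrier ?A" "q u = \<one>\<^bsub>mid E1\<^esub>" for u
  proof -
    obtain v y where vy: "u = (v, y)" "v \<in> carrier (mid E0)" "y \<in> carrier Y" using u(1) by auto
    have "proj E1 (q u) = proj E0 v" using vy by (simp add: q_def S(3))
    then have "proj E0 v = \<one>\<^bsub>Z\<^esub>" using u(2) by simp
    then obtain w where w: "w \<in> carrier W" "v = incl E0 w" using vy(2) E0.kernelE by blast
    have "incl E1 (a w \<otimes>\<^bsub>Y\<^esub> y) = \<one>\<^bsub>mid E1\<^esub>"
      using u(2) vy w by (simp add: q_def S(2) a)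
    then have "a w \<otimes>\<^bsub>Y\<^esub> y = \<one>\<^bsub>Y\<^esub>"
      by (rule E1.incl_one_iff[THEN iffD1, OF E1.Y.m_closed[OF a[OF w(1)] vy(3)]])
    then have "incl E2 (a w \<otimes>\<^bsub>Y\<^esub> y) = \<one>\<^bsub>mid E2\<^esub>" by simp
    then show ?thesis using vy w a[OF w(1)] by (simp add: f_def T(2))
  qed
  obtain R where R: "top_morphism lin (mid E1) (mid E2) R" "\<And>u. u \<in> carrier ?A \<Longrightarrow> R (q u) = f u"
    using top_morphism_factor[OF A E1.mid_object E2.mid_object q op surj f ker] by blast
  show ?thesis
  proof (rule pushesI[OF R(1)])
    fix y assume "y \<in> carrier Y"
    then show "R (incl E1 y) = incl E2 y"
      using R(2)[of "(\<one>\<^bsub>mid E0\<^esub>, y)"] by (simp add: q_def f_def)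
  next
    fix x assume "x \<in> carrier (mid E1)"
    then obtain v y where vy: "v \<in> carrier (mid E0)" "y \<in> carrier Y" "x = q (v, y)"
      unfolding surj[symmetric] by auto
    then show "proj E2 (R x) = proj E1 x"
      using R(2)[of "(v, y)"] by (simp add: q_def f_def S(3) T(3))
  qed
qed

section \<open>Products and pull-backs of extensions\<close>

lemma tvs_trivial_extension_simps [simp]:
  "mid (tvs_trivial_extension Z Y) = tvs_prod Y Z"
  "incl (tvs_trivial_extension Z Y) = (\<lambda>y. (y, \<one>\<^bsub>Z\<^esub>))"
  "proj (tvs_trivial_extension Z Y) = snd"
  by (simp_all add: tvs_trivial_extension_def)

lemma top_extension_trivial:
  assumes Z: "top_object lin Z" and Y: "top_object lin Y"
  shows "top_extension lin Z Y (tvs_trivial_extension Z Y)"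
proof (rule top_extensionI[OF Z Y])
  interpret Z: top_ab_group Z by (rule top_objectD[OF Z])
  interpret Y: top_ab_group Y by (rule top_objectD[OF Y])
  show "top_object lin (mid (tvs_trivial_extension Z Y))"
    by (simp add: top_object_tvs_prod[OF Y Z])
  show "top_morphism lin Y (mid (tvs_trivial_extension Z Y)) (incl (tvs_trivial_extension Z Y))"
    by (simp add: top_morphism_pair top_morphism_id top_morphism_const_one[OF Z])
  show "top_morphism lin (mid (tvs_trivial_extension Z Y)) Z (proj (tvs_trivial_extension Z Y))"
    by (simp add: top_morphism_snd)
  show "\<exists>V. openin (topol (mid (tvs_trivial_extension Z Y))) V \<and>
      \<one>\<^bsub>mid (tvs_trivial_extension Z Y)\<^esub> \<in> V \<and>
      (\<forall>y\<in>carrier Y. incl (tvs_trivial_extension Z Y) y \<in> V \<longrightarrow> y \<in> U)"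
    if "openin (topol Y) U" "\<one>\<^bsub>Y\<^esub> \<in> U" for U
    by (intro exI[of _ "U \<times> topspace (topol Z)"])
      (use that in \<open>simp_all add: openin_prod_Times_iff, simp add: Z.topspace_topol\<close>)
  show "\<exists>V. openin (topol Z) V \<and> \<one>\<^bsub>Z\<^esub> \<in> V \<and> V \<subseteq> proj (tvs_trivial_extension Z Y) ` U"
    if "openin (topol (mid (tvs_trivial_extension Z Y))) U"
      "\<one>\<^bsub>mid (tvs_trivial_extension Z Y)\<^esub> \<in> U" for U
    using that open_map_snd[of "topol Y" "topol Z"]
    by (intro exI[of _ "snd ` U"]) (force simp: open_map_def)
  show "z \<in> proj (tvs_trivial_extension Z Y) ` carrier (mid (tvs_trivial_extension Z Y))"
    if "z \<in> carrier Z" for z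
    using that by (intro image_eqI[of _ _ "(\<one>\<^bsub>Y\<^esub>, z)"]) simp_all
qed auto

lemma tvs_product_extension_simps [simp]:
  "mid (tvs_product_extension E1 E2) = tvs_prod (mid E1) (mid E2)"
  "incl (tvs_product_extension E1 E2) = map_prod (incl E1) (incl E2)"
  "proj (tvs_product_extension E1 E2) = map_prod (proj E1) (proj E2)"
  by (simp_all add: tvs_product_extension_def)

lemma top_morphism_map_prod:
  assumes "top_morphism lin A B f" "top_morphism lin C D g"
  shows "top_morphism lin (tvs_prod A C) (tvs_prod B D) (map_prod f g)"
  using top_morphism_pair[OF top_morphism_compose[OF top_morphism_fst assms(1)]
      top_morphism_compose[OF top_morphism_snd assms(2)]]
  by (simp add: map_prod_def case_prod_unfold)

lemma top_extension_product:
  assumes "top_extension lin Z1 Y1 E1" "top_extension lin Z2 Y2 E2"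
  shows "top_extension lin (tvs_prod Z1 Z2) (tvs_prod Y1 Y2) (tvs_product_extension E1 E2)"
    (is "top_extension lin ?Z ?Y ?E")
proof -
  interpret E1: top_extension lin Z1 Y1 E1 by fact
  interpret E2: top_extension lin Z2 Y2 E2 by fact
  show ?thesis
  proof (rule top_extensionI; (unfold tvs_product_extension_simps)?)
    show "top_object lin ?Z" "top_object lin ?Y" "top_object lin (tvs_prod (mid E1) (mid E2))"
      by (intro top_object_tvs_prod E1.Z_object E2.Z_object E1.Y_object E2.Y_object
          E1.mid_object E2.mid_object)+
    show "top_morphism lin ?Y (tvs_prod (mid E1) (mid E2)) (map_prod (incl E1) (incl E2))"
      by (rule top_morphism_map_prod[OF E1.incl_morphism E2.incl_morphism])
    show "top_morphism lin (tvs_prod (mid E1) (mid E2)) ?Z (map_prod (proj E1) (proj E2))"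
      by (rule top_morphism_map_prod[OF E1.proj_morphism E2.proj_morphism])
    show "map_prod (proj E1) (proj E2) (map_prod (incl E1) (incl E2) y) = \<one>\<^bsub>?Z\<^esub>"
      if "y \<in> carrier ?Y" for y
      using that by auto
    show "y = \<one>\<^bsub>?Y\<^esub>"
      if "y \<in> carrier ?Y" "map_prod (incl E1) (incl E2) y = \<one>\<^bsub>tvs_prod (mid E1) (mid E2)\<^esub>" for y
      using that by (auto simp: E1.incl_one_iff E2.incl_one_iff)
    show "x \<in> map_prod (incl E1) (incl E2) ` carrier ?Y"
      if x: "x \<in> carrier (tvs_prod (mid E1) (mid E2))"
        "map_prod (proj E1) (proj E2) x = \<one>\<^bsub>?Z\<^esub>" for x
    proof -
      obtain x1 x2 where x12: "x = (x1, x2)" by (cases x)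
      have "x1 \<in> incl E1 ` carrier Y1" "x2 \<in> incl E2 ` carrier Y2"
        using x unfolding E1.incl_image E2.incl_image x12 by simp_all
      then show ?thesis unfolding x12 by auto
    qed
    show "z \<in> map_prod (proj E1) (proj E2) ` carrier (tvs_prod (mid E1) (mid E2))"
      if z: "z \<in> carrier ?Z" for z
    proof -
      obtain z1 z2 where z12: "z = (z1, z2)" by (cases z)
      have "z1 \<in> proj E1 ` carrier (mid E1)" "z2 \<in> proj E2 ` carrier (mid E2)"
        using z unfolding E1.proj_surj E2.proj_surj z12 by simp_all
      then show ?thesis unfolding z12 by auto
    qed
    show "\<exists>V. openin (topol (tvs_prod (mid E1) (mid E2))) V \<and> \<one>\<^bsub>tvs_prod (mid E1) (mid E2)\<^esub> \<in> V \<and>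
        (\<forall>y\<in>carrier ?Y. map_prod (incl E1) (incl E2) y \<in> V \<longrightarrow> y \<in> U)"
      if U: "openin (topol ?Y) U" "\<one>\<^bsub>?Y\<^esub> \<in> U" for U
    proof -
      obtain U1 U2 where U12: "openin (topol Y1) U1" "openin (topol Y2) U2" "\<one>\<^bsub>Y1\<^esub> \<in> U1" "\<one>\<^bsub>Y2\<^esub> \<in> U2"
          "U1 \<times> U2 \<subseteq> U"
        using U unfolding tvs_prod_simps openin_prod_topology_alt by meson
      obtain V1 where V1: "openin (topol (mid E1)) V1" "\<one>\<^bsub>mid E1\<^esub> \<in> V1"
          "\<And>y. \<lbrakk>y \<in> carrier Y1; incl E1 y \<in> V1\<rbrakk> \<Longrightarrow> y \<in> U1"
        by (rule E1.incl_nbhd[OF U12(1,3)]) (rule that)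
      obtain V2 where V2: "openin (topol (mid E2)) V2" "\<one>\<^bsub>mid E2\<^esub> \<in> V2"
          "\<And>y. \<lbrakk>y \<in> carrier Y2; incl E2 y \<in> V2\<rbrakk> \<Longrightarrow> y \<in> U2"
        by (rule E2.incl_nbhd[OF U12(2,4)]) (rule that)
      show ?thesis
      proof (intro exI[of _ "V1 \<times> V2"] conjI ballI impI)
        show "openin (topol (tvs_prod (mid E1) (mid E2))) (V1 \<times> V2)"
          using V1(1) V2(1) by (simp add: openin_prod_Times_iff)
        show "\<one>\<^bsub>tvs_prod (mid E1) (mid E2)\<^esub> \<in> V1 \<times> V2" using V1(2) V2(2) by simp
        fix y assume y: "y \<in> carrier ?Y" "map_prod (incl E1) (incl E2) y \<in> V1 \<times> V2"
        obtain y1 y2 where y12: "y = (y1, y2)" by (cases y)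
        have "y1 \<in> U1" by (rule V1(3)) (use y y12 in simp_all)
        moreover have "y2 \<in> U2" by (rule V2(3)) (use y y12 in simp_all)
        ultimately show "y \<in> U" using U12(5) y12 by blast
      qed
    qed
    show "\<exists>V. openin (topol ?Z) V \<and> \<one>\<^bsub>?Z\<^esub> \<in> V \<and> V \<subseteq> map_prod (proj E1) (proj E2) ` U"
      if U: "openin (topol (tvs_prod (mid E1) (mid E2))) U" "\<one>\<^bsub>tvs_prod (mid E1) (mid E2)\<^esub> \<in> U" for U
    proof (intro exI conjI)
      show "openin (topol ?Z) (map_prod (proj E1) (proj E2) ` U)"
        using open_map_prod_map[OF E1.proj_open_map E2.proj_open_map] U
        by (simp add: open_map_def map_prod_def case_prod_unfold)
      show "\<one>\<^bsub>?Z\<^esub> \<in> map_prod (proj E1) (proj E2) ` U"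
        using U(2) by (intro image_eqI[of _ _ "(\<one>\<^bsub>mid E1\<^esub>, \<one>\<^bsub>mid E2\<^esub>)"]) simp_all
    qed simp
  qed
qed

lemma tvs_pullback_extension_simps [simp]:
  "mid (tvs_pullback_extension Z' t E) = tvs_subobject (tvs_prod (mid E) Z') (pullback_set Z' t E)"
  "incl (tvs_pullback_extension Z' t E) = (\<lambda>h. (incl E h, \<one>\<^bsub>Z'\<^esub>))"
  "proj (tvs_pullback_extension Z' t E) = snd"
  by (simp_all add: tvs_pullback_extension_def tvs_subobject_def Let_def)

lemma pullback_set_iff:
  "u \<in> pullback_set Z' t E \<longleftrightarrow> fst u \<in> carrier (mid E) \<and> snd u \<in> carrier Z' \<and> proj E (fst u) = t (snd u)"
  by (auto simp: pullback_set_def)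

lemma top_extension_pullback:
  assumes "top_extension lin Z Y E" and Z': "top_object lin Z'" and t: "top_morphism lin Z' Z t"
  shows "top_extension lin Z' Y (tvs_pullback_extension Z' t E)"
proof -
  interpret E: top_extension lin Z Y E by fact
  interpret Z': top_ab_group Z' by (rule top_objectD[OF Z'])
  interpret t: group_hom Z' Z t by (rule top_morphism_group_hom[OF Z' E.Z_object t])
  let ?P = "tvs_prod (mid E) Z'" and ?S = "pullback_set Z' t E"
  let ?M = "tvs_subobject ?P ?S"
  have P: "top_object lin ?P" by (rule top_object_tvs_prod[OF E.mid_object Z'])
  have eq: "?S = {u \<in> carrier ?P. \<forall>i\<in>(UNIV :: unit set). proj E (fst u) = t (snd u)}"
    by (auto simp: pullback_set_iff)
  have M: "top_object lin ?M"
    unfolding eq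
    by (rule top_object_equalizer[OF P E.Z_object top_morphism_compose[OF top_morphism_fst E.proj_morphism]
        top_morphism_compose[OF top_morphism_snd t]])
  show ?thesis
  proof (rule top_extensionI[OF Z' E.Y_object]; (unfold tvs_pullback_extension_simps)?)
    show "top_morphism lin Y ?M (\<lambda>y. (incl E y, \<one>\<^bsub>Z'\<^esub>))"
      by (rule top_morphism_into_subobject[OF top_morphism_pair[OF E.incl_morphism
            top_morphism_const_one[OF Z']] _ E.Y_object])
        (simp add: pullback_set_iff)
    show "top_morphism lin ?M Z' snd"
      by (rule top_morphism_from_subobject[OF top_morphism_snd]) (auto simp: pullback_set_iff)
    show "z \<in> snd ` carrier ?M" if z: "z \<in> carrier Z'" for z
    proof -
      have "t z \<in> proj E ` carrier (mid E)" using z by (simp add: E.proj_surj)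
      then obtain x where "x \<in> carrier (mid E)" "t z = proj E x" by blast
      then show ?thesis using z by (intro image_eqI[of _ _ "(x, z)"]) (simp_all add: pullback_set_iff)
    qed
    show "u \<in> (\<lambda>y. (incl E y, \<one>\<^bsub>Z'\<^esub>)) ` carrier Y" if u: "u \<in> carrier ?M" "snd u = \<one>\<^bsub>Z'\<^esub>" for u
    proof -
      have "fst u \<in> incl E ` carrier Y" using u by (simp add: pullback_set_iff E.incl_image)
      then show ?thesis using u(2) by (cases u) auto
    qed
    show "\<exists>V. openin (topol ?M) V \<and> \<one>\<^bsub>?M\<^esub> \<in> V \<and> (\<forall>y\<in>carrier Y. (incl E y, \<one>\<^bsub>Z'\<^esub>) \<in> V \<longrightarrow> y \<in> U)"
      if U: "openin (topol Y) U" "\<one>\<^bsub>Y\<^esub> \<in> U" for U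
    proof -
      obtain V where V: "openin (topol (mid E)) V" "\<one>\<^bsub>mid E\<^esub> \<in> V"
          "\<And>y. \<lbrakk>y \<in> carrier Y; incl E y \<in> V\<rbrakk> \<Longrightarrow> y \<in> U"
        by (rule E.incl_nbhd[OF U]) (rule that)
      have "openin (topol ?P) (V \<times> topspace (topol Z'))"
        using V(1) by (simp add: openin_prod_Times_iff)
      then have "openin (topol ?M) ((V \<times> topspace (topol Z')) \<inter> ?S)"
        by (simp add: openin_subtopology_Int)
      moreover have "\<one>\<^bsub>?M\<^esub> \<in> (V \<times> topspace (topol Z')) \<inter> ?S"
        using V(2) by (simp add: pullback_set_iff Z'.topspace_topol)
      moreover have "\<forall>y\<in>carrier Y. (incl E y, \<one>\<^bsub>Z'\<^esub>) \<in> (V \<times> topspace (topol Z')) \<inter> ?S \<longrightarrow> y \<in> U"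
        using V(3) by simp
      ultimately show ?thesis by meson
    qed
    show "\<exists>V. openin (topol Z') V \<and> \<one>\<^bsub>Z'\<^esub> \<in> V \<and> V \<subseteq> snd ` U"
      if U: "openin (topol ?M) U" "\<one>\<^bsub>?M\<^esub> \<in> U" for U
    proof -
      obtain W where W: "openin (topol ?P) W" "U = W \<inter> ?S"
        using U(1) by (auto simp: openin_subtopology)
      then have "(\<one>\<^bsub>mid E\<^esub>, \<one>\<^bsub>Z'\<^esub>) \<in> W" using U(2) by simp
      then obtain A B where AB: "openin (topol (mid E)) A" "openin (topol Z') B"
          "\<one>\<^bsub>mid E\<^esub> \<in> A" "\<one>\<^bsub>Z'\<^esub> \<in> B" "A \<times> B \<subseteq> W"
        using W(1) unfolding tvs_prod_simps openin_prod_topology_alt by meson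
      let ?V = "{z \<in> topspace (topol Z'). t z \<in> proj E ` A} \<inter> B"
      have "openin (topol Z) (proj E ` A)"
        using E.proj_open_map AB(1) by (simp only: open_map_def)
      then have "openin (topol Z') ?V"
        by (intro openin_Int AB(2) openin_continuous_map_preimage[OF top_morphism_continuous[OF t]])
      moreover have "proj E \<one>\<^bsub>mid E\<^esub> \<in> proj E ` A" using AB(3) by (rule imageI)
      then have "\<one>\<^bsub>Z'\<^esub> \<in> ?V" using AB(4) by (simp add: Z'.topspace_topol)
      moreover have "?V \<subseteq> snd ` U"
      proof
        fix z assume z: "z \<in> ?V"
        then obtain x where x: "x \<in> A" "t z = proj E x" by blast
        then have "x \<in> carrier (mid E)" using E.X.openin_subset_carrier[OF AB(1)] by blast
        moreover have "(x, z) \<in> W" using x(1) z AB(5) by blast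
        ultimately have "(x, z) \<in> U"
          using x z by (simp add: W(2) pullback_set_iff Z'.topspace_topol)
        then show "z \<in> snd ` U" by (rule rev_image_eqI) simp
      qed
      ultimately show ?thesis by meson
    qed
    show "top_object lin ?M" by (rule M)
  qed (simp_all add: E.incl_one_iff)
qed

section \<open>Push-outs of extensions\<close>

lemma tvs_pushout_extension_simps:
  "mid (tvs_pushout_extension Y Y' a E) = tvs_quotient (tvs_prod Y' (mid E)) (pushout_subgroup Y a E)"
  "incl (tvs_pushout_extension Y Y' a E) =
     (\<lambda>y'. pushout_subgroup Y a E #>\<^bsub>tvs_prod Y' (mid E)\<^esub> (y', \<one>\<^bsub>mid E\<^esub>))"
  "proj (tvs_pushout_extension Y Y' a E) = (\<lambda>C. the_elem ((\<lambda>(y', x). proj E x) ` C))"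
  by (simp_all add: tvs_pushout_extension_def Let_def)

context top_extension
begin

text \<open>
  The inclusion is a homeomorphism onto its image.
\<close>

lemma incl_inverse:
  obtains g where "continuous_map (subtopology (topol (mid E)) (incl E ` carrier Y)) (topol Y) g"
    "\<And>y. y \<in> carrier Y \<Longrightarrow> g (incl E y) = y"
proof -
  let ?T = "subtopology (topol (mid E)) (incl E ` carrier Y)"
  have "incl E ` carrier Y \<subseteq> carrier (mid E)" by auto
  then have ts: "topspace ?T = incl E ` carrier Y" by (simp add: X.topspace_topol Int_absorb1)
  have "homeomorphic_map (topol Y) ?T (incl E)"
  proof (rule bijective_open_imp_homeomorphic_map)
    show "continuous_map (topol Y) ?T (incl E)"
      using top_morphism_continuous[OF incl_morphism] ts
      by (simp add: continuous_map_in_subtopology Y.topspace_topol)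
    show "open_map (topol Y) ?T (incl E)" using incl_open by (simp add: open_onto_image_def)
    show "incl E ` topspace (topol Y) = topspace ?T" using ts by (simp add: Y.topspace_topol)
    show "inj_on (incl E) (topspace (topol Y))"
      using exact by (simp add: Y.topspace_topol short_exact_def)
  qed
  then obtain g where "homeomorphic_maps (topol Y) ?T (incl E) g"
    unfolding homeomorphic_map_maps by blast
  then show thesis
    by (intro that[of g]) (simp_all add: homeomorphic_maps_def Y.topspace_topol)
qed

lemma closedin_incl_image: "closedin (topol (mid E)) (incl E ` carrier Y)"
proof -
  have "closedin (topol Z) {\<one>\<^bsub>Z\<^esub>}"
    by (simp add: closedin_Hausdorff_sing_eq[OF Z.Hausdorff] Z.topspace_topol)
  from closedin_continuous_map_preimage[OF top_morphism_continuous[OF proj_morphism] this]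
  show ?thesis unfolding incl_image by (simp add: X.topspace_topol)
qed

context
  fixes Y' :: "'v tvs" and a :: "'y \<Rightarrow> 'v"
  assumes Y': "top_object lin Y'" and a: "top_morphism lin Y Y' a"
begin

private abbreviation "P \<equiv> tvs_prod Y' (mid E)"
private abbreviation "N \<equiv> pushout_subgroup Y a E"

interpretation Y': top_ab_group Y' by (rule top_objectD[OF Y'])
interpretation a: group_hom Y Y' a by (rule top_morphism_group_hom[OF Y_object Y' a])

private lemma P: "top_object lin P"
  by (rule top_object_tvs_prod[OF Y' mid_object])

interpretation P: top_ab_group P by (rule top_objectD[OF P])

private lemma graph: "top_morphism lin Y P (\<lambda>y. (a y, inv\<^bsub>mid E\<^esub> (incl E y)))"
  by (rule top_morphism_pair[OF a top_morphism_inv_fun[OF mid_object incl_morphism]])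

private lemma N_subgroup: "subgroup N P"
  unfolding pushout_subgroup_def
  by (rule group_hom.img_is_subgroup[OF top_morphism_group_hom[OF Y_object P graph]])

private lemma N_scale: "\<lbrakk>lin; u \<in> N\<rbrakk> \<Longrightarrow> scale P r u \<in> N"
  unfolding pushout_subgroup_def
proof (elim imageE)
  fix y assume *: lin "y \<in> carrier Y" "u = (a y, inv\<^bsub>mid E\<^esub> incl E y)"
  show "scale P r u \<in> (\<lambda>y. (a y, inv\<^bsub>mid E\<^esub> incl E y)) ` carrier Y"
    unfolding *(3) top_morphism_scale[OF graph *(1,2), symmetric]
    by (rule imageI) (rule top_object_scale_closed[OF Y_object *(1,2)])
qed

private lemma N_iff:
  assumes "y' \<in> carrier Y'" "y \<in> carrier Y"
  shows "(y', incl E y) \<in> N \<longleftrightarrow> y' \<otimes>\<^bsub>Y'\<^esub> a y = \<one>\<^bsub>Y'\<^esub>"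
proof
  assume "(y', incl E y) \<in> N"
  then obtain k where k: "k \<in> carrier Y" "y' = a k" "incl E y = inv\<^bsub>mid E\<^esub> incl E k"
    unfolding pushout_subgroup_def by blast
  then have "incl E (k \<otimes>\<^bsub>Y\<^esub> y) = \<one>\<^bsub>mid E\<^esub>" using assms by simp
  then have "k \<otimes>\<^bsub>Y\<^esub> y = \<one>\<^bsub>Y\<^esub>" by (rule incl_one_iff[THEN iffD1, OF Y.m_closed[OF k(1) assms(2)]])
  then have "a (k \<otimes>\<^bsub>Y\<^esub> y) = \<one>\<^bsub>Y'\<^esub>" by simp
  then show "y' \<otimes>\<^bsub>Y'\<^esub> a y = \<one>\<^bsub>Y'\<^esub>" using k assms by simp
next
  assume "y' \<otimes>\<^bsub>Y'\<^esub> a y = \<one>\<^bsub>Y'\<^esub>"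
  then have "y' = a (inv\<^bsub>Y\<^esub> y)" using assms Y'.inv_equality[of y' "a y"] by simp
  then show "(y', incl E y) \<in> N"
    unfolding pushout_subgroup_def using assms by (intro image_eqI[of _ _ "inv\<^bsub>Y\<^esub> y"]) simp_all
qed

text \<open>
  All of \<open>N\<close> lies in the closed set of pairs \<open>(y', x)\<close> with \<open>x\<close> in the image of \<open>Y\<close>, and there it is the
  zero set of the continuous map \<open>(y', y) \<mapsto> y' + a y\<close>. Hence the quotient will be Hausdorff.
\<close>

private lemma N_closed: "closedin (topol P) N"
proof -
  let ?C = "carrier Y' \<times> incl E ` carrier Y"
  obtain g where g: "continuous_map (subtopology (topol (mid E)) (incl E ` carrier Y)) (topol Y) g"
    "\<And>y. y \<in> carrier Y \<Longrightarrow> g (incl E y) = y" by (rule incl_inverse) (rule that)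
  have C: "closedin (topol P) ?C"
    using closedin_incl_image closedin_topspace[of "topol Y'"]
    by (simp add: closedin_prod_Times_iff Y'.topspace_topol)
  let ?T = "subtopology (topol P) ?C"
  have "continuous_map ?T (topol Y') (\<lambda>u. fst u \<otimes>\<^bsub>Y'\<^esub> a (g (snd u)))"
  proof (rule Y'.continuous_map_mult)
    show "continuous_map ?T (topol Y') fst"
      by (simp add: continuous_map_from_subtopology continuous_map_fst)
    have "continuous_map ?T (subtopology (topol (mid E)) (incl E ` carrier Y)) snd"
      by (auto simp: continuous_map_in_subtopology continuous_map_from_subtopology continuous_map_snd)
    from continuous_map_compose[OF continuous_map_compose[OF this g(1)] top_morphism_continuous[OF a]]
    show "continuous_map ?T (topol Y') (\<lambda>u. a (g (snd u)))" by (simp add: o_def)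
  qed
  moreover have "closedin (topol Y') {\<one>\<^bsub>Y'\<^esub>}"
    by (simp add: closedin_Hausdorff_sing_eq[OF Y'.Hausdorff] Y'.topspace_topol)
  ultimately have "closedin ?T {u \<in> topspace ?T. fst u \<otimes>\<^bsub>Y'\<^esub> a (g (snd u)) \<in> {\<one>\<^bsub>Y'\<^esub>}}"
    by (rule closedin_continuous_map_preimage)
  moreover have "{u \<in> topspace ?T. fst u \<otimes>\<^bsub>Y'\<^esub> a (g (snd u)) \<in> {\<one>\<^bsub>Y'\<^esub>}} = N"
  proof (intro equalityI subsetI)
    fix u assume "u \<in> {u \<in> topspace ?T. fst u \<otimes>\<^bsub>Y'\<^esub> a (g (snd u)) \<in> {\<one>\<^bsub>Y'\<^esub>}}"
    then have "u \<in> ?C" and u: "fst u \<otimes>\<^bsub>Y'\<^esub> a (g (snd u)) = \<one>\<^bsub>Y'\<^esub>" by simp_all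
    then obtain y' y where y: "u = (y', incl E y)" "y' \<in> carrier Y'" "y \<in> carrier Y" by blast
    then show "u \<in> N" using u g(2)[OF y(3)] N_iff[OF y(2,3)] by simp
  next
    fix u assume u: "u \<in> N"
    then obtain k where k: "k \<in> carrier Y" "u = (a k, inv\<^bsub>mid E\<^esub> (incl E k))"
      unfolding pushout_subgroup_def by blast
    then have u': "u = (a k, incl E (inv\<^bsub>Y\<^esub> k))" by simp
    then show "u \<in> {u \<in> topspace ?T. fst u \<otimes>\<^bsub>Y'\<^esub> a (g (snd u)) \<in> {\<one>\<^bsub>Y'\<^esub>}}"
      using k(1) by (simp add: g(2) Y'.topspace_topol X.topspace_topol del: i.hom_inv)
  qed
  ultimately show ?thesis
    using closedin_trans_full[OF _ C] by simp
qed

private abbreviation "Q \<equiv> tvs_quotient P N"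
private abbreviation "q \<equiv> (\<lambda>u. N #>\<^bsub>P\<^esub> u)"

private lemma Q: "top_object lin Q"
  by (rule top_object_tvs_quotient[OF P N_subgroup N_scale N_closed])

private lemma q: "top_morphism lin P Q q"
  by (rule top_morphism_tvs_quotient[OF P N_subgroup N_scale])

private lemma q_eq_one_iff: "u \<in> carrier P \<Longrightarrow> q u = \<one>\<^bsub>Q\<^esub> \<longleftrightarrow> u \<in> N"
  by (rule tvs_quotient_eq_one_iff[OF P N_subgroup N_scale])

private lemma q_surj: "q ` carrier P = carrier Q"
  by (rule tvs_quotient_surj[OF P N_subgroup N_scale])

private lemma q_open: "open_map (topol P) (topol Q) q"
  by (rule open_map_tvs_quotient[OF P N_subgroup N_scale])

private lemma q_shift:
  assumes "y' \<in> carrier Y'" "x \<in> carrier (mid E)" "y \<in> carrier Y"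
  shows "q (y', incl E y \<otimes>\<^bsub>mid E\<^esub> x) = q (a y \<otimes>\<^bsub>Y'\<^esub> y', x)"
proof -
  have "(a y, inv\<^bsub>mid E\<^esub> (incl E y)) \<in> N"
    unfolding pushout_subgroup_def using assms(3) by (rule imageI)
  moreover have "(a y \<otimes>\<^bsub>Y'\<^esub> y', x) = (a y, inv\<^bsub>mid E\<^esub> (incl E y)) \<otimes>\<^bsub>P\<^esub> (y', incl E y \<otimes>\<^bsub>mid E\<^esub> x)"
    using assms by (simp add: X.m_assoc[symmetric])
  ultimately have "(a y \<otimes>\<^bsub>Y'\<^esub> y', x) \<in> q (y', incl E y \<otimes>\<^bsub>mid E\<^esub> x)"
    unfolding r_coset_def by blast
  then show ?thesis
    by (rule P.repr_independence[OF _ _ N_subgroup]) (use assms in simp)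
qed

private lemma proj_coset:
  assumes "u \<in> carrier P"
  shows "proj (tvs_pushout_extension Y Y' a E) (q u) = proj E (snd u)"
proof -
  have "proj E (snd v) = proj E (snd u)" if v: "v \<in> q u" for v
  proof -
    obtain y where "y \<in> carrier Y" "v = (a y, inv\<^bsub>mid E\<^esub> (incl E y)) \<otimes>\<^bsub>P\<^esub> u"
      using v unfolding r_coset_def pushout_subgroup_def by blast
    moreover have "snd u \<in> carrier (mid E)" using assms by (simp add: mem_Times_iff)
    ultimately show ?thesis by simp
  qed
  then have "(\<lambda>v. proj E (snd v)) ` q u = (\<lambda>v. proj E (snd u)) ` q u"
    by (intro image_cong refl)
  also have "\<dots> = {proj E (snd u)}"
    by (rule image_constant[OF P.rcos_self[OF assms N_subgroup]])
  finally have "(\<lambda>(y', x). proj E x) ` q u = {proj E (snd u)}"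
    by (simp only: case_prod_unfold)
  then show ?thesis by (simp add: tvs_pushout_extension_simps)
qed

text \<open>
  The delicate point is that \<open>Y'\<close> carries the topology induced from the quotient \<open>Q\<close>. If \<open>(y', 0)\<close> has the
  class of a small pair \<open>(w, v)\<close>, then \<open>v\<close> lies over \<open>0\<close>, hence comes from some \<open>y \<in> Y\<close>, which is small
  because \<open>Y\<close> carries the induced topology, and \<open>y' = a y + w\<close> is small as well.
\<close>

lemma top_extension_pushout: "top_extension lin Z Y' (tvs_pushout_extension Y Y' a E)"
proof (rule top_extensionI[OF Z_object Y']; (unfold tvs_pushout_extension_simps(1,2))?)
  let ?pr = "proj (tvs_pushout_extension Y Y' a E)"
  show "top_object lin Q" by (rule Q)
  show "top_morphism lin Y' Q (\<lambda>y'. q (y', \<one>\<^bsub>mid E\<^esub>))"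
    by (rule top_morphism_compose[OF top_morphism_pair[OF top_morphism_id
          top_morphism_const_one[OF mid_object]] q])
  show "top_morphism lin Q Z ?pr"
  proof -
    have pr: "top_morphism lin P Z (\<lambda>u. proj E (snd u))"
      by (rule top_morphism_compose[OF top_morphism_snd proj_morphism])
    have ker: "proj E (snd u) = \<one>\<^bsub>Z\<^esub>" if "u \<in> carrier P" "q u = \<one>\<^bsub>Q\<^esub>" for u
    proof -
      have "u \<in> N" using that q_eq_one_iff by simp
      then obtain y where "y \<in> carrier Y" "u = (a y, inv\<^bsub>mid E\<^esub> (incl E y))"
        unfolding pushout_subgroup_def by blast
      then show ?thesis by simp
    qed
    obtain T where T: "top_morphism lin Q Z T" "\<And>u. u \<in> carrier P \<Longrightarrow> T (q u) = proj E (snd u)"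
      by (rule top_morphism_factor[OF P Q Z_object q q_open q_surj pr ker]) (simp, simp, rule that)
    show ?thesis
    proof (rule top_morphism_cong[OF Q T(1)])
      fix C assume "C \<in> carrier Q"
      then obtain u where "u \<in> carrier P" "C = q u" unfolding q_surj[symmetric] by blast
      then show "?pr C = T C" by (simp only: T(2) proj_coset)
    qed
  qed
  show "?pr (q (y', \<one>\<^bsub>mid E\<^esub>)) = \<one>\<^bsub>Z\<^esub>" if "y' \<in> carrier Y'" for y'
    using that by (simp add: proj_coset)
  show "y' = \<one>\<^bsub>Y'\<^esub>" if "y' \<in> carrier Y'" "q (y', \<one>\<^bsub>mid E\<^esub>) = \<one>\<^bsub>Q\<^esub>" for y'
    using that q_eq_one_iff[of "(y', \<one>\<^bsub>mid E\<^esub>)"] N_iff[of y' "\<one>\<^bsub>Y\<^esub>"] by simp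
  show "C \<in> (\<lambda>y'. q (y', \<one>\<^bsub>mid E\<^esub>)) ` carrier Y'" if C: "C \<in> carrier Q" "?pr C = \<one>\<^bsub>Z\<^esub>" for C
  proof -
    obtain y' x where u: "y' \<in> carrier Y'" "x \<in> carrier (mid E)" "C = q (y', x)"
    proof -
      obtain u where "u \<in> carrier P" "C = q u" using C(1) unfolding q_surj[symmetric] by blast
      then show thesis by (intro that[of "fst u" "snd u"]) (simp_all add: mem_Times_iff)
    qed
    then have "proj E x = \<one>\<^bsub>Z\<^esub>" using C(2) by (simp add: proj_coset)
    then obtain y where y: "y \<in> carrier Y" "x = incl E y" by (rule kernelE[OF u(2)])
    then have "C = q (a y \<otimes>\<^bsub>Y'\<^esub> y', \<one>\<^bsub>mid E\<^esub>)" using q_shift[OF u(1) X.one_closed y(1)] u by simp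
    moreover have "a y \<otimes>\<^bsub>Y'\<^esub> y' \<in> carrier Y'" using u(1) y(1) by simp
    ultimately show ?thesis by blast
  qed
  show "z \<in> ?pr ` carrier Q" if z: "z \<in> carrier Z" for z
  proof -
    obtain x where x: "x \<in> carrier (mid E)" "z = proj E x" using z unfolding proj_surj[symmetric] by blast
    have "q (\<one>\<^bsub>Y'\<^esub>, x) \<in> carrier Q" unfolding q_surj[symmetric] by (rule imageI) (simp add: x)
    then show ?thesis by (rule rev_image_eqI) (simp add: proj_coset x)
  qed
  show "\<exists>V. openin (topol Q) V \<and> \<one>\<^bsub>Q\<^esub> \<in> V \<and> (\<forall>y'\<in>carrier Y'. q (y', \<one>\<^bsub>mid E\<^esub>) \<in> V \<longrightarrow> y' \<in> U)"
    if U: "openin (topol Y') U" "\<one>\<^bsub>Y'\<^esub> \<in> U" for U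
  proof -
    \<comment> \<open>a sum of two elements of \<open>W\<close> lies in \<open>U\<close>; one of the two will be \<open>w\<close>, the other \<open>a y\<close>\<close>
    obtain W where W: "openin (topol Y') W" "\<one>\<^bsub>Y'\<^esub> \<in> W" "\<And>x y. \<lbrakk>x \<in> W; y \<in> W\<rbrakk> \<Longrightarrow> x \<otimes>\<^bsub>Y'\<^esub> y \<in> U"
      by (rule Y'.nbhd_one_mult[OF U]) (rule that)
    have aW: "openin (topol Y) {y \<in> topspace (topol Y). a y \<in> W}"
      by (rule openin_continuous_map_preimage[OF top_morphism_continuous[OF a] W(1)])
    have one: "\<one>\<^bsub>Y\<^esub> \<in> {y \<in> topspace (topol Y). a y \<in> W}" using W(2) by (simp add: Y.topspace_topol)
    obtain V where V: "openin (topol (mid E)) V" "\<one>\<^bsub>mid E\<^esub> \<in> V"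
        "\<And>y. \<lbrakk>y \<in> carrier Y; incl E y \<in> V\<rbrakk> \<Longrightarrow> y \<in> {y \<in> topspace (topol Y). a y \<in> W}"
      by (rule incl_nbhd[OF aW one]) (rule that)
    show ?thesis
    proof (intro exI conjI ballI impI)
      have "openin (topol P) (W \<times> V)" using W(1) V(1) by (simp add: openin_prod_Times_iff)
      then show "openin (topol Q) (q ` (W \<times> V))" using q_open by (simp only: open_map_def)
      have "(\<one>\<^bsub>Y'\<^esub>, \<one>\<^bsub>mid E\<^esub>) \<in> W \<times> V" using W(2) V(2) by simp
      moreover have "\<one>\<^bsub>Q\<^esub> = q (\<one>\<^bsub>Y'\<^esub>, \<one>\<^bsub>mid E\<^esub>)" using top_morphism_one[OF P Q q] by simp
      ultimately show "\<one>\<^bsub>Q\<^esub> \<in> q ` (W \<times> V)" by (rule rev_image_eqI)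
      fix y' assume y': "y' \<in> carrier Y'" "q (y', \<one>\<^bsub>mid E\<^esub>) \<in> q ` (W \<times> V)"
      then obtain w v where wv: "w \<in> W" "v \<in> V" "q (y', \<one>\<^bsub>mid E\<^esub>) = q (w, v)" by blast
      have c: "w \<in> carrier Y'" "v \<in> carrier (mid E)"
        using wv Y'.openin_subset_carrier[OF W(1)] X.openin_subset_carrier[OF V(1)] by blast+
      have "proj E v = \<one>\<^bsub>Z\<^esub>"
        using arg_cong[OF wv(3), of ?pr] y'(1) c by (simp add: proj_coset)
      then obtain y where y: "y \<in> carrier Y" "v = incl E y" by (rule kernelE[OF c(2)])
      interpret Q: top_ab_group Q by (rule top_objectD[OF Q])
      let ?w = "a y \<otimes>\<^bsub>Y'\<^esub> w"
      have wc: "?w \<in> carrier Y'" using y c by simp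
      have "q (y', \<one>\<^bsub>mid E\<^esub>) = q (?w, \<one>\<^bsub>mid E\<^esub>)"
        using wv(3) q_shift[OF c(1) X.one_closed y(1)] y by simp
      moreover have "q ((y', \<one>\<^bsub>mid E\<^esub>) \<otimes>\<^bsub>P\<^esub> inv\<^bsub>P\<^esub> (?w, \<one>\<^bsub>mid E\<^esub>)) = q (y', \<one>\<^bsub>mid E\<^esub>) \<otimes>\<^bsub>Q\<^esub> inv\<^bsub>Q\<^esub> q (?w, \<one>\<^bsub>mid E\<^esub>)"
      proof -
        interpret q: group_hom P Q q by (rule top_morphism_group_hom[OF P Q q])
        have "(y', \<one>\<^bsub>mid E\<^esub>) \<in> carrier P" "(?w, \<one>\<^bsub>mid E\<^esub>) \<in> carrier P" using y' wc by simp_all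
        then show ?thesis by (simp only: q.hom_mult q.hom_inv P.inv_closed)
      qed
      moreover have "q (?w, \<one>\<^bsub>mid E\<^esub>) \<in> carrier Q"
        by (rule top_morphism_closed[OF q]) (use wc in simp)
      moreover have inv: "inv\<^bsub>P\<^esub> (?w, \<one>\<^bsub>mid E\<^esub>) = (inv\<^bsub>Y'\<^esub> ?w, \<one>\<^bsub>mid E\<^esub>)"
        by (rule P.inv_equality) (use wc in simp_all)
      ultimately have "q (y' \<otimes>\<^bsub>Y'\<^esub> inv\<^bsub>Y'\<^esub> ?w, \<one>\<^bsub>mid E\<^esub>) = \<one>\<^bsub>Q\<^esub>"
        by (simp only: inv tvs_prod_simps fst_conv snd_conv X.r_one X.one_closed Q.r_inv)
      then have "(y' \<otimes>\<^bsub>Y'\<^esub> inv\<^bsub>Y'\<^esub> ?w, \<one>\<^bsub>mid E\<^esub>) \<in> N"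
        using q_eq_one_iff y' wc by simp
      then have "y' \<otimes>\<^bsub>Y'\<^esub> inv\<^bsub>Y'\<^esub> ?w = \<one>\<^bsub>Y'\<^esub>"
        using N_iff[of "y' \<otimes>\<^bsub>Y'\<^esub> inv\<^bsub>Y'\<^esub> ?w" "\<one>\<^bsub>Y\<^esub>"] y'(1) wc by simp
      then have "y' = ?w" using Y'.inv_solve_right'[of "\<one>\<^bsub>Y'\<^esub>" y' ?w] y'(1) wc by simp
      moreover have "a y \<in> W" using V(3)[OF y(1)] wv(2) y(2) by simp
      ultimately show "y' \<in> U" using W(3) wv(1) by simp
    qed
  qed
  show "\<exists>V. openin (topol Z) V \<and> \<one>\<^bsub>Z\<^esub> \<in> V \<and> V \<subseteq> ?pr ` U" if U: "openin (topol Q) U" "\<one>\<^bsub>Q\<^esub> \<in> U" for U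
  proof (intro exI conjI)
    let ?W = "{u \<in> topspace (topol P). q u \<in> U}"
    have W: "openin (topol P) ?W"
      by (rule openin_continuous_map_preimage[OF top_morphism_continuous[OF q] U(1)])
    have "openin (topol (mid E)) (snd ` ?W)"
      using open_map_snd[of "topol Y'" "topol (mid E)"] W by (simp only: open_map_def tvs_prod_simps)
    then show "openin (topol Z) (proj E ` snd ` ?W)" using proj_open_map by (simp only: open_map_def)
    have "q \<one>\<^bsub>P\<^esub> = \<one>\<^bsub>Q\<^esub>" by (rule top_morphism_one[OF P Q q])
    then have "\<one>\<^bsub>P\<^esub> \<in> ?W" using U(2) P.one_closed unfolding P.topspace_topol by (metis (mono_tags, lifting) mem_Collect_eq)
    then have "proj E (snd \<one>\<^bsub>P\<^esub>) \<in> proj E ` snd ` ?W" by (intro imageI)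
    then show "\<one>\<^bsub>Z\<^esub> \<in> proj E ` snd ` ?W" by simp
    show "proj E ` snd ` ?W \<subseteq> ?pr ` U"
    proof
      fix z assume "z \<in> proj E ` snd ` ?W"
      then obtain u where "u \<in> carrier P" "q u \<in> U" "z = proj E (snd u)" unfolding P.topspace_topol by blast
      then show "z \<in> ?pr ` U" using proj_coset[of u] by (intro image_eqI[of _ _ "q u"]) simp_all
    qed
  qed
qed

lemma pushes_pushout: "pushes lin Y a E (tvs_pushout_extension Y Y' a E)"
proof (rule pushesI; (unfold tvs_pushout_extension_simps(1,2))?)
  show "top_morphism lin (mid E) Q (\<lambda>x. q (\<one>\<^bsub>Y'\<^esub>, x))"
    by (rule top_morphism_compose[OF top_morphism_pair[OF top_morphism_const_one[OF Y']
          top_morphism_id] q])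
  show "q (\<one>\<^bsub>Y'\<^esub>, incl E y) = q (a y, \<one>\<^bsub>mid E\<^esub>)" if "y \<in> carrier Y" for y
    using q_shift[OF Y'.one_closed X.one_closed that] that by simp
  show "proj (tvs_pushout_extension Y Y' a E) (q (\<one>\<^bsub>Y'\<^esub>, x)) = proj E x" if "x \<in> carrier (mid E)" for x
    using that by (simp add: proj_coset)
qed

end
end

section \<open>Fibre products of extensions\<close>

text \<open>
  The second component, the common image in \<open>Z\<close>, is kept so that the construction is right for empty
  \<open>I\<close> as well: then the fibre product is isomorphic to \<open>Z\<close>.
\<close>

definition fibre_product_set ::
    "'i set \<Rightarrow> 'z tvs \<Rightarrow> ('i \<Rightarrow> ('y, 'x, 'z) tvs_extension) \<Rightarrow> (('i \<Rightarrow> 'x) \<times> 'z) set" where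
  "fibre_product_set I Z E =
     {u \<in> carrier (tvs_prod (tvs_Prod I (\<lambda>i. mid (E i))) Z). \<forall>i\<in>I. proj (E i) (fst u i) = snd u}"

definition fibre_product_extension ::
    "'i set \<Rightarrow> 'z tvs \<Rightarrow> ('i \<Rightarrow> ('y, 'x, 'z) tvs_extension) \<Rightarrow>
     ('i \<Rightarrow> 'y, ('i \<Rightarrow> 'x) \<times> 'z, 'z) tvs_extension" where
  "fibre_product_extension I Z E =
     \<lparr>mid = tvs_subobject (tvs_prod (tvs_Prod I (\<lambda>i. mid (E i))) Z) (fibre_product_set I Z E),
      incl = (\<lambda>y. (\<lambda>i\<in>I. incl (E i) (y i), \<one>\<^bsub>Z\<^esub>)),
      proj = snd\<rparr>"

context
  fixes I :: "'i set" and lin :: bool and Z :: "'z tvs" and Y :: "'i \<Rightarrow> 'y tvs"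
    and E :: "'i \<Rightarrow> ('y, 'x, 'z) tvs_extension"
  assumes Z: "top_object lin Z" and E: "\<And>i. i \<in> I \<Longrightarrow> top_extension lin Z (Y i) (E i)"
begin

interpretation Z: top_ab_group Z by (rule top_objectD[OF Z])

private abbreviation "X \<equiv> \<lambda>i. mid (E i)"
private abbreviation "P \<equiv> tvs_prod (tvs_Prod I X) Z"
private abbreviation "S \<equiv> fibre_product_set I Z E"
private abbreviation "M \<equiv> tvs_subobject P S"
private abbreviation "F \<equiv> fibre_product_extension I Z E"

private lemma F_simps:
  "mid F = M" "incl F = (\<lambda>y. (\<lambda>i\<in>I. incl (E i) (y i), \<one>\<^bsub>Z\<^esub>))" "proj F = snd"
  by (simp_all add: fibre_product_extension_def)

private lemma S_iff:
  "u \<in> S \<longleftrightarrow> fst u \<in> (\<Pi>\<^sub>E i\<in>I. carrier (X i)) \<and> snd u \<in> carrier Z \<and> (\<forall>i\<in>I. proj (E i) (fst u i) = snd u)"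
  unfolding fibre_product_set_def by (simp add: mem_Times_iff)

private lemma X_object: "i \<in> I \<Longrightarrow> top_object lin (X i)"
  using E by (simp add: top_extension_def)

private lemma Y_object: "i \<in> I \<Longrightarrow> top_object lin (Y i)"
  using E by (simp add: top_extension_def)

private lemma P: "top_object lin P"
  by (intro top_object_tvs_prod top_object_tvs_Prod X_object Z)

private lemma coord: "i \<in> I \<Longrightarrow> top_morphism lin P (X i) (\<lambda>u. fst u i)"
  by (rule top_morphism_compose[OF top_morphism_fst top_morphism_coord])

private lemma M: "top_object lin M"
  unfolding fibre_product_set_def
  by (rule top_object_equalizer[OF P Z])
    (rule top_morphism_compose[OF coord top_extension.proj_morphism[OF E]] top_morphism_snd; assumption?)+

private lemma S_subset: "S \<subseteq> carrier P"
  by (auto simp: fibre_product_set_def)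

text \<open>
  Neighbourhoods in a product restrict finitely many coordinates only. So a finite intersection of
  neighbourhoods in \<open>Z\<close> suffices to lift its points to a given neighbourhood in the fibre product.
\<close>

lemma top_extension_fibre_product:
  "top_extension lin Z (tvs_Prod I Y) (fibre_product_extension I Z E)"
proof (rule top_extensionI[OF Z]; (unfold F_simps)?)
  show "top_object lin (tvs_Prod I Y)" by (intro top_object_tvs_Prod Y_object)
  then show "top_morphism lin (tvs_Prod I Y) M (\<lambda>y. (\<lambda>i\<in>I. incl (E i) (y i), \<one>\<^bsub>Z\<^esub>))"
  proof (rule top_morphism_into_subobject[rotated 2])
    show "top_morphism lin (tvs_Prod I Y) P (\<lambda>y. (\<lambda>i\<in>I. incl (E i) (y i), \<one>\<^bsub>Z\<^esub>))"
    proof (intro top_morphism_pair top_morphism_tuple top_morphism_const_one[OF Z])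
      fix i assume i: "i \<in> I"
      show "top_morphism lin (tvs_Prod I Y) (X i) (\<lambda>y. incl (E i) (y i))"
        by (rule top_morphism_compose[OF top_morphism_coord[OF i, where Y = Y] top_extension.incl_morphism[OF E[OF i]]])
    qed
    fix y assume "y \<in> carrier (tvs_Prod I Y)"
    then show "(\<lambda>i\<in>I. incl (E i) (y i), \<one>\<^bsub>Z\<^esub>) \<in> S"
      by (simp add: S_iff PiE_iff top_morphism_closed[OF top_extension.incl_morphism[OF E]]
          top_extension.proj_incl[OF E])
  qed
  show "top_object lin M" by (rule M)
  show "top_morphism lin M Z snd"
    by (rule top_morphism_from_subobject[OF top_morphism_snd S_subset])
  show "snd (\<lambda>i\<in>I. incl (E i) (y i), \<one>\<^bsub>Z\<^esub>) = \<one>\<^bsub>Z\<^esub>" for y by simp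
  show "y = \<one>\<^bsub>tvs_Prod I Y\<^esub>"
    if y: "y \<in> carrier (tvs_Prod I Y)" "(\<lambda>i\<in>I. incl (E i) (y i), \<one>\<^bsub>Z\<^esub>) = \<one>\<^bsub>M\<^esub>" for y
  proof -
    have "y i = \<one>\<^bsub>Y i\<^esub>" if i: "i \<in> I" for i
    proof -
      have "(\<lambda>i\<in>I. incl (E i) (y i)) i = (\<lambda>i\<in>I. \<one>\<^bsub>X i\<^esub>) i" using y(2) by simp
      then have "incl (E i) (y i) = \<one>\<^bsub>X i\<^esub>" using i by simp
      moreover have "y i \<in> carrier (Y i)" using y(1) i by (simp add: PiE_iff)
      ultimately show ?thesis using top_extension.incl_one_iff[OF E[OF i]] by simp
    qed
    then show ?thesis using y(1) by (intro ext) (simp add: PiE_iff extensional_def)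
  qed
  show "u \<in> (\<lambda>y. (\<lambda>i\<in>I. incl (E i) (y i), \<one>\<^bsub>Z\<^esub>)) ` carrier (tvs_Prod I Y)"
    if u: "u \<in> carrier M" "snd u = \<one>\<^bsub>Z\<^esub>" for u
  proof -
    have u': "fst u \<in> (\<Pi>\<^sub>E i\<in>I. carrier (X i))" "\<forall>i\<in>I. proj (E i) (fst u i) = \<one>\<^bsub>Z\<^esub>"
      using u by (simp_all add: S_iff)
    have "\<exists>y. y \<in> carrier (Y i) \<and> fst u i = incl (E i) y" if i: "i \<in> I" for i
      using top_extension.kernelE[OF E[OF i], of "fst u i"] u' i by (metis PiE_mem)
    then obtain y where y: "\<And>i. i \<in> I \<Longrightarrow> y i \<in> carrier (Y i) \<and> fst u i = incl (E i) (y i)" by metis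
    have "u = (\<lambda>i\<in>I. incl (E i) (restrict y I i), \<one>\<^bsub>Z\<^esub>)"
    proof (rule prod_eqI)
      show "fst u = fst (\<lambda>i\<in>I. incl (E i) (restrict y I i), \<one>\<^bsub>Z\<^esub>)"
        using y u'(1) by (intro ext) (simp add: PiE_iff extensional_def)
    qed (simp add: u)
    moreover have "restrict y I \<in> carrier (tvs_Prod I Y)" using y by simp
    ultimately show ?thesis by (rule image_eqI)
  qed
  show "z \<in> snd ` carrier M" if z: "z \<in> carrier Z" for z
  proof -
    have "\<exists>x. x \<in> carrier (X i) \<and> proj (E i) x = z" if i: "i \<in> I" for i
      using top_extension.proj_surj[OF E[OF i]] z by (metis imageE)
    then obtain x where x: "\<And>i. i \<in> I \<Longrightarrow> x i \<in> carrier (X i) \<and> proj (E i) (x i) = z" by metis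
    then have "(restrict x I, z) \<in> S" using z by (simp add: S_iff)
    then show ?thesis by (intro image_eqI[of _ _ "(restrict x I, z)"]) simp_all
  qed
  have nbhd_coord: "openin (topol P) ((\<Pi>\<^sub>E i\<in>I. V i) \<times> W)"
    if "\<And>i. i \<in> I \<Longrightarrow> openin (topol (X i)) (V i)" "finite {i \<in> I. V i \<noteq> topspace (topol (X i))}"
      "openin (topol Z) W" for V W
    using that by (simp add: openin_prod_Times_iff openin_PiE_gen)
  have tsX: "topspace (topol (X i)) = carrier (X i)" if "i \<in> I" for i
    using top_ab_group.topspace_topol[OF top_objectD[OF X_object[OF that]]] .
  have tsY: "topspace (topol (Y i)) = carrier (Y i)" if "i \<in> I" for i
    using top_ab_group.topspace_topol[OF top_objectD[OF Y_object[OF that]]] .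
  show "\<exists>V. openin (topol M) V \<and> \<one>\<^bsub>M\<^esub> \<in> V \<and>
      (\<forall>y\<in>carrier (tvs_Prod I Y). (\<lambda>i\<in>I. incl (E i) (y i), \<one>\<^bsub>Z\<^esub>) \<in> V \<longrightarrow> y \<in> U)"
    if U: "openin (topol (tvs_Prod I Y)) U" "\<one>\<^bsub>tvs_Prod I Y\<^esub> \<in> U" for U
  proof -
    obtain B where B: "finite {i \<in> I. B i \<noteq> topspace (topol (Y i))}"
        "\<forall>i\<in>I. openin (topol (Y i)) (B i)" "\<one>\<^bsub>tvs_Prod I Y\<^esub> \<in> Pi\<^sub>E I B" "Pi\<^sub>E I B \<subseteq> U"
      using U unfolding tvs_Prod_simps(4) openin_product_topology_alt by meson
    have "\<exists>V. openin (topol (X i)) V \<and> \<one>\<^bsub>X i\<^esub> \<in> V \<and>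
        (\<forall>y\<in>carrier (Y i). incl (E i) y \<in> V \<longrightarrow> y \<in> B i) \<and>
        (B i = topspace (topol (Y i)) \<longrightarrow> V = topspace (topol (X i)))" if i: "i \<in> I" for i
    proof (cases "B i = topspace (topol (Y i))")
      case True
      have "\<one>\<^bsub>X i\<^esub> \<in> carrier (X i)"
        using top_ab_group.axioms(1)[OF top_objectD[OF X_object[OF i]]]
        by (simp add: comm_group_def group_def monoid.one_closed)
      then show ?thesis using True i by (intro exI[of _ "topspace (topol (X i))"]) (simp add: tsY, simp add: tsX)
    next
      case False
      have "openin (topol (Y i)) (B i)" "\<one>\<^bsub>Y i\<^esub> \<in> B i" using B i by (auto simp: PiE_iff)
      then show ?thesis
        using top_extension.incl_nbhd[OF E[OF i]] False by (metis (no_types, lifting))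
    qed
    then obtain V where V: "\<And>i. i \<in> I \<Longrightarrow> openin (topol (X i)) (V i) \<and> \<one>\<^bsub>X i\<^esub> \<in> V i \<and>
        (\<forall>y\<in>carrier (Y i). incl (E i) y \<in> V i \<longrightarrow> y \<in> B i) \<and>
        (B i = topspace (topol (Y i)) \<longrightarrow> V i = topspace (topol (X i)))" by metis
    have "{i \<in> I. V i \<noteq> topspace (topol (X i))} \<subseteq> {i \<in> I. B i \<noteq> topspace (topol (Y i))}"
      using V by blast
    then have "finite {i \<in> I. V i \<noteq> topspace (topol (X i))}" using B(1) finite_subset by blast
    moreover have "openin (topol Z) (carrier Z)"
      using openin_topspace[of "topol Z"] by (simp only: Z.topspace_topol)
    ultimately have "openin (topol P) ((\<Pi>\<^sub>E i\<in>I. V i) \<times> carrier Z)"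
      using V by (intro nbhd_coord) blast+
    then have "openin (topol M) (((\<Pi>\<^sub>E i\<in>I. V i) \<times> carrier Z) \<inter> S)"
      unfolding tvs_subobject_simps by (rule openin_subtopology_Int)
    moreover have "\<one>\<^bsub>M\<^esub> \<in> ((\<Pi>\<^sub>E i\<in>I. V i) \<times> carrier Z) \<inter> S"
    proof -
      have "\<one>\<^bsub>M\<^esub> \<in> carrier M" using top_ab_group.axioms(1)[OF top_objectD[OF M]]
        by (simp only: comm_group_def group_def monoid.one_closed)
      then show ?thesis using V by simp
    qed
    moreover have "y \<in> U" if y: "y \<in> carrier (tvs_Prod I Y)"
      "(\<lambda>i\<in>I. incl (E i) (y i), \<one>\<^bsub>Z\<^esub>) \<in> ((\<Pi>\<^sub>E i\<in>I. V i) \<times> carrier Z) \<inter> S" for y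
    proof -
      have "y i \<in> B i" if i: "i \<in> I" for i
      proof -
        have "(\<lambda>i\<in>I. incl (E i) (y i)) \<in> (\<Pi>\<^sub>E i\<in>I. V i)" using y(2) by simp
        then have "incl (E i) (y i) \<in> V i" using i by (auto simp: PiE_iff)
        moreover have "y i \<in> carrier (Y i)" using y(1) i by (simp add: PiE_iff)
        ultimately show ?thesis using V[OF i] by blast
      qed
      then have "y \<in> Pi\<^sub>E I B" using y(1) by (simp add: PiE_iff)
      then show ?thesis using B(4) by blast
    qed
    ultimately show ?thesis by meson
  qed
  show "\<exists>V. openin (topol Z) V \<and> \<one>\<^bsub>Z\<^esub> \<in> V \<and> V \<subseteq> snd ` U"
    if U: "openin (topol M) U" "\<one>\<^bsub>M\<^esub> \<in> U" for U
  proof -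
    obtain W where W: "openin (topol P) W" "U = W \<inter> S"
      using U(1) unfolding tvs_subobject_simps openin_subtopology by blast
    have "(\<one>\<^bsub>tvs_Prod I X\<^esub>, \<one>\<^bsub>Z\<^esub>) \<in> W" using U(2) W(2) by simp
    then obtain A B where AB: "openin (topol (tvs_Prod I X)) A" "openin (topol Z) B"
        "\<one>\<^bsub>tvs_Prod I X\<^esub> \<in> A" "\<one>\<^bsub>Z\<^esub> \<in> B" "A \<times> B \<subseteq> W"
      using W(1) unfolding tvs_prod_simps(4) openin_prod_topology_alt by meson
    obtain V where V: "finite {i \<in> I. V i \<noteq> topspace (topol (X i))}"
        "\<forall>i\<in>I. openin (topol (X i)) (V i)" "\<one>\<^bsub>tvs_Prod I X\<^esub> \<in> Pi\<^sub>E I V" "Pi\<^sub>E I V \<subseteq> A"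
      using AB(1,3) unfolding tvs_Prod_simps(4) openin_product_topology_alt by meson
    let ?J = "{i \<in> I. V i \<noteq> topspace (topol (X i))}"
    \<comment> \<open>a point near \<open>\<one>\<close> has to be lifted to \<open>V i\<close> for the finitely many \<open>i\<close> in \<open>?J\<close> only\<close>
    let ?B = "B \<inter> \<Inter>((\<lambda>i. proj (E i) ` V i) ` ?J)"
    have "openin (topol Z) (proj (E i) ` V i)" if "i \<in> ?J" for i
      using top_extension.proj_open_map[OF E] V(2) that by (simp add: open_map_def)
    then have "openin (topol Z) ?B"
      using V(1) AB(2) by (intro openin_Int_Inter) auto
    moreover have "\<one>\<^bsub>Z\<^esub> \<in> proj (E i) ` V i" if i: "i \<in> ?J" for i
    proof -
      have "proj (E i) \<one>\<^bsub>X i\<^esub> = \<one>\<^bsub>Z\<^esub>"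
        by (rule top_morphism_one[OF X_object Z top_extension.proj_morphism[OF E]]) (use i in simp_all)
      moreover have "\<one>\<^bsub>X i\<^esub> \<in> V i" using V(3) i by (simp add: PiE_iff)
      ultimately show ?thesis by (metis image_eqI)
    qed
    then have "\<one>\<^bsub>Z\<^esub> \<in> ?B" using AB(4) by blast
    moreover have "?B \<subseteq> snd ` U"
    proof
      fix z assume z: "z \<in> ?B"
      then have zZ: "z \<in> carrier Z" using Z.openin_subset_carrier[OF AB(2)] by blast
      have "\<exists>x. x \<in> V i \<and> proj (E i) x = z" if i: "i \<in> I" for i
      proof (cases "i \<in> ?J")
        case True
        then show ?thesis using z by blast
      next
        case False
        then show ?thesis
          using i zZ tsX[OF i] unfolding top_extension.proj_surj[OF E[OF i], symmetric] by blast
      qed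
      then obtain x where x: "\<And>i. i \<in> I \<Longrightarrow> x i \<in> V i \<and> proj (E i) (x i) = z" by metis
      have "V i \<subseteq> carrier (X i)" if "i \<in> I" for i
        using V(2) that tsX[OF that] openin_subset by blast
      then have "(restrict x I, z) \<in> S" using x zZ by (auto simp: S_iff)
      moreover have "restrict x I \<in> A" using x V(4) by auto
      then have "(restrict x I, z) \<in> W" using z AB(5) by blast
      ultimately have "(restrict x I, z) \<in> U" by (simp add: W(2))
      then show "z \<in> snd ` U" by (rule rev_image_eqI) simp
    qed
    ultimately show ?thesis by meson
  qed
qed

lemma pushes_fibre_product_coord:
  assumes i: "i \<in> I"
  shows "pushes lin (tvs_Prod I Y) (\<lambda>y. y i) (fibre_product_extension I Z E) (E i)"
  by (rule pushesI[where S = "\<lambda>u. fst u i"]; (unfold F_simps)?)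
    (simp_all add: i S_iff top_morphism_from_subobject[OF coord[OF i] S_subset])

text \<open>
  The universal property of the fibre product: morphisms to all factors over \<open>Z\<close> combine to one
  morphism.
\<close>

lemma pushes_into_fibre_product:
  assumes E': "top_extension lin Z (tvs_Prod I Y) E'"
    and push: "\<And>i. i \<in> I \<Longrightarrow> pushes lin (tvs_Prod I Y) (\<lambda>y. y i) E' (E i)"
  shows "pushes lin (tvs_Prod I Y) (\<lambda>y. y) E' (fibre_product_extension I Z E)"
proof -
  interpret E': top_extension lin Z "tvs_Prod I Y" E' by fact
  have "\<exists>S. top_morphism lin (mid E') (X i) S \<and>
      (\<forall>y\<in>carrier (tvs_Prod I Y). S (incl E' y) = incl (E i) (y i)) \<and>
      (\<forall>x\<in>carrier (mid E'). proj (E i) (S x) = proj E' x)" if "i \<in> I" for i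
    using push[OF that] by (simp only: pushes_def)
  then obtain T where T: "\<And>i. i \<in> I \<Longrightarrow> top_morphism lin (mid E') (X i) (T i)"
      "\<And>i y. \<lbrakk>i \<in> I; y \<in> carrier (tvs_Prod I Y)\<rbrakk> \<Longrightarrow> T i (incl E' y) = incl (E i) (y i)"
      "\<And>i x. \<lbrakk>i \<in> I; x \<in> carrier (mid E')\<rbrakk> \<Longrightarrow> proj (E i) (T i x) = proj E' x"
    by metis
  \<comment> \<open>the morphisms to the factors, with the base point in \<open>Z\<close> as second component\<close>
  let ?T = "\<lambda>x. (\<lambda>i\<in>I. T i x, proj E' x)"
  show ?thesis
  proof (rule pushesI[where S = ?T]; (unfold F_simps)?)
    show "top_morphism lin (mid E') M ?T"
    proof (rule top_morphism_into_subobject[OF _ _ E'.mid_object])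
      show "top_morphism lin (mid E') P ?T"
        by (intro top_morphism_pair top_morphism_tuple T(1) E'.proj_morphism)
      fix x assume "x \<in> carrier (mid E')"
      then show "?T x \<in> S" by (simp add: S_iff T(3) top_morphism_closed[OF T(1)])
    qed
    show "?T (incl E' y) = (\<lambda>i\<in>I. incl (E i) (y i), \<one>\<^bsub>Z\<^esub>)" if y: "y \<in> carrier (tvs_Prod I Y)" for y
    proof (rule prod_eqI)
      show "fst (?T (incl E' y)) = fst (\<lambda>i\<in>I. incl (E i) (y i), \<one>\<^bsub>Z\<^esub>)"
        unfolding fst_conv by (rule restrict_ext) (rule T(2)[OF _ y])
      show "snd (?T (incl E' y)) = snd (\<lambda>i\<in>I. incl (E i) (y i), \<one>\<^bsub>Z\<^esub>)"
        unfolding snd_conv by (rule E'.proj_incl[OF y])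
    qed
  qed simp
qed

end

section \<open>The Baer sum\<close>

text \<open>
  The intermediate step of the Baer sum, an extension of \<open>Z\<close> by \<open>Y1 \<times> Y2\<close>. It is the
  product of \<open>E1\<close> and \<open>E2\<close> in the category of extensions of \<open>Z\<close>: its two projections are
  \<open>pushes_diagonal_fst\<close> and \<open>pushes_diagonal_snd\<close>, and \<open>pushes_pair\<close> is its universal property.
\<close>

definition diagonal_extension ::
    "'z tvs \<Rightarrow> ('y1, 'x1, 'z) tvs_extension \<Rightarrow> ('y2, 'x2, 'z) tvs_extension \<Rightarrow>
     ('y1 \<times> 'y2, ('x1 \<times> 'x2) \<times> 'z, 'z) tvs_extension" where
  "diagonal_extension Z E1 E2 = tvs_pullback_extension Z (\<lambda>z. (z, z)) (tvs_product_extension E1 E2)"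

lemma tvs_baer_sum_eq:
  "tvs_baer_sum Z Y E1 E2 =
     tvs_pushout_extension (tvs_prod Y Y) Y (\<lambda>(a, b). a \<otimes>\<^bsub>Y\<^esub> b) (diagonal_extension Z E1 E2)"
  by (simp add: tvs_baer_sum_def diagonal_extension_def)

lemma diagonal_extension_simps:
  "mid (diagonal_extension Z E1 E2) = tvs_subobject (tvs_prod (tvs_prod (mid E1) (mid E2)) Z)
     (pullback_set Z (\<lambda>z. (z, z)) (tvs_product_extension E1 E2))"
  "incl (diagonal_extension Z E1 E2) = (\<lambda>y. ((incl E1 (fst y), incl E2 (snd y)), \<one>\<^bsub>Z\<^esub>))"
  "proj (diagonal_extension Z E1 E2) = snd"
  by (simp_all add: diagonal_extension_def map_prod_def case_prod_unfold)

lemma top_extension_diagonal: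
  assumes E1: "top_extension lin Z Y1 E1" and E2: "top_extension lin Z Y2 E2"
  shows "top_extension lin Z (tvs_prod Y1 Y2) (diagonal_extension Z E1 E2)"
proof -
  have Z: "top_object lin Z" using E1 by (simp add: top_extension_def)
  show ?thesis
    unfolding diagonal_extension_def
    by (rule top_extension_pullback[OF top_extension_product[OF E1 E2] Z
          top_morphism_pair[OF top_morphism_id top_morphism_id]])
qed

lemma
  assumes E1: "top_extension lin Z Y1 E1" and E2: "top_extension lin Z Y2 E2"
  shows pushes_diagonal_fst: "pushes lin (tvs_prod Y1 Y2) fst (diagonal_extension Z E1 E2) E1"
    and pushes_diagonal_snd: "pushes lin (tvs_prod Y1 Y2) snd (diagonal_extension Z E1 E2) E2"
proof -
  let ?S = "pullback_set Z (\<lambda>z. (z, z)) (tvs_product_extension E1 E2)"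
  have sub: "?S \<subseteq> carrier (tvs_prod (tvs_prod (mid E1) (mid E2)) Z)"
    by (auto simp: pullback_set_iff)
  have 1: "top_morphism lin (mid (diagonal_extension Z E1 E2)) (mid E1) (\<lambda>u. fst (fst u))"
    unfolding diagonal_extension_simps
    by (rule top_morphism_from_subobject[OF top_morphism_compose[OF top_morphism_fst top_morphism_fst] sub])
  show "pushes lin (tvs_prod Y1 Y2) fst (diagonal_extension Z E1 E2) E1"
    by (rule pushesI[OF 1]) (auto simp: diagonal_extension_simps pullback_set_iff)
  have 2: "top_morphism lin (mid (diagonal_extension Z E1 E2)) (mid E2) (\<lambda>u. snd (fst u))"
    unfolding diagonal_extension_simps
    by (rule top_morphism_from_subobject[OF top_morphism_compose[OF top_morphism_fst top_morphism_snd] sub])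
  show "pushes lin (tvs_prod Y1 Y2) snd (diagonal_extension Z E1 E2) E2"
    by (rule pushesI[OF 2]) (auto simp: diagonal_extension_simps pullback_set_iff)
qed

lemma pushes_pair:
  assumes E: "top_extension lin Z W E"
    and 1: "pushes lin W a E E1" and 2: "pushes lin W b E E2"
  shows "pushes lin W (\<lambda>w. (a w, b w)) E (diagonal_extension Z E1 E2)"
proof -
  interpret E: top_extension lin Z W E by fact
  obtain S1 where S1: "top_morphism lin (mid E) (mid E1) S1"
    "\<And>w. w \<in> carrier W \<Longrightarrow> S1 (incl E w) = incl E1 (a w)"
    "\<And>x. x \<in> carrier (mid E) \<Longrightarrow> proj E1 (S1 x) = proj E x" by (rule pushesE[OF 1]) (rule that)
  obtain S2 where S2: "top_morphism lin (mid E) (mid E2) S2"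
    "\<And>w. w \<in> carrier W \<Longrightarrow> S2 (incl E w) = incl E2 (b w)"
    "\<And>x. x \<in> carrier (mid E) \<Longrightarrow> proj E2 (S2 x) = proj E x" by (rule pushesE[OF 2]) (rule that)
  have T: "top_morphism lin (mid E) (mid (diagonal_extension Z E1 E2)) (\<lambda>x. ((S1 x, S2 x), proj E x))"
    unfolding diagonal_extension_simps
    by (rule top_morphism_into_subobject[OF top_morphism_pair[OF top_morphism_pair[OF S1(1) S2(1)]
          E.proj_morphism] _ E.mid_object])
      (simp add: pullback_set_iff S1(3) S2(3) top_morphism_closed[OF S1(1)] top_morphism_closed[OF S2(1)])
  show ?thesis
    by (rule pushesI[OF T]) (simp_all add: diagonal_extension_simps S1(2) S2(2))
qed

lemma top_morphism_mult_pair: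
  "top_object lin Y \<Longrightarrow> top_morphism lin (tvs_prod Y Y) Y (\<lambda>(a, b). a \<otimes>\<^bsub>Y\<^esub> b)"
  unfolding case_prod_unfold by (intro top_morphism_mult_fun top_morphism_fst top_morphism_snd)

lemma top_extension_baer_sum:
  assumes "top_extension lin Z Y E1" "top_extension lin Z Y E2"
  shows "top_extension lin Z Y (tvs_baer_sum Z Y E1 E2)"
proof -
  have Y: "top_object lin Y" using assms by (simp add: top_extension_def)
  show ?thesis
    unfolding tvs_baer_sum_eq
    by (rule top_extension.top_extension_pushout[OF top_extension_diagonal[OF assms] Y
          top_morphism_mult_pair[OF Y]])
qed

text \<open>
  The map to \<open>diagonal_extension\<close> given by the universal property, followed by the push-out along the
  addition. Together with uniqueness this characterises the Baer sum up to equivalence, since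
  \<open>E\<close> may be \<open>diagonal_extension\<close> itself.
\<close>

lemma pushes_baer_sum:
  assumes E1: "top_extension lin Z Y E1" and E2: "top_extension lin Z Y E2"
    and E: "top_extension lin Z W E"
    and a: "pushes lin W a E E1" "\<And>w. w \<in> carrier W \<Longrightarrow> a w \<in> carrier Y"
    and b: "pushes lin W b E E2" "\<And>w. w \<in> carrier W \<Longrightarrow> b w \<in> carrier Y"
  shows "pushes lin W (\<lambda>w. a w \<otimes>\<^bsub>Y\<^esub> b w) E (tvs_baer_sum Z Y E1 E2)"
proof -
  have Y: "top_object lin Y" using E1 by (simp add: top_extension_def)
  have "pushes lin (tvs_prod Y Y) (\<lambda>(a, b). a \<otimes>\<^bsub>Y\<^esub> b) (diagonal_extension Z E1 E2) (tvs_baer_sum Z Y E1 E2)"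
    unfolding tvs_baer_sum_eq
    by (rule top_extension.pushes_pushout[OF top_extension_diagonal[OF E1 E2] Y top_morphism_mult_pair[OF Y]])
  then show ?thesis
    by (rule pushes_compose[OF pushes_pair[OF E a(1) b(1)]]) (simp_all add: a(2) b(2))
qed

lemma pushes_id_sym:
  assumes "top_extension lin Z Y E" "top_extension lin Z Y E'" "pushes lin Y (\<lambda>y. y) E E'"
  shows "pushes lin Y (\<lambda>y. y) E' E"
  by (rule pushes_unique[OF assms(1,2,1) _ assms(3) pushes_id])

lemma pushes_id_trans:
  assumes "pushes lin Y (\<lambda>y. y) E E'" "pushes lin Y (\<lambda>y. y) E' E''"
  shows "pushes lin Y (\<lambda>y. y) E E''"
  by (rule pushes_compose[OF assms]) simp_all

context
  fixes lin :: bool and Z :: "'z tvs" and Y :: "'y tvs"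
  assumes Z: "top_object lin Z" and Y: "top_object lin Y"
begin

interpretation Y: top_ab_group Y by (rule top_objectD[OF Y])

lemma baer_sum_cong:
  assumes "top_extension lin Z Y E1" "top_extension lin Z Y E2"
    and "top_extension lin Z Y E1'" "top_extension lin Z Y E2'"
    and "pushes lin Y (\<lambda>y. y) E1 E1'" "pushes lin Y (\<lambda>y. y) E2 E2'"
  shows "pushes lin Y (\<lambda>y. y) (tvs_baer_sum Z Y E1 E2) (tvs_baer_sum Z Y E1' E2')"
proof -
  note S = top_extension_diagonal[OF assms(1,2)]
  note 1 = pushes_diagonal_fst[OF assms(1,2)] and 2 = pushes_diagonal_snd[OF assms(1,2)]
  have fst': "pushes lin (tvs_prod Y Y) fst (diagonal_extension Z E1 E2) E1'"
    by (rule pushes_compose[OF 1 assms(5)]) auto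
  have snd': "pushes lin (tvs_prod Y Y) snd (diagonal_extension Z E1 E2) E2'"
    by (rule pushes_compose[OF 2 assms(6)]) auto
  show ?thesis
    by (rule pushes_unique[OF S top_extension_baer_sum[OF assms(1,2)] top_extension_baer_sum[OF assms(3,4)]
          _ pushes_baer_sum[OF assms(1,2) S 1 _ 2] pushes_baer_sum[OF assms(3,4) S fst' _ snd']]) auto
qed

lemma baer_sum_comm:
  assumes "top_extension lin Z Y E1" "top_extension lin Z Y E2"
  shows "pushes lin Y (\<lambda>y. y) (tvs_baer_sum Z Y E1 E2) (tvs_baer_sum Z Y E2 E1)"
proof -
  note S = top_extension_diagonal[OF assms]
  note 1 = pushes_diagonal_fst[OF assms] and 2 = pushes_diagonal_snd[OF assms]
  have "pushes lin (tvs_prod Y Y) (\<lambda>w. snd w \<otimes>\<^bsub>Y\<^esub> fst w) (diagonal_extension Z E1 E2) (tvs_baer_sum Z Y E2 E1)"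
    by (rule pushes_baer_sum[OF assms(2,1) S 2 _ 1]) auto
  then have swap: "pushes lin (tvs_prod Y Y) (\<lambda>w. fst w \<otimes>\<^bsub>Y\<^esub> snd w) (diagonal_extension Z E1 E2) (tvs_baer_sum Z Y E2 E1)"
    by (rule pushes_compose[OF _ pushes_id, where Y = Y]) (auto intro: Y.m_comm)
  show ?thesis
    by (rule pushes_unique[OF S top_extension_baer_sum[OF assms] top_extension_baer_sum[OF assms(2,1)] _
          pushes_baer_sum[OF assms S 1 _ 2] swap]) auto
qed

text \<open>
  Both sides are reached, along \<open>((x, y), z) \<mapsto> x + y + z\<close>, from the extension by \<open>(Y \<times> Y) \<times> Y\<close> that
  combines the three given ones.
\<close>

lemma baer_sum_assoc:
  assumes E: "top_extension lin Z Y E1" "top_extension lin Z Y E2" "top_extension lin Z Y E3"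
  shows "pushes lin Y (\<lambda>y. y) (tvs_baer_sum Z Y (tvs_baer_sum Z Y E1 E2) E3)
           (tvs_baer_sum Z Y E1 (tvs_baer_sum Z Y E2 E3))"
proof -
  let ?S12 = "diagonal_extension Z E1 E2"
  let ?S = "diagonal_extension Z ?S12 E3"
  let ?W = "tvs_prod (tvs_prod Y Y) Y"
  note S12 = top_extension_diagonal[OF E(1,2)]
  note S = top_extension_diagonal[OF S12 E(3)]
  have 1: "pushes lin ?W (\<lambda>w. fst (fst w)) ?S E1"
    by (rule pushes_compose[OF pushes_diagonal_fst[OF S12 E(3)] pushes_diagonal_fst[OF E(1,2)]]) auto
  have 2: "pushes lin ?W (\<lambda>w. snd (fst w)) ?S E2"
    by (rule pushes_compose[OF pushes_diagonal_fst[OF S12 E(3)] pushes_diagonal_snd[OF E(1,2)]]) auto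
  have 3: "pushes lin ?W snd ?S E3" by (rule pushes_diagonal_snd[OF S12 E(3)])
  note E12 = top_extension_baer_sum[OF E(1,2)] and E23 = top_extension_baer_sum[OF E(2,3)]
  have 12: "pushes lin ?W (\<lambda>w. fst (fst w) \<otimes>\<^bsub>Y\<^esub> snd (fst w)) ?S (tvs_baer_sum Z Y E1 E2)"
    by (rule pushes_baer_sum[OF E(1,2) S 1 _ 2]) auto
  have 23: "pushes lin ?W (\<lambda>w. snd (fst w) \<otimes>\<^bsub>Y\<^esub> snd w) ?S (tvs_baer_sum Z Y E2 E3)"
    by (rule pushes_baer_sum[OF E(2,3) S 2 _ 3]) auto
  have l: "pushes lin ?W (\<lambda>w. (fst (fst w) \<otimes>\<^bsub>Y\<^esub> snd (fst w)) \<otimes>\<^bsub>Y\<^esub> snd w) ?S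
      (tvs_baer_sum Z Y (tvs_baer_sum Z Y E1 E2) E3)"
    by (rule pushes_baer_sum[OF E12 E(3) S 12 _ 3]) auto
  have "pushes lin ?W (\<lambda>w. fst (fst w) \<otimes>\<^bsub>Y\<^esub> (snd (fst w) \<otimes>\<^bsub>Y\<^esub> snd w)) ?S
      (tvs_baer_sum Z Y E1 (tvs_baer_sum Z Y E2 E3))"
    by (rule pushes_baer_sum[OF E(1) E23 S 1 _ 23]) auto
  then have r: "pushes lin ?W (\<lambda>w. (fst (fst w) \<otimes>\<^bsub>Y\<^esub> snd (fst w)) \<otimes>\<^bsub>Y\<^esub> snd w) ?S
      (tvs_baer_sum Z Y E1 (tvs_baer_sum Z Y E2 E3))"
    by (rule pushes_compose[OF _ pushes_id, where Y = Y]) (auto simp: Y.m_assoc)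
  show ?thesis
    by (rule pushes_unique[OF S top_extension_baer_sum[OF E12 E(3)] top_extension_baer_sum[OF E(1) E23] _ l r])
      auto
qed

lemma pushes_trivial:
  assumes "top_extension lin Z W E"
  shows "pushes lin W (\<lambda>_. \<one>\<^bsub>Y\<^esub>) E (tvs_trivial_extension Z Y)"
proof -
  interpret E: top_extension lin Z W E by fact
  show ?thesis
    by (rule pushesI[where S = "\<lambda>x. (\<one>\<^bsub>Y\<^esub>, proj E x)"])
      (simp_all add: top_morphism_pair[OF top_morphism_const_one[OF Y] E.proj_morphism])
qed

text \<open>
  \<open>E\<close> pushes to the trivial extension along \<open>0\<close> and to itself along the identity, hence to the sum along
  the identity.
\<close>

lemma baer_sum_trivial:
  assumes E: "top_extension lin Z Y E"
  shows "pushes lin Y (\<lambda>y. y) (tvs_baer_sum Z Y (tvs_trivial_extension Z Y) E) E"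
proof -
  note triv = top_extension_trivial[OF Z Y]
  have "pushes lin Y (\<lambda>y. \<one>\<^bsub>Y\<^esub> \<otimes>\<^bsub>Y\<^esub> y) E (tvs_baer_sum Z Y (tvs_trivial_extension Z Y) E)"
    by (rule pushes_baer_sum[OF triv E E pushes_trivial[OF E] _ pushes_id]) simp_all
  then have "pushes lin Y (\<lambda>y. y) E (tvs_baer_sum Z Y (tvs_trivial_extension Z Y) E)"
    by (rule pushes_compose[OF _ pushes_id, where Y = Y]) simp_all
  then show ?thesis
    by (rule pushes_id_sym[OF E top_extension_baer_sum[OF triv E]])
qed

text \<open>
  The inverse of \<open>E\<close> is its push-out along \<open>y \<mapsto> - y\<close>: the sum of the two is reached from \<open>E\<close> along
  \<open>y \<mapsto> - y + y = 0\<close>, and so is the trivial extension.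
\<close>

lemma ex_baer_sum_inverse:
  fixes E :: "('y, 'x, 'z) tvs_extension"
  assumes E: "top_extension lin Z Y E"
  shows "\<exists>E' :: ('y, ('y \<times> 'x) set, 'z) tvs_extension. top_extension lin Z Y E' \<and>
    pushes lin Y (\<lambda>y. y) (tvs_baer_sum Z Y E' E) (tvs_trivial_extension Z Y)"
proof (intro exI conjI)
  let ?E' = "tvs_pushout_extension Y Y (\<lambda>y. inv\<^bsub>Y\<^esub> y) E"
  note inv = top_morphism_inv_fun[OF Y top_morphism_id]
  show E': "top_extension lin Z Y ?E'"
    by (rule top_extension.top_extension_pushout[OF E Y inv])
  have "pushes lin Y (\<lambda>y. inv\<^bsub>Y\<^esub> y \<otimes>\<^bsub>Y\<^esub> y) E (tvs_baer_sum Z Y ?E' E)"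
    by (rule pushes_baer_sum[OF E' E E top_extension.pushes_pushout[OF E Y inv] _ pushes_id]) simp_all
  then have zero: "pushes lin Y (\<lambda>_. \<one>\<^bsub>Y\<^esub>) E (tvs_baer_sum Z Y ?E' E)"
    by (rule pushes_compose[OF _ pushes_id, where Y = Y]) simp_all
  show "pushes lin Y (\<lambda>y. y) (tvs_baer_sum Z Y ?E' E) (tvs_trivial_extension Z Y)"
    by (rule pushes_unique[OF E top_extension_baer_sum[OF E' E] top_extension_trivial[OF Z Y] _ zero
          pushes_trivial[OF E]]) simp_all
qed

end

section \<open>Extensions in the two categories\<close>

lemma top_object_True_iff: "top_object True A \<longleftrightarrow> top_vector_space A"
  by (auto simp: top_object_def top_vector_space_def)

lemma is_tvs_extension_iff:
  assumes "top_vector_space Z" "top_vector_space Y"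
  shows "is_tvs_extension Z Y E \<longleftrightarrow> top_extension True Z Y E"
  using assms
  by (auto simp: is_tvs_extension_def top_extension_def top_object_True_iff top_morphism_def
      continuous_linear_def)

lemma tvs_ext_equiv_iff: "tvs_ext_equiv Y E E' \<longleftrightarrow> pushes True Y (\<lambda>y. y) E E'"
  by (simp add: tvs_ext_equiv_def pushes_def top_morphism_def continuous_linear_def)

definition lift_tgroup :: "'a tgroup \<Rightarrow> 'a tvs" where
  "lift_tgroup A = tgroup.extend A (tvs.fields (\<lambda>r x. x))"

lemma truncate_lift_tgroup [simp]: "tgroup.truncate (lift_tgroup A) = A"
  by (cases A) (simp add: lift_tgroup_def tgroup.defs tvs.defs)

lemma truncate_simps [simp]:
  "carrier (tgroup.truncate A) = carrier A"
  "monoid.mult (tgroup.truncate A) = monoid.mult A"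
  "one (tgroup.truncate A) = one A"
  "topol (tgroup.truncate A) = topol A"
  by (simp_all add: tgroup.truncate_def)

lemma m_inv_truncate [simp]: "m_inv (tgroup.truncate A) = m_inv A"
  by (intro ext) (simp add: m_inv_def)

lemma r_coset_truncate [simp]: "r_coset (tgroup.truncate A) = r_coset A"
  by (intro ext) (simp add: r_coset_def)

definition forget_scale :: "('y, 'x, 'z) tvs_extension \<Rightarrow> ('y, 'x, 'z) tgroup_extension" where
  "forget_scale E = \<lparr>mid = tgroup.truncate (mid E), incl = incl E, proj = proj E\<rparr>"

lemma forget_scale_simps [simp]:
  "mid (forget_scale E) = tgroup.truncate (mid E)"
  "incl (forget_scale E) = incl E"
  "proj (forget_scale E) = proj E"
  by (simp_all add: forget_scale_def)

lemma ex_forget_scale: "\<exists>E. forget_scale E = E'"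
  by (rule exI[of _ "\<lparr>mid = lift_tgroup (mid E'), incl = incl E', proj = proj E'\<rparr>"])
    (simp add: forget_scale_def)

lemma top_ab_group_truncate_iff: "top_ab_group (tgroup.truncate A) \<longleftrightarrow> top_ab_group A"
  using top_ab_group_cong[of A "tgroup.truncate A"] top_ab_group_cong[of "tgroup.truncate A" A] by auto

lemma continuous_hom_truncate: 
  "continuous_hom (tgroup.truncate A) (tgroup.truncate B) f \<longleftrightarrow> continuous_hom A B f"
  by (simp add: continuous_hom_def hom_def)

lemma is_extension_forget_scale_iff:
  assumes "top_ab_group Z" "top_ab_group Y"
  shows "is_extension (tgroup.truncate Z) (tgroup.truncate Y) (forget_scale E) \<longleftrightarrow>
    top_extension False Z Y E"
  using assms
  by (auto simp: is_extension_def top_extension_def top_object_def top_morphism_def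
      top_ab_group_truncate_iff continuous_hom_truncate open_onto_image_def short_exact_def kernel_def)

lemma ext_equiv_forget_scale_iff:
  "ext_equiv (tgroup.truncate Y) (forget_scale E) (forget_scale E') \<longleftrightarrow> pushes False Y (\<lambda>y. y) E E'"
  by (simp add: ext_equiv_def pushes_def top_morphism_def continuous_hom_truncate)

text \<open>
  For \<open>lin = False\<close> the equivalent extension is found among the extensions of topological groups, and
  its middle object then receives a scalar multiplication by \<open>ex_forget_scale\<close>.
\<close>

lemma ex_small_top_extension:
  fixes E :: "('y, 'x, 'z) tvs_extension"
  assumes E: "top_extension lin Z Y E"
  shows "\<exists>E' :: ('y, 'y \<times> 'z, 'z) tvs_extension. top_extension lin Z Y E' \<and> pushes lin Y (\<lambda>y. y) E E'"
proof (cases lin)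
  case True
  then have tvs: "top_vector_space Z" "top_vector_space Y"
    using E by (simp_all add: top_extension_def top_object_True_iff)
  then have "is_tvs_extension Z Y E" using E True by (simp add: is_tvs_extension_iff)
  from ex_small_tvs_extension[OF tvs this] show ?thesis
    using True by (simp add: is_tvs_extension_iff[OF tvs] tvs_ext_equiv_iff)
next
  case False
  then have tg: "top_ab_group Z" "top_ab_group Y"
    using E by (simp_all add: top_extension_def top_object_def)
  have "is_extension (tgroup.truncate Z) (tgroup.truncate Y) (forget_scale E)"
    using E False by (simp add: is_extension_forget_scale_iff[OF tg])
  then obtain E0 :: "('y, 'y \<times> 'z, 'z) tgroup_extension" where E0:
    "is_extension (tgroup.truncate Z) (tgroup.truncate Y) E0"
    "ext_equiv (tgroup.truncate Y) (forget_scale E) E0"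
    using ex_small_extension[of "tgroup.truncate Z" "tgroup.truncate Y"] tg
    by (metis top_ab_group_truncate_iff)
  obtain E' where "forget_scale E' = E0" using ex_forget_scale by metis
  then show ?thesis
    using E0 False is_extension_forget_scale_iff[OF tg] ext_equiv_forget_scale_iff by metis
qed

section \<open>The group of extension classes\<close>

text \<open>
  As for \<open>Ext\<close> and \<open>Ext_TVS\<close>, the extension may live on any type, but its class collects
  the equivalent extensions with middle object on \<open>'y \<times> 'z\<close>; \<open>ex_small_top_extension\<close> says that there
  are such extensions in every class.
\<close>

definition ext_class_lin ::
    "bool \<Rightarrow> 'z tvs \<Rightarrow> 'y tvs \<Rightarrow> ('y, 'x, 'z) tvs_extension \<Rightarrow> ('y, 'y \<times> 'z, 'z) tvs_extension set" where
  "ext_class_lin lin Z Y E = {E'. top_extension lin Z Y E' \<and> pushes lin Y (\<lambda>y. y) E E'}"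

definition Ext_lin ::
    "bool \<Rightarrow> 'z tvs \<Rightarrow> 'y tvs \<Rightarrow> ('y, 'y \<times> 'z, 'z) tvs_extension set monoid" where
  "Ext_lin lin Z Y =
     \<lparr>carrier = ext_class_lin lin Z Y ` {E :: ('y, 'y \<times> 'z, 'z) tvs_extension. top_extension lin Z Y E},
      monoid.mult = (\<lambda>c1 c2. \<Union>E1\<in>c1. \<Union>E2\<in>c2. ext_class_lin lin Z Y (tvs_baer_sum Z Y E1 E2)),
      one = ext_class_lin lin Z Y (tvs_trivial_extension Z Y)\<rparr>"

lemma Ext_TVS_eq:
  fixes Z :: "'z tvs" and Y :: "'y tvs"
  assumes "top_vector_space Z" "top_vector_space Y"
  shows "Ext_TVS Z Y = Ext_lin True Z Y"
proof -
  have cls: "tvs_ext_class Z Y E = ext_class_lin True Z Y E" for E :: "('y, 'x, 'z) tvs_extension"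
    by (simp add: tvs_ext_class_def ext_class_lin_def is_tvs_extension_iff[OF assms] tvs_ext_equiv_iff)
  show ?thesis
    by (simp add: Ext_TVS_def Ext_lin_def is_tvs_extension_iff[OF assms] cls)
qed

lemma ext_class_lin_cong:
  assumes "top_extension lin Z Y E" "top_extension lin Z Y E'" "pushes lin Y (\<lambda>y. y) E E'"
  shows "ext_class_lin lin Z Y E = ext_class_lin lin Z Y E'"
  unfolding ext_class_lin_def
  using pushes_id_trans[OF assms(3)] pushes_id_trans[OF pushes_id_sym[OF assms]] by blast

lemma ext_class_lin_eq_iff:
  assumes "top_extension lin Z Y E" "top_extension lin Z Y E'"
  shows "ext_class_lin lin Z Y E = ext_class_lin lin Z Y E' \<longleftrightarrow> pushes lin Y (\<lambda>y. y) E E'"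
proof
  assume eq: "ext_class_lin lin Z Y E = ext_class_lin lin Z Y E'"
  obtain E0 where "E0 \<in> ext_class_lin lin Z Y E'"
    using ex_small_top_extension[OF assms(2)] by (auto simp: ext_class_lin_def)
  then have "top_extension lin Z Y E0" "pushes lin Y (\<lambda>y. y) E E0" "pushes lin Y (\<lambda>y. y) E' E0"
    using eq by (auto simp: ext_class_lin_def)
  then show "pushes lin Y (\<lambda>y. y) E E'"
    using pushes_id_trans pushes_id_sym assms(2) by metis
qed (rule ext_class_lin_cong[OF assms])

lemma ext_class_lin_nonempty: "top_extension lin Z Y E \<Longrightarrow> ext_class_lin lin Z Y E \<noteq> {}"
  using ex_small_top_extension by (fastforce simp: ext_class_lin_def)

lemma ext_class_lin_in_Ext:
  fixes E :: "('y, 'x, 'z) tvs_extension"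
  assumes "top_extension lin Z Y E"
  shows "ext_class_lin lin Z Y E \<in> carrier (Ext_lin lin Z Y)"
proof -
  obtain E' :: "('y, 'y \<times> 'z, 'z) tvs_extension" where "top_extension lin Z Y E'" "pushes lin Y (\<lambda>y. y) E E'"
    using ex_small_top_extension[OF assms] by blast
  then show ?thesis using ext_class_lin_cong[OF assms] by (auto simp: Ext_lin_def)
qed

lemma Ext_lin_mult:
  assumes "top_extension lin Z Y E1" "top_extension lin Z Y E2"
  shows "ext_class_lin lin Z Y E1 \<otimes>\<^bsub>Ext_lin lin Z Y\<^esub> ext_class_lin lin Z Y E2 =
    ext_class_lin lin Z Y (tvs_baer_sum Z Y E1 E2)"
proof -
  have obj: "top_object lin Z" "top_object lin Y" using assms by (simp_all add: top_extension_def)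
  have "ext_class_lin lin Z Y (tvs_baer_sum Z Y E1' E2') = ext_class_lin lin Z Y (tvs_baer_sum Z Y E1 E2)"
    if E': "E1' \<in> ext_class_lin lin Z Y E1" "E2' \<in> ext_class_lin lin Z Y E2" for E1' E2'
  proof -
    have E'': "top_extension lin Z Y E1'" "top_extension lin Z Y E2'"
        "pushes lin Y (\<lambda>y. y) E1 E1'" "pushes lin Y (\<lambda>y. y) E2 E2'"
      using E' by (simp_all add: ext_class_lin_def)
    show ?thesis
      by (rule ext_class_lin_cong[symmetric, OF top_extension_baer_sum[OF assms]
            top_extension_baer_sum[OF E''(1,2)] baer_sum_cong[OF obj assms E'']])
  qed
  then show ?thesis
    using ext_class_lin_nonempty[OF assms(1)] ext_class_lin_nonempty[OF assms(2)]
    by (simp add: Ext_lin_def cong: SUP_cong)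
qed

lemma comm_group_Ext_lin:
  fixes Z :: "'z tvs" and Y :: "'y tvs"
  assumes Z: "top_object lin Z" and Y: "top_object lin Y"
  shows "comm_group (Ext_lin lin Z Y)"
proof -
  let ?c = "ext_class_lin lin Z Y"
  have carrier: "\<And>x. x \<in> carrier (Ext_lin lin Z Y) \<Longrightarrow>
      \<exists>E :: ('y, 'y \<times> 'z, 'z) tvs_extension. top_extension lin Z Y E \<and> x = ?c E"
    by (auto simp: Ext_lin_def)
  have one: "\<one>\<^bsub>Ext_lin lin Z Y\<^esub> = ?c (tvs_trivial_extension Z Y)" by (simp add: Ext_lin_def)
  note triv = top_extension_trivial[OF Z Y]
  note sum = top_extension_baer_sum
  show ?thesis
  proof (rule comm_groupI)
    show "\<one>\<^bsub>Ext_lin lin Z Y\<^esub> \<in> carrier (Ext_lin lin Z Y)"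
      unfolding one by (rule ext_class_lin_in_Ext[OF triv])
    fix x assume "x \<in> carrier (Ext_lin lin Z Y)"
    then obtain E1 :: "('y, 'y \<times> 'z, 'z) tvs_extension" where E1: "top_extension lin Z Y E1" "x = ?c E1"
      using carrier by blast
    show "\<one>\<^bsub>Ext_lin lin Z Y\<^esub> \<otimes>\<^bsub>Ext_lin lin Z Y\<^esub> x = x"
      unfolding one E1(2) Ext_lin_mult[OF triv E1(1)]
      by (rule ext_class_lin_cong[OF sum[OF triv E1(1)] E1(1) baer_sum_trivial[OF Z Y E1(1)]])
    obtain E' :: "('y, ('y \<times> 'y \<times> 'z) set, 'z) tvs_extension" where E': "top_extension lin Z Y E'"
        "pushes lin Y (\<lambda>y. y) (tvs_baer_sum Z Y E' E1) (tvs_trivial_extension Z Y)"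
      using ex_baer_sum_inverse[OF Z Y E1(1)] by blast
    have "?c E' \<otimes>\<^bsub>Ext_lin lin Z Y\<^esub> x = \<one>\<^bsub>Ext_lin lin Z Y\<^esub>"
      unfolding one E1(2) Ext_lin_mult[OF E'(1) E1(1)]
      by (rule ext_class_lin_cong[OF sum[OF E'(1) E1(1)] triv E'(2)])
    then show "\<exists>y\<in>carrier (Ext_lin lin Z Y). y \<otimes>\<^bsub>Ext_lin lin Z Y\<^esub> x = \<one>\<^bsub>Ext_lin lin Z Y\<^esub>"
      using ext_class_lin_in_Ext[OF E'(1)] by blast
    fix y assume "y \<in> carrier (Ext_lin lin Z Y)"
    then obtain E2 :: "('y, 'y \<times> 'z, 'z) tvs_extension" where E2: "top_extension lin Z Y E2" "y = ?c E2"
      using carrier by blast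
    show "x \<otimes>\<^bsub>Ext_lin lin Z Y\<^esub> y \<in> carrier (Ext_lin lin Z Y)"
      unfolding E1(2) E2(2) Ext_lin_mult[OF E1(1) E2(1)]
      by (rule ext_class_lin_in_Ext[OF sum[OF E1(1) E2(1)]])
    show "x \<otimes>\<^bsub>Ext_lin lin Z Y\<^esub> y = y \<otimes>\<^bsub>Ext_lin lin Z Y\<^esub> x"
      unfolding E1(2) E2(2) Ext_lin_mult[OF E1(1) E2(1)] Ext_lin_mult[OF E2(1) E1(1)]
      by (rule ext_class_lin_cong[OF sum[OF E1(1) E2(1)] sum[OF E2(1) E1(1)]
            baer_sum_comm[OF Z Y E1(1) E2(1)]])
    fix z assume "z \<in> carrier (Ext_lin lin Z Y)"
    then obtain E3 :: "('y, 'y \<times> 'z, 'z) tvs_extension" where E3: "top_extension lin Z Y E3" "z = ?c E3"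
      using carrier by blast
    note E12 = sum[OF E1(1) E2(1)] and E23 = sum[OF E2(1) E3(1)]
    show "x \<otimes>\<^bsub>Ext_lin lin Z Y\<^esub> y \<otimes>\<^bsub>Ext_lin lin Z Y\<^esub> z = x \<otimes>\<^bsub>Ext_lin lin Z Y\<^esub> (y \<otimes>\<^bsub>Ext_lin lin Z Y\<^esub> z)"
      unfolding E1(2) E2(2) E3(2) Ext_lin_mult[OF E1(1) E2(1)] Ext_lin_mult[OF E2(1) E3(1)]
        Ext_lin_mult[OF E12 E3(1)] Ext_lin_mult[OF E1(1) E23]
      by (rule ext_class_lin_cong[OF sum[OF E12 E3(1)] sum[OF E1(1) E23]
            baer_sum_assoc[OF Z Y E1(1) E2(1) E3(1)]])
  qed
qed

section \<open>Products of the coefficients\<close>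

text \<open>
  The isomorphism sends the class of \<open>E\<close> to the classes of its push-outs along the coordinate
  projections. It is a homomorphism because the \<open>i\<close>-th push-out of a Baer sum and the Baer sum of the
  \<open>i\<close>-th push-outs are both reached from \<open>diagonal_extension\<close> along \<open>w \<mapsto> fst w i + snd w i\<close>. It is injective
  because \<open>E\<close> is equivalent to the fibre product of its push-outs, and surjective because a fibre
  product pushes to each of its factors.
\<close>

lemma Ext_lin_tvs_Prod_iso:
  fixes Z :: "'z tvs" and Y :: "'i \<Rightarrow> 'y tvs"
  assumes Z: "top_object lin Z" and Y: "\<And>i. i \<in> I \<Longrightarrow> top_object lin (Y i)"
  shows "Ext_lin lin Z (tvs_Prod I Y) \<cong> product_group I (\<lambda>i. Ext_lin lin Z (Y i))"
proof -
  let ?P = "tvs_Prod I Y"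
  let ?c = "ext_class_lin lin Z ?P" and ?ci = "\<lambda>i. ext_class_lin lin Z (Y i)"
  let ?po = "\<lambda>i E. tvs_pushout_extension ?P (Y i) (\<lambda>y. y i) E"
  have P: "top_object lin ?P" by (rule top_object_tvs_Prod[OF Y])
  have closed: "y i \<in> carrier (Y i)" if "y \<in> carrier ?P" "i \<in> I" for y i
    using that by (simp add: PiE_iff)
  have po: "top_extension lin Z (Y i) (?po i E)" "pushes lin ?P (\<lambda>y. y i) E (?po i E)"
    if "top_extension lin Z ?P E" "i \<in> I" for i and E :: "('i \<Rightarrow> 'y, 'x, 'z) tvs_extension"
    using top_extension.top_extension_pushout[OF that(1) Y[OF that(2)] top_morphism_coord[OF that(2)]]
      top_extension.pushes_pushout[OF that(1) Y[OF that(2)] top_morphism_coord[OF that(2)]]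
    by blast+
  \<comment> \<open>\<open>\<Phi>\<close> is defined by means of representatives; by \<open>po_class\<close>, any representative will do\<close>
  have po_class: "?ci i (?po i E) = ?ci i Ei"
    if "top_extension lin Z ?P E" "i \<in> I" "top_extension lin Z (Y i) Ei" "pushes lin ?P (\<lambda>y. y i) E Ei"
    for i and E :: "('i \<Rightarrow> 'y, 'x, 'z) tvs_extension" and Ei :: "('y, 'x2, 'z) tvs_extension"
  proof (rule ext_class_lin_cong[OF po(1)[OF that(1,2)] that(3)])
    show "pushes lin (Y i) (\<lambda>y. y) (?po i E) Ei"
      by (rule pushes_unique[OF that(1) po(1)[OF that(1,2)] that(3) _ po(2)[OF that(1,2)] that(4)])
        (rule closed[OF _ that(2)])
  qed
  define \<Phi> :: "('i \<Rightarrow> 'y, ('i \<Rightarrow> 'y) \<times> 'z, 'z) tvs_extension set \<Rightarrow> _"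
    where "\<Phi> = (\<lambda>c. \<lambda>i\<in>I. ?ci i (?po i (SOME E. E \<in> c)))"
  have \<Phi>: "\<Phi> (?c E) = (\<lambda>i\<in>I. ?ci i (?po i E))" if E: "top_extension lin Z ?P E"
    for E :: "('i \<Rightarrow> 'y, 'x, 'z) tvs_extension"
  proof -
    define E' where "E' = (SOME E'. E' \<in> ?c E)"
    have "E' \<in> ?c E" unfolding E'_def using ext_class_lin_nonempty[OF E] by (rule some_in_eq[THEN iffD2])
    then have E': "top_extension lin Z ?P E'" "pushes lin ?P (\<lambda>y. y) E E'"
      by (simp_all add: ext_class_lin_def)
    have "?ci i (?po i E) = ?ci i (?po i E')" if i: "i \<in> I" for i
      by (rule po_class[OF E i po(1)[OF E'(1) i] pushes_compose[OF E'(2) po(2)[OF E'(1) i]]]) simp_all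
    then show ?thesis unfolding \<Phi>_def E'_def[symmetric] by (intro restrict_ext) simp
  qed
  have carrier: "\<exists>E :: ('i \<Rightarrow> 'y, ('i \<Rightarrow> 'y) \<times> 'z, 'z) tvs_extension. top_extension lin Z ?P E \<and> x = ?c E"
    if "x \<in> carrier (Ext_lin lin Z ?P)" for x
    using that by (auto simp: Ext_lin_def)
  have "\<Phi> \<in> iso (Ext_lin lin Z ?P) (product_group I (\<lambda>i. Ext_lin lin Z (Y i)))"
    unfolding iso_iff
  proof (intro conjI)
    show "\<Phi> \<in> hom (Ext_lin lin Z ?P) (product_group I (\<lambda>i. Ext_lin lin Z (Y i)))"
    proof (rule homI)
      fix x assume "x \<in> carrier (Ext_lin lin Z ?P)"
      then obtain E1 :: "('i \<Rightarrow> 'y, ('i \<Rightarrow> 'y) \<times> 'z, 'z) tvs_extension"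
        where E1: "top_extension lin Z ?P E1" "x = ?c E1" using carrier by blast
      show x: "\<Phi> x \<in> carrier (product_group I (\<lambda>i. Ext_lin lin Z (Y i)))"
        unfolding E1(2) \<Phi>[OF E1(1)] by (simp add: ext_class_lin_in_Ext po(1)[OF E1(1)])
      fix y assume "y \<in> carrier (Ext_lin lin Z ?P)"
      then obtain E2 :: "('i \<Rightarrow> 'y, ('i \<Rightarrow> 'y) \<times> 'z, 'z) tvs_extension"
        where E2: "top_extension lin Z ?P E2" "y = ?c E2" using carrier by blast
      note E12 = top_extension_baer_sum[OF E1(1) E2(1)]
      show "\<Phi> (x \<otimes>\<^bsub>Ext_lin lin Z ?P\<^esub> y) =
          \<Phi> x \<otimes>\<^bsub>product_group I (\<lambda>i. Ext_lin lin Z (Y i))\<^esub> \<Phi> y"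
      proof -
        have "?ci i (?po i (tvs_baer_sum Z ?P E1 E2)) =
            ?ci i (?po i E1) \<otimes>\<^bsub>Ext_lin lin Z (Y i)\<^esub> ?ci i (?po i E2)" if i: "i \<in> I" for i
        proof -
          note S = top_extension_diagonal[OF E1(1) E2(1)]
          let ?W = "tvs_prod ?P ?P" and ?S = "diagonal_extension Z E1 E2"
          have 1: "pushes lin ?W (\<lambda>w. fst w i) ?S (?po i E1)"
            by (rule pushes_compose[OF pushes_diagonal_fst[OF E1(1) E2(1)] po(2)[OF E1(1) i]]) auto
          have 2: "pushes lin ?W (\<lambda>w. snd w i) ?S (?po i E2)"
            by (rule pushes_compose[OF pushes_diagonal_snd[OF E1(1) E2(1)] po(2)[OF E2(1) i]]) auto
          have r: "pushes lin ?W (\<lambda>w. fst w i \<otimes>\<^bsub>Y i\<^esub> snd w i) ?S (tvs_baer_sum Z (Y i) (?po i E1) (?po i E2))"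
            by (rule pushes_baer_sum[OF po(1)[OF E1(1) i] po(1)[OF E2(1) i] S 1 _ 2])
              (auto simp: closed[OF _ i])
          have Pm: "fst w \<otimes>\<^bsub>?P\<^esub> snd w \<in> carrier ?P" if "w \<in> carrier ?W" for w
            using top_morphism_closed[OF top_morphism_mult_pair[OF P] that] by (simp add: case_prod_unfold)
          have "pushes lin ?W (\<lambda>w. fst w \<otimes>\<^bsub>?P\<^esub> snd w) ?S (tvs_baer_sum Z ?P E1 E2)"
            by (rule pushes_baer_sum[OF E1(1) E2(1) S pushes_diagonal_fst[OF E1(1) E2(1)] _
                  pushes_diagonal_snd[OF E1(1) E2(1)]]) auto
          then have l: "pushes lin ?W (\<lambda>w. fst w i \<otimes>\<^bsub>Y i\<^esub> snd w i) ?S (?po i (tvs_baer_sum Z ?P E1 E2))"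
            by (rule pushes_compose[OF _ po(2)[OF E12 i]]) (rule Pm, assumption, simp add: i)
          have cl: "fst w i \<otimes>\<^bsub>Y i\<^esub> snd w i \<in> carrier (Y i)" if "w \<in> carrier ?W" for w
            using closed[OF Pm[OF that] i] i by simp
          note sum = top_extension_baer_sum[OF po(1)[OF E1(1) i] po(1)[OF E2(1) i]]
          show ?thesis
            unfolding Ext_lin_mult[OF po(1)[OF E1(1) i] po(1)[OF E2(1) i]]
            by (rule ext_class_lin_cong[OF po(1)[OF E12 i] sum
                  pushes_unique[OF S po(1)[OF E12 i] sum cl l r]])
        qed
        then show ?thesis
          unfolding E1(2) E2(2) Ext_lin_mult[OF E1(1) E2(1)] \<Phi>[OF E1(1)] \<Phi>[OF E2(1)] \<Phi>[OF E12]
          by (simp cong: restrict_cong)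
      qed
    qed
  next
    show "inj_on \<Phi> (carrier (Ext_lin lin Z ?P))"
    proof (rule inj_onI)
      fix x y assume "x \<in> carrier (Ext_lin lin Z ?P)" and y: "y \<in> carrier (Ext_lin lin Z ?P)"
        and eq: "\<Phi> x = \<Phi> y"
      then obtain E1 :: "('i \<Rightarrow> 'y, ('i \<Rightarrow> 'y) \<times> 'z, 'z) tvs_extension"
        where E1: "top_extension lin Z ?P E1" "x = ?c E1" using carrier by blast
      from y obtain E2 :: "('i \<Rightarrow> 'y, ('i \<Rightarrow> 'y) \<times> 'z, 'z) tvs_extension"
        where E2: "top_extension lin Z ?P E2" "y = ?c E2" using carrier by blast
      have eq': "?ci i (?po i E1) = ?ci i (?po i E2)" if "i \<in> I" for i
        using fun_cong[OF eq, of i] that unfolding E1(2) E2(2) \<Phi>[OF E1(1)] \<Phi>[OF E2(1)] by simp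
      let ?F = "fibre_product_extension I Z (\<lambda>i. ?po i E2)"
      have F: "top_extension lin Z ?P ?F"
        by (rule top_extension_fibre_product[OF Z po(1)[OF E2(1)]])
      have 2: "pushes lin ?P (\<lambda>y. y) E2 ?F"
        by (rule pushes_into_fibre_product[OF Z po(1)[OF E2(1)] E2(1) po(2)[OF E2(1)]])
      have "pushes lin ?P (\<lambda>y. y i) E1 (?po i E2)" if i: "i \<in> I" for i
      proof -
        have "pushes lin (Y i) (\<lambda>y. y) (?po i E1) (?po i E2)"
          using eq'[OF i] ext_class_lin_eq_iff[OF po(1)[OF E1(1) i] po(1)[OF E2(1) i]] by blast
        then show ?thesis
          by (rule pushes_compose[OF po(2)[OF E1(1) i]]) (simp_all add: closed[OF _ i] del: tvs_Prod_simps)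
      qed
      from pushes_into_fibre_product[OF Z po(1)[OF E2(1)] E1(1) this]
      have 1: "pushes lin ?P (\<lambda>y. y) E1 ?F" .
      show "x = y"
        unfolding E1(2) E2(2)
        by (rule ext_class_lin_cong[OF E1(1) E2(1) pushes_id_trans[OF 1 pushes_id_sym[OF E2(1) F 2]]])
    qed
  next
    show "\<Phi> ` carrier (Ext_lin lin Z ?P) = carrier (product_group I (\<lambda>i. Ext_lin lin Z (Y i)))"
    proof (intro equalityI subsetI)
      fix c assume "c \<in> \<Phi> ` carrier (Ext_lin lin Z ?P)"
      then obtain E :: "('i \<Rightarrow> 'y, ('i \<Rightarrow> 'y) \<times> 'z, 'z) tvs_extension"
        where E: "top_extension lin Z ?P E" "c = \<Phi> (?c E)" using carrier by blast
      show "c \<in> carrier (product_group I (\<lambda>i. Ext_lin lin Z (Y i)))"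
        unfolding E(2) \<Phi>[OF E(1)] by (simp add: ext_class_lin_in_Ext po(1)[OF E(1)])
    next
      fix c assume c: "c \<in> carrier (product_group I (\<lambda>i. Ext_lin lin Z (Y i)))"
      then have "\<exists>E :: ('y, 'y \<times> 'z, 'z) tvs_extension. top_extension lin Z (Y i) E \<and> c i = ?ci i E"
        if "i \<in> I" for i
        using that by (auto simp: Ext_lin_def PiE_iff)
      then obtain E :: "'i \<Rightarrow> ('y, 'y \<times> 'z, 'z) tvs_extension"
        where E: "\<And>i. i \<in> I \<Longrightarrow> top_extension lin Z (Y i) (E i)" "\<And>i. i \<in> I \<Longrightarrow> c i = ?ci i (E i)"
        by metis
      let ?F = "fibre_product_extension I Z E"
      have F: "top_extension lin Z ?P ?F" by (rule top_extension_fibre_product[OF Z E(1)])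
      have "?ci i (?po i ?F) = c i" if i: "i \<in> I" for i
        unfolding E(2)[OF i]
        by (rule po_class[OF F i E(1)[OF i] pushes_fibre_product_coord[OF Z E(1) i]])
      then have "\<Phi> (?c ?F) = c"
        unfolding \<Phi>[OF F] using c by (intro ext) (simp add: PiE_iff extensional_def)
      then show "c \<in> \<Phi> ` carrier (Ext_lin lin Z ?P)"
        using ext_class_lin_in_Ext[OF F] by (metis image_eqI)
    qed
  qed
  then show ?thesis unfolding is_iso_def by blast
qed

section \<open>From vector spaces back to groups\<close>

lemma truncate_tvs_prod: "tgroup.truncate (tvs_prod A B) = tgroup_prod (tgroup.truncate A) (tgroup.truncate B)"
  by (simp add: tvs_prod_def tgroup_prod_def tgroup.defs tvs.defs monoid.defs DirProd_def)

lemma truncate_tvs_quotient: "tgroup.truncate (tvs_quotient A N) = tgroup_quotient (tgroup.truncate A) N"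
  by (simp add: tvs_quotient_def tgroup_quotient_def tgroup.defs tvs.defs monoid.defs FactGroup_def
      RCOSETS_def r_coset_def set_mult_def[abs_def])

lemma truncate_tvs_Prod: "tgroup.truncate (tvs_Prod I Y) = tgroup_Prod I (\<lambda>i. tgroup.truncate (Y i))"
  by (simp add: tvs_Prod_def tgroup_Prod_def tgroup.defs tvs.defs monoid.defs product_group_def)

lemma forget_scale_trivial:
  "forget_scale (tvs_trivial_extension Z Y) = trivial_extension (tgroup.truncate Z) (tgroup.truncate Y)"
  by (simp add: forget_scale_def tvs_trivial_extension_def trivial_extension_def truncate_tvs_prod)

lemma forget_scale_product:
  "forget_scale (tvs_product_extension E1 E2) = product_extension (forget_scale E1) (forget_scale E2)"
  by (simp add: forget_scale_def tvs_product_extension_def product_extension_def truncate_tvs_prod)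

lemma truncate_update:
  "tgroup.truncate (A\<lparr>carrier := S, topol := T\<rparr>) = (tgroup.truncate A)\<lparr>carrier := S, topol := T\<rparr>"
  by (simp add: tgroup.defs)

lemma forget_scale_pullback:
  "forget_scale (tvs_pullback_extension Z t E) = pullback_extension (tgroup.truncate Z) t (forget_scale E)"
  by (simp add: forget_scale_def tvs_pullback_extension_def pullback_extension_def Let_def
      truncate_update pullback_set_def flip: truncate_tvs_prod)

lemma forget_scale_pushout:
  "forget_scale (tvs_pushout_extension Y Y' a E) =
     pushout_extension (tgroup.truncate Y) (tgroup.truncate Y') a (forget_scale E)"
  by (simp add: forget_scale_def tvs_pushout_extension_def pushout_extension_def Let_def
      pushout_subgroup_def truncate_tvs_quotient flip: truncate_tvs_prod)

lemma forget_scale_baer_sum: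
  "forget_scale (tvs_baer_sum Z Y E1 E2) =
     baer_sum (tgroup.truncate Z) (tgroup.truncate Y) (forget_scale E1) (forget_scale E2)"
  by (simp add: tvs_baer_sum_def baer_sum_def forget_scale_pushout forget_scale_pullback
      forget_scale_product truncate_tvs_prod)

text \<open>
  Every extension of groups arises by forgetting a scalar multiplication, and two extensions are
  equivalent for \<open>lin = False\<close> if and only if their images are. So the image of a class is a class,
  and the Baer sum is preserved on the nose by \<open>forget_scale_baer_sum\<close>.
\<close>

lemma iso_forget_scale:
  fixes Z :: "'z tvs" and Y :: "'y tvs"
  assumes Z: "top_ab_group Z" and Y: "top_ab_group Y"
  shows "(\<lambda>c. forget_scale ` c) \<in> iso (Ext_lin False Z Y) (Ext (tgroup.truncate Z) (tgroup.truncate Y))"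
    and "forget_scale ` \<one>\<^bsub>Ext_lin False Z Y\<^esub> = \<one>\<^bsub>Ext (tgroup.truncate Z) (tgroup.truncate Y)\<^esub>"
proof -
  let ?G = "tgroup.truncate Z" and ?H = "tgroup.truncate Y"
  have obj: "top_object False Z" "top_object False Y" using Z Y by (simp_all add: top_object_def)
  have cls: "forget_scale ` ext_class_lin False Z Y E = ext_class ?G ?H (forget_scale E)"
    for E :: "('y, 'x, 'z) tvs_extension"
  proof (intro equalityI subsetI)
    fix E' assume "E' \<in> ext_class ?G ?H (forget_scale E)"
    moreover obtain E'' where "E' = forget_scale E''" using ex_forget_scale by metis
    ultimately show "E' \<in> forget_scale ` ext_class_lin False Z Y E"
      by (simp add: ext_class_def ext_class_lin_def is_extension_forget_scale_iff[OF Z Y]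
          ext_equiv_forget_scale_iff)
  qed (auto simp: ext_class_def ext_class_lin_def is_extension_forget_scale_iff[OF Z Y]
      ext_equiv_forget_scale_iff)
  show "forget_scale ` \<one>\<^bsub>Ext_lin False Z Y\<^esub> = \<one>\<^bsub>Ext ?G ?H\<^esub>"
    by (simp add: Ext_lin_def Ext_def cls forget_scale_trivial)
  have carrier: "carrier (Ext ?G ?H) = (\<lambda>c. forget_scale ` c) ` carrier (Ext_lin False Z Y)"
  proof -
    have "{E :: ('y, 'y \<times> 'z, 'z) tgroup_extension. is_extension ?G ?H E} =
        forget_scale ` {E :: ('y, 'y \<times> 'z, 'z) tvs_extension. top_extension False Z Y E}"
    proof (intro equalityI subsetI)
      fix E' :: "('y, 'y \<times> 'z, 'z) tgroup_extension"
      assume "E' \<in> {E. is_extension ?G ?H E}"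
      moreover obtain E where "E' = forget_scale E" using ex_forget_scale by metis
      ultimately show "E' \<in> forget_scale ` {E. top_extension False Z Y E}"
        by (simp add: is_extension_forget_scale_iff[OF Z Y])
    qed (auto simp: is_extension_forget_scale_iff[OF Z Y])
    then have "carrier (Ext ?G ?H) = ext_class ?G ?H ` forget_scale `
        {E :: ('y, 'y \<times> 'z, 'z) tvs_extension. top_extension False Z Y E}"
      by (simp only: Ext_def partial_object.simps)
    then show ?thesis by (simp add: Ext_lin_def image_image cls)
  qed
  show "(\<lambda>c. forget_scale ` c) \<in> iso (Ext_lin False Z Y) (Ext ?G ?H)"
    unfolding iso_iff
  proof (intro conjI)
    show "(\<lambda>c. forget_scale ` c) \<in> hom (Ext_lin False Z Y) (Ext ?G ?H)"
    proof (rule homI)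
      show "forget_scale ` c \<in> carrier (Ext ?G ?H)" if "c \<in> carrier (Ext_lin False Z Y)" for c
        using that by (simp add: carrier)
      show "forget_scale ` (c \<otimes>\<^bsub>Ext_lin False Z Y\<^esub> d) =
          forget_scale ` c \<otimes>\<^bsub>Ext ?G ?H\<^esub> forget_scale ` d" for c d
        by (simp add: Ext_lin_def Ext_def image_UN cls forget_scale_baer_sum)
    qed
    show "inj_on (\<lambda>c. forget_scale ` c) (carrier (Ext_lin False Z Y))"
    proof (rule inj_onI)
      fix c d assume cd: "c \<in> carrier (Ext_lin False Z Y)" "d \<in> carrier (Ext_lin False Z Y)"
        and eq: "forget_scale ` c = forget_scale ` d"
      from cd(1) obtain E1 :: "('y, 'y \<times> 'z, 'z) tvs_extension"
        where E1: "top_extension False Z Y E1" "c = ext_class_lin False Z Y E1"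
        unfolding Ext_lin_def partial_object.simps by blast
      from cd(2) obtain E2 :: "('y, 'y \<times> 'z, 'z) tvs_extension"
        where E2: "top_extension False Z Y E2" "d = ext_class_lin False Z Y E2"
        unfolding Ext_lin_def partial_object.simps by blast
      have "E1 \<in> c" using E1 pushes_id[of False Y E1] by (simp add: ext_class_lin_def)
      then have "forget_scale E1 \<in> forget_scale ` d" using eq by blast
      then obtain E' where E': "E' \<in> d" "forget_scale E1 = forget_scale E'" by blast
      have "pushes False Y (\<lambda>y. y) E2 E'" using E'(1) by (simp add: E2(2) ext_class_lin_def)
      then have "pushes False Y (\<lambda>y. y) E2 E1"
        by (simp only: ext_equiv_forget_scale_iff[symmetric] E'(2))
      then show "c = d" unfolding E1(2) E2(2) using ext_class_lin_cong[OF E2(1) E1(1)] by simp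
    qed
  qed (simp add: carrier)
qed

lemma comm_group_product_group:
  assumes "\<And>i. i \<in> I \<Longrightarrow> comm_group (A i)"
  shows "comm_group (product_group I A)"
proof (rule group.group_comm_groupI)
  show "group (product_group I A)"
    using assms by (intro product_group) (simp add: comm_group_def)
  fix x y assume "x \<in> carrier (product_group I A)" "y \<in> carrier (product_group I A)"
  then show "x \<otimes>\<^bsub>product_group I A\<^esub> y = y \<otimes>\<^bsub>product_group I A\<^esub> x"
    using assms by (auto simp: PiE_iff comm_group_def comm_monoid.m_comm intro!: restrict_ext)
qed

lemma isomorphic_Ext_lin_tvs_Prod:
  assumes Z: "top_object lin Z" and Y: "\<And>i. i \<in> I \<Longrightarrow> top_object lin (Y i)"
  shows "isomorphic_ab_groups (Ext_lin lin Z (tvs_Prod I Y)) (product_group I (\<lambda>i. Ext_lin lin Z (Y i)))"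
  unfolding isomorphic_ab_groups_def
  by (intro conjI comm_group_product_group comm_group_Ext_lin top_object_tvs_Prod
      Ext_lin_tvs_Prod_iso Z Y)

lemma isomorphic_Ext_forget_scale:
  assumes Z: "top_ab_group Z" and Y: "top_ab_group Y"
  shows "isomorphic_ab_groups (Ext_lin False Z Y) (Ext (tgroup.truncate Z) (tgroup.truncate Y))"
proof -
  let ?A = "Ext_lin False Z Y" and ?B = "Ext (tgroup.truncate Z) (tgroup.truncate Y)"
  have A: "comm_group ?A" using Z Y by (intro comm_group_Ext_lin) (simp_all add: top_object_def)
  have "comm_group (?B\<lparr>one := forget_scale ` \<one>\<^bsub>?A\<^esub>\<rparr>)"
    by (rule comm_group.iso_imp_img_comm_group[OF A iso_forget_scale(1)[OF Z Y]])
  moreover have "?B\<lparr>one := forget_scale ` \<one>\<^bsub>?A\<^esub>\<rparr> = ?B"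
    unfolding iso_forget_scale(2)[OF Z Y] by simp
  ultimately have "comm_group ?B" by simp
  then show ?thesis
    using A is_isoI[OF iso_forget_scale(1)[OF Z Y]] by (simp add: isomorphic_ab_groups_def)
qed

lemma isomorphic_Ext_tgroup_Prod:
  fixes G :: "'g tgroup" and H :: "'i \<Rightarrow> 'h tgroup"
  assumes G: "top_ab_group G" and H: "\<And>i. i \<in> I \<Longrightarrow> top_ab_group (H i)"
  shows "isomorphic_ab_groups (Ext G (tgroup_Prod I H)) (product_group I (\<lambda>i. Ext G (H i)))"
proof -
  let ?Z = "lift_tgroup G" and ?Y = "\<lambda>i. lift_tgroup (H i)"
  have Z: "top_ab_group ?Z" using G top_ab_group_truncate_iff[of ?Z] by simp
  have Y: "top_ab_group (?Y i)" if "i \<in> I" for i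
    using H[OF that] top_ab_group_truncate_iff[of "?Y i"] by simp
  have P: "top_ab_group (tvs_Prod I ?Y)"
    using top_object_tvs_Prod[of I False ?Y] Y by (simp add: top_object_def)
  have "isomorphic_ab_groups (Ext_lin False ?Z (tvs_Prod I ?Y)) (Ext G (tgroup_Prod I H))"
    using isomorphic_Ext_forget_scale[OF Z P] by (simp add: truncate_tvs_Prod)
  then have 1: "comm_group (Ext G (tgroup_Prod I H))"
      "Ext G (tgroup_Prod I H) \<cong> Ext_lin False ?Z (tvs_Prod I ?Y)"
    by (auto simp: isomorphic_ab_groups_def comm_group_def intro: group.iso_sym)
  have 2: "isomorphic_ab_groups (Ext_lin False ?Z (tvs_Prod I ?Y))
      (product_group I (\<lambda>i. Ext_lin False ?Z (?Y i)))"
    using Z Y by (intro isomorphic_Ext_lin_tvs_Prod) (simp_all add: top_object_def)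
  have 3: "isomorphic_ab_groups (Ext_lin False ?Z (?Y i)) (Ext G (H i))" if "i \<in> I" for i
    using isomorphic_Ext_forget_scale[OF Z Y[OF that]] by simp
  then have "product_group I (\<lambda>i. Ext_lin False ?Z (?Y i)) \<cong> product_group I (\<lambda>i. Ext G (H i))"
    by (intro iso_product_groupI) (simp_all add: isomorphic_ab_groups_def comm_group_def)
  with 1(2) 2 have "Ext G (tgroup_Prod I H) \<cong> product_group I (\<lambda>i. Ext G (H i))"
    unfolding isomorphic_ab_groups_def by (blast intro: iso_trans)
  moreover have "comm_group (product_group I (\<lambda>i. Ext G (H i)))"
    using 3 by (intro comm_group_product_group) (simp add: isomorphic_ab_groups_def)
  ultimately show ?thesis using 1(1) by (simp add: isomorphic_ab_groups_def)
qed

lemma isomorphic_Ext_TVS_tvs_Prod: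
  fixes Z :: "'z tvs" and Y :: "'i \<Rightarrow> 'y tvs"
  assumes Z: "top_vector_space Z" and Y: "\<And>i. i \<in> I \<Longrightarrow> top_vector_space (Y i)"
  shows "isomorphic_ab_groups (Ext_TVS Z (tvs_Prod I Y)) (product_group I (\<lambda>i. Ext_TVS Z (Y i)))"
proof -
  have "top_vector_space (tvs_Prod I Y)"
    using top_object_tvs_Prod[of I True Y] Y by (simp add: top_object_True_iff)
  then have "Ext_TVS Z (tvs_Prod I Y) = Ext_lin True Z (tvs_Prod I Y)" by (rule Ext_TVS_eq[OF Z])
  moreover have "product_group I (\<lambda>i. Ext_TVS Z (Y i)) = product_group I (\<lambda>i. Ext_lin True Z (Y i))"
    using Y by (simp add: product_group_def Ext_TVS_eq[OF Z] cong: PiE_cong restrict_cong)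
  moreover have "isomorphic_ab_groups (Ext_lin True Z (tvs_Prod I Y)) (product_group I (\<lambda>i. Ext_lin True Z (Y i)))"
    by (rule isomorphic_Ext_lin_tvs_Prod) (simp_all add: top_object_True_iff Z Y)
  ultimately show ?thesis by simp
qed

theorem theorem16:
  fixes I :: "'i set"
    and G :: "'g tgroup" and H :: "'i \<Rightarrow> 'h tgroup"
    and Z :: "'z tvs" and Y :: "'i \<Rightarrow> 'y tvs"
  shows "(top_ab_group G \<and> (\<forall>\<alpha>\<in>I. top_ab_group (H \<alpha>)) \<longrightarrow>
           isomorphic_ab_groups (Ext G (tgroup_Prod I H)) (product_group I (\<lambda>\<alpha>. Ext G (H \<alpha>)))) \<and>
         (top_vector_space Z \<and> (\<forall>\<alpha>\<in>I. top_vector_space (Y \<alpha>)) \<longrightarrow>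
           isomorphic_ab_groups (Ext_TVS Z (tvs_Prod I Y)) (product_group I (\<lambda>\<alpha>. Ext_TVS Z (Y \<alpha>))))"
  by (intro conjI impI isomorphic_Ext_tgroup_Prod isomorphic_Ext_TVS_tvs_Prod) simp_all

end
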